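(* Let $n\ge1$ and $M\ge n$. Let $\{f_k\,d\gamma\}_{k\ge1}$ be a sequence of centered probability measures on $\mathbb{R}^n$ with $\sqrt{f_k}\in W^{1,2}(\mathbb{R}^n,d\gamma)$ and $\int_{\mathbb{R}^n}|x|^2f_k\,d\gamma\le M$ for all $k$. If $\delta(f_k)\to0$ as $k\to\infty$, then $f_k\to1$ in $L^1(\mathbb{R}^n,d\gamma)$.
   Context: On $\mathbb{R}^n$, $d\gamma=(2\pi)^{-n/2}e^{-|x|^2/2}dx$ is the standard Gaussian measure. For a probability measure $f\,d\gamma$ with $\sqrt f\in W^{1,2}(\mathbb{R}^n,d\gamma)$, the Fisher information is $\mathrm{I}(f)=\int \frac{|\nabla f|^2}{f}\,d\gamma$, the relative entropy is $\mathrm{H}(f)=\int f\log f\,d\gamma$, and the log-Sobolev deficit is $\delta(f)=\frac12 \mathrm{I}(f)-\mathrm{H}(f)\ge 0$. A probability measure $\mu$ is centered if $\int x\,d\mu=0$. *)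

theory Defs
  imports "HOL-Probability.Probability"
begin

definition std_gaussian :: "'a::euclidean_space measure" where
  "std_gaussian = density lborel
     (\<lambda>x. ennreal ((2 * pi) powr (- (real DIM('a) / 2)) * exp (- (norm x)\<^sup>2 / 2)))"

definition partial_deriv :: "'a::euclidean_space \<Rightarrow> ('a \<Rightarrow> real) \<Rightarrow> 'a \<Rightarrow> real" where
  "partial_deriv i \<phi> x = frechet_derivative \<phi> (at x) i"

text \<open>Requiring differentiability, and not just existence of the partial derivatives, loses
  nothing: functions with continuous partial derivatives are differentiable.\<close>

primrec Ck :: "nat \<Rightarrow> ('a::euclidean_space \<Rightarrow> real) \<Rightarrow> bool" where
  "Ck 0 \<phi> \<longleftrightarrow> continuous_on UNIV \<phi>"
| "Ck (Suc k) \<phi> \<longleftrightarrow> (\<forall>x. \<phi> differentiable (at x)) \<and> (\<forall>i\<in>Basis. Ck k (partial_deriv i \<phi>))"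

definition test_function :: "('a::euclidean_space \<Rightarrow> real) \<Rightarrow> bool" where
  "test_function \<phi> \<longleftrightarrow> (\<forall>k. Ck k \<phi>) \<and> compact (closure {x. \<phi> x \<noteq> 0})"

definition locally_integrable ::
    "('a::euclidean_space \<Rightarrow> 'b::{banach, second_countable_topology}) \<Rightarrow> bool" where
  "locally_integrable g \<longleftrightarrow>
     g \<in> borel_measurable borel \<and> (\<forall>K. compact K \<longrightarrow> set_integrable lborel K g)"

text \<open>Weak gradients are distributional, with respect to Lebesgue measure, also for the
  Gaussian Sobolev space below.\<close>

definition has_weak_gradient ::
    "('a::euclidean_space \<Rightarrow> real) \<Rightarrow> ('a \<Rightarrow> 'a) \<Rightarrow> bool" where
  "has_weak_gradient g v \<longleftrightarrow>
     locally_integrable g \<and> locally_integrable v \<and>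
     (\<forall>\<phi>. test_function \<phi> \<longrightarrow>
        (\<forall>i\<in>Basis. (LINT x|lborel. g x * partial_deriv i \<phi> x)
                  = - (LINT x|lborel. (v x \<bullet> i) * \<phi> x)))"

text \<open>Weak gradients are unique up to null sets, so the choice does not affect integrals.\<close>

definition weak_gradient :: "('a::euclidean_space \<Rightarrow> real) \<Rightarrow> 'a \<Rightarrow> 'a" where
  "weak_gradient g = (SOME v. has_weak_gradient g v)"

definition gaussian_W12 :: "('a::euclidean_space \<Rightarrow> real) set" where
  "gaussian_W12 = {g. g \<in> borel_measurable borel \<and>
     integrable std_gaussian (\<lambda>x. (g x)\<^sup>2) \<and>
     (\<exists>v. has_weak_gradient g v \<and> integrable std_gaussian (\<lambda>x. (norm (v x))\<^sup>2))}"

definition gaussian_prob_density :: "('a::euclidean_space \<Rightarrow> real) \<Rightarrow> bool" where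
  "gaussian_prob_density f \<longleftrightarrow>
     f \<in> borel_measurable borel \<and> (AE x in std_gaussian. 0 \<le> f x) \<and>
     prob_space (density std_gaussian (\<lambda>x. ennreal (f x)))"

definition centered :: "'a::euclidean_space measure \<Rightarrow> bool" where
  "centered \<mu> \<longleftrightarrow> integrable \<mu> (\<lambda>x. x) \<and> (LINT x|\<mu>. x) = 0"

text \<open>If \<open>f\<close> is a probability density with \<open>sqrt f\<close> in the Gaussian Sobolev space, then \<open>f\<close> has
  the weak gradient \<open>2 * sqrt f\<close> times that of \<open>sqrt f\<close>, and the integrands below are integrable
  (for \<open>f * ln f\<close> by the logarithmic Sobolev inequality), so the real-valued integrals are not
  defaulting to 0. The conventions \<open>y / 0 = 0\<close> and \<open>0 * ln 0 = 0\<close> give the usual readings on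
  the set where \<open>f\<close> vanishes; there the weak gradient of \<open>f\<close> is 0 almost everywhere.\<close>

definition fisher_information :: "('a::euclidean_space \<Rightarrow> real) \<Rightarrow> real" where
  "fisher_information f = (LINT x|std_gaussian. (norm (weak_gradient f x))\<^sup>2 / f x)"

definition relative_entropy :: "('a::euclidean_space \<Rightarrow> real) \<Rightarrow> real" where
  "relative_entropy f = (LINT x|std_gaussian. f x * ln (f x))"

definition log_sobolev_deficit :: "('a::euclidean_space \<Rightarrow> real) \<Rightarrow> real" where
  "log_sobolev_deficit f = fisher_information f / 2 - relative_entropy f"

end

theory Submission
  imports Defs "HOL-Real_Asymp.Real_Asymp"
begin

text \<open>For \<open>c = cos \<theta>\<close>, \<open>s = sin \<theta>\<close> let \<open>P\<^sub>\<theta> h x\<close> be the mean of \<open>h (c x + s z)\<close> over Gaussian \<open>z\<close>, an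
  Ornstein-Uhlenbeck average. For a smooth density \<open>f\<close> with gradient \<open>V\<close> and mass 1, differentiating the entropy
  of \<open>P\<^sub>\<theta> f\<close> in \<open>\<theta>\<close> gives that the deficit of \<open>f\<close> is the integral over \<open>[0, \<pi>/2]\<close> of
  \<open>s c (I - \<integral> \<bar>P\<^sub>\<theta> V\<bar>\<^sup>2 / P\<^sub>\<theta> f)\<close>, where \<open>I\<close> is the Fisher information.
  By Cauchy-Schwarz the bracket is at least
  \<open>(\<parallel>V\<parallel>\<^sub>1 - \<parallel>P\<^sub>\<theta> V\<parallel>\<^sub>1)\<^sup>2\<close> when the difference is nonnegative.
  If \<open>f\<close> is centered, then \<open>\<parallel>P\<^sub>\<theta> V\<parallel>\<^sub>1\<close> is at most a constant times \<open>(c / s) (1 + M)\<close>, so for \<open>\<theta>\<close> close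
  to \<open>\<pi>/2\<close> a small deficit forces \<open>\<parallel>V\<parallel>\<^sub>1\<close> to be small, and the \<open>L\<^sup>1\<close> Poincare inequality bounds
  \<open>\<parallel>f - 1\<parallel>\<^sub>1\<close> by a multiple of \<open>\<parallel>V\<parallel>\<^sub>1\<close>. The resulting inequality survives the
  passage from smooth densities to all \<open>f\<close> with \<open>sqrt f\<close> in the Sobolev space, by cutting off and mollifying
  \<open>sqrt f\<close>; no compactness and no characterization of the equality case is needed.\<close>

section \<open>The standard Gaussian measure\<close>

text \<open>The angle replaces heat-flow time because \<open>rot \<theta>\<close> preserves the
  product of two Gaussians: the estimates become changes of variables on pairs, the parameter runs
  over a bounded interval, and \<open>sin \<theta> * cos \<theta>\<close> has total weight 1/2.
  Centering matters because the averaged gradient tends to the barycenter as \<theta> approaches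
  \<open>pi / 2\<close>; translated Gaussians have deficit zero and are excluded only by it. Two
  features shape the inequality that is carried to the limit. Cutting off and mollifying destroy
  mass 1 and centering, so the mass \<open>m\<close>, the term \<open>m * ln m\<close> and the
  barycenter stay in it until the end. The squared L1 gap is replaced by
  \<open>2 * l * gap - l\<^sup>2 * m\<close> with a free \<open>l \<ge> 0\<close>: this comes from a
  pointwise Young inequality, asks for no sign of the gap and is continuous in the data, so that
  only the entropy needs lower semicontinuity, which is Fatou's lemma. The angle is fixed before the
  free parameter, to make \<open>cos \<theta> / sin \<theta>\<close> small compared with the moment
  bound.\<close>

definition gaussian_density :: "'a::euclidean_space \<Rightarrow> real" where
  "gaussian_density x = (2 * pi) powr (- (real DIM('a) / 2)) * exp (- (norm x)\<^sup>2 / 2)"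

lemma gaussian_density_pos: "0 < gaussian_density x"
  by (simp add: gaussian_density_def)

lemma gaussian_density_nonneg [simp]: "0 \<le> gaussian_density x"
  using gaussian_density_pos[of x] by simp

lemma gaussian_density_measurable [measurable]: "gaussian_density \<in> borel_measurable borel"
  unfolding gaussian_density_def[abs_def] by measurable

lemma std_gaussian_eq: "std_gaussian = density lborel (\<lambda>x. ennreal (gaussian_density x))"
  by (simp add: std_gaussian_def gaussian_density_def)

lemma sets_std_gaussian [simp, measurable_cong]: "sets std_gaussian = sets borel"
  and space_std_gaussian [simp]: "space std_gaussian = UNIV"
  by (simp_all add: std_gaussian_def)

text \<open>The squared norm is the sum of the squared coordinates, so the density splits into
  one-dimensional normal densities and its total mass reduces to theirs.\<close>

lemma gaussian_density_eq_prod: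
  fixes x :: "'a::euclidean_space"
  shows "gaussian_density x = (\<Prod>b\<in>Basis. std_normal_density (x \<bullet> b))"
proof -
  have n: "(norm x)\<^sup>2 = (\<Sum>b\<in>Basis. (x \<bullet> b)\<^sup>2)"
    unfolding power2_norm_eq_inner by (subst euclidean_inner) (simp add: power2_eq_square)
  have d: "std_normal_density t = (2*pi) powr (-1/2) * exp (- t\<^sup>2 / 2)" for t
    by (simp add: std_normal_density_def powr_minus powr_half_sqrt divide_simps)
  have "(\<Prod>b\<in>Basis. std_normal_density (x \<bullet> b)) =
    (\<Prod>b\<in>(Basis::'a set). (2*pi) powr (-1/2)) * (\<Prod>b\<in>Basis. exp (- (x \<bullet> b)\<^sup>2 / 2))"
    unfolding d by (rule prod.distrib)
  also have "(\<Prod>b\<in>(Basis::'a set). (2*pi) powr (-1/2)) = (2 * pi) powr (- (real DIM('a) / 2))"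
    by (simp add: powr_power)
  also have "(\<Prod>b\<in>Basis. exp (- (x \<bullet> b)\<^sup>2 / 2)) = exp (- (norm x)\<^sup>2 / 2)"
    by (simp add: n exp_sum[symmetric] sum_negf sum_divide_distrib)
  finally show ?thesis by (simp add: gaussian_density_def)
qed

lemma prob_space_std_gaussian: "prob_space (std_gaussian :: 'a::euclidean_space measure)"
proof
  have 1: "(\<integral>\<^sup>+x. ennreal (std_normal_density x) \<partial>lborel) = 1"
    by (subst nn_integral_eq_integral) (auto intro: integrable_normal_density)
  have "emeasure (std_gaussian :: 'a measure) (space std_gaussian) =
     (\<integral>\<^sup>+x. ennreal (gaussian_density (x::'a)) \<partial>lborel)"
    by (simp add: std_gaussian_eq emeasure_density)
  also have "\<dots> = (\<integral>\<^sup>+x. (\<Prod>b\<in>Basis. ennreal (std_normal_density ((x::'a) \<bullet> b))) \<partial>lborel)"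
    by (simp add: gaussian_density_eq_prod prod_ennreal)
  also have "\<dots> = (\<Prod>b\<in>(Basis::'a set). (\<integral>\<^sup>+x. ennreal (std_normal_density x) \<partial>lborel))"
    by (rule nn_integral_lborel_prod) auto
  finally show "emeasure (std_gaussian :: 'a measure) (space std_gaussian) = 1"
    by (simp add: 1)
qed

interpretation std_gaussian: prob_space "std_gaussian :: 'a::euclidean_space measure"
  by (rule prob_space_std_gaussian)

interpretation std_gaussian_pair: pair_prob_space
  "std_gaussian :: 'a::euclidean_space measure" "std_gaussian :: 'a measure" ..

lemma integrable_gaussian_density: "integrable lborel (gaussian_density :: 'a::euclidean_space \<Rightarrow> real)"
proof -
  have "(\<integral>\<^sup>+x. ennreal (gaussian_density (x::'a)) \<partial>lborel) = 1"
    using std_gaussian.emeasure_space_1[where 'a='a]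
    by (simp add: std_gaussian_eq emeasure_density)
  then show ?thesis by (intro integrableI_nonneg) auto
qed

lemma integrable_std_gaussian_iff:
  fixes h :: "'a::euclidean_space \<Rightarrow> 'b::{banach, second_countable_topology}"
  assumes [measurable]: "h \<in> borel_measurable borel"
  shows "integrable std_gaussian h \<longleftrightarrow> integrable lborel (\<lambda>x. gaussian_density x *\<^sub>R h x)"
  unfolding std_gaussian_eq by (rule integrable_density) auto

lemma integral_std_gaussian:
  fixes h :: "'a::euclidean_space \<Rightarrow> 'b::{banach, second_countable_topology}"
  assumes [measurable]: "h \<in> borel_measurable borel"
  shows "(LINT x|std_gaussian. h x) = (LINT x|lborel. gaussian_density x *\<^sub>R h x)"
  unfolding std_gaussian_eq by (rule integral_density) auto

lemma AE_std_gaussian_iff: "(AE x in std_gaussian. P x) \<longleftrightarrow> (AE x in lborel. P x)"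
  unfolding std_gaussian_eq by (subst AE_density) (auto simp: gaussian_density_pos)

lemma nn_integral_lborel_scale:
  fixes g :: "'a::euclidean_space \<Rightarrow> ennreal"
  assumes [measurable]: "g \<in> borel_measurable borel" and "s \<noteq> 0"
  shows "(\<integral>\<^sup>+x. g x \<partial>lborel) = ennreal (\<bar>s\<bar>^DIM('a)) * (\<integral>\<^sup>+x. g (t + s *\<^sub>R x) \<partial>lborel)"
  by (subst lborel_affine[OF \<open>s \<noteq> 0\<close>, of t])
     (simp add: nn_integral_density nn_integral_distr nn_integral_cmult)

text \<open>Half of the exponent absorbs the square: \<open>t * exp (- t / 2)\<close> is at most
  \<open>4 * exp (- t / 4)\<close>, and this majorant is a multiple of the density at
  \<open>x / sqrt 2\<close>, integrable by scaling. No moment has to be computed.\<close>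

lemma integrable_std_gaussian_norm_sq:
  "integrable std_gaussian (\<lambda>x::'a::euclidean_space. (norm x)\<^sup>2)"
proof -
  have s: "integrable lborel (\<lambda>x::'a. gaussian_density ((1 / sqrt 2) *\<^sub>R x))"
  proof (rule integrableI_bounded)
    have "(\<integral>\<^sup>+ x. ennreal (gaussian_density x) \<partial>(lborel :: 'a measure)) =
      ennreal (\<bar>1 / sqrt 2\<bar>^DIM('a)) * (\<integral>\<^sup>+ x. ennreal (gaussian_density ((1 / sqrt 2) *\<^sub>R (x::'a))) \<partial>lborel)"
      using nn_integral_lborel_scale[of "\<lambda>x::'a. ennreal (gaussian_density x)" "1 / sqrt 2" 0] by simp
    moreover have "(\<integral>\<^sup>+ x. ennreal (gaussian_density x) \<partial>(lborel :: 'a measure)) < \<infinity>"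
      using integrable_gaussian_density[where 'a='a] by (simp add: integrable_iff_bounded)
    moreover have "ennreal (\<bar>1 / sqrt 2\<bar>^DIM('a)) \<noteq> 0" by (simp add: ennreal_eq_0_iff not_le)
    ultimately show "(\<integral>\<^sup>+ x. ennreal (norm (gaussian_density ((1 / sqrt 2) *\<^sub>R (x::'a)))) \<partial>lborel) < \<infinity>"
      by (auto simp: ennreal_mult_less_top simp del: abs_divide)
  qed auto
  have "integrable lborel (\<lambda>x::'a. gaussian_density x * (norm x)\<^sup>2)"
  proof (rule Bochner_Integration.integrable_bound)
    show "integrable lborel (\<lambda>x::'a. 4 * gaussian_density ((1 / sqrt 2) *\<^sub>R x))"
      using s by simp
    have "exp (- t / 2) * t \<le> 4 * exp (- t / 4)" if "t \<ge> 0" for t :: real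
    proof -
      have "t \<le> 4 * exp (t / 4)" using exp_ge_add_one_self[of "t/4"] by linarith
      then have "exp (- t / 2) * t \<le> exp (-t/2) * (4 * exp (t / 4))" by (intro mult_left_mono) auto
      also have "\<dots> = 4 * (exp (-t/2) * exp (t/4))" by simp
      also have "exp (-t/2) * exp (t/4) = exp (-t/4)" by (subst exp_add[symmetric]) (simp add: field_simps)
      finally show ?thesis .
    qed
    from this[of "(norm x)\<^sup>2" for x :: 'a]
    show "AE x in lborel. norm (gaussian_density (x::'a) * (norm x)\<^sup>2) \<le> norm (4 * gaussian_density ((1 / sqrt 2) *\<^sub>R x))"
      by (auto simp: gaussian_density_def power_mult_distrib power_divide mult_left_mono
          mult.assoc mult.left_commute[of 4] simp del: mult_minus_left)
  qed auto
  then show ?thesis by (subst integrable_std_gaussian_iff) auto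
qed

lemma integrable_std_gaussian_norm:
  "integrable std_gaussian (\<lambda>x::'a::euclidean_space. norm x)"
proof (rule Bochner_Integration.integrable_bound)
  show "integrable std_gaussian (\<lambda>x::'a. 1 + (norm x)\<^sup>2)"
    using integrable_std_gaussian_norm_sq by auto
  have "r \<le> 1 + r\<^sup>2" if "r \<ge> 0" for r :: real
    using sum_power2_ge_zero[of "r-1" 0] that by (simp add: power2_eq_square algebra_simps)
  then show "AE x in std_gaussian. norm (norm (x::'a)) \<le> norm (1 + (norm x)\<^sup>2)" by auto
qed auto

section \<open>Orthogonal changes of variables on pairs of independent Gaussians\<close>

text \<open>The block matrix with rows (c, s) and (s, -c) is symmetric and orthogonal. Taking this
  reflection instead of the rotation by \<theta> makes the map its own inverse, so the same map
  leads to the new variables and back.\<close>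

definition rot :: "real \<Rightarrow> 'a::euclidean_space \<times> 'a \<Rightarrow> 'a \<times> 'a" where
  "rot \<theta> = (\<lambda>(x, z). (cos \<theta> *\<^sub>R x + sin \<theta> *\<^sub>R z, sin \<theta> *\<^sub>R x - cos \<theta> *\<^sub>R z))"

lemma rot_measurable [measurable]: "rot \<theta> \<in> borel \<Otimes>\<^sub>M borel \<rightarrow>\<^sub>M borel \<Otimes>\<^sub>M borel"
  unfolding rot_def by measurable

lemma nn_integral_std_gaussian:
  assumes [measurable]: "h \<in> borel_measurable borel"
  shows "(\<integral>\<^sup>+x. h x \<partial>std_gaussian) = (\<integral>\<^sup>+x. ennreal (gaussian_density x) * h x \<partial>lborel)"
  unfolding std_gaussian_eq by (rule nn_integral_density) auto

lemma norm_rot_sq: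
  fixes x z :: "'a::euclidean_space"
  shows "(norm (cos \<theta> *\<^sub>R x + sin \<theta> *\<^sub>R z))\<^sup>2 + (norm (sin \<theta> *\<^sub>R x - cos \<theta> *\<^sub>R z))\<^sup>2 = (norm x)\<^sup>2 + (norm z)\<^sup>2"
proof -
  have "(norm (c *\<^sub>R x + s *\<^sub>R z))\<^sup>2 + (norm (s *\<^sub>R x - c *\<^sub>R z))\<^sup>2
     = (c\<^sup>2 + s\<^sup>2) * (norm x)\<^sup>2 + (c\<^sup>2 + s\<^sup>2) * (norm z)\<^sup>2" for c s
    unfolding power2_norm_eq_inner inner_add_left inner_add_right inner_diff_left inner_diff_right
      inner_scaleR_left inner_scaleR_right
    by (simp add: inner_commute[of z x] algebra_simps power2_eq_square power2_norm_eq_inner)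
  from this[of "cos \<theta>" "sin \<theta>"] show ?thesis by simp
qed

lemma gaussian_density_rot:
  fixes x z :: "'a::euclidean_space"
  shows "gaussian_density (cos \<theta> *\<^sub>R x + sin \<theta> *\<^sub>R z) * gaussian_density (sin \<theta> *\<^sub>R x - cos \<theta> *\<^sub>R z) =
    gaussian_density x * gaussian_density z"
proof -
  have *: "exp (- (norm u)\<^sup>2 / 2) * exp (- (norm w)\<^sup>2 / 2) = exp (- ((norm u)\<^sup>2 + (norm w)\<^sup>2) / 2)" for u w :: 'a
    by (subst exp_add[symmetric]) (simp add: field_simps)
  have **: "gaussian_density u * gaussian_density w = ((2 * pi) powr (- (real DIM('a) / 2)))\<^sup>2 * exp (- ((norm u)\<^sup>2 + (norm w)\<^sup>2) / 2)" for u w :: 'a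
    unfolding *[symmetric] gaussian_density_def by (simp add: power2_eq_square)
  show ?thesis unfolding ** norm_rot_sq ..
qed

text \<open>The rotation is decoupled into two affine substitutions, first in \<open>z\<close> with \<open>x\<close> fixed and
  then in \<open>x\<close>; this needs only \<open>sin \<theta> > 0\<close>.\<close>

lemma nn_integral_rot:
  fixes h :: "'a::euclidean_space \<times> 'a \<Rightarrow> ennreal"
  assumes [measurable]: "h \<in> borel_measurable (borel \<Otimes>\<^sub>M borel)" and s: "sin \<theta> > 0"
  shows "(\<integral>\<^sup>+p. h (rot \<theta> p) \<partial>(std_gaussian \<Otimes>\<^sub>M std_gaussian)) = (\<integral>\<^sup>+p. h p \<partial>(std_gaussian \<Otimes>\<^sub>M std_gaussian))"
proof -
  define c where "c = cos \<theta>"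
  define s where "s = sin \<theta>"
  have sp: "s > 0" using s by (simp add: s_def)
  have cs: "c\<^sup>2 + s\<^sup>2 = 1" by (simp add: c_def s_def)
  define G where "G = (\<lambda>(u::'a, w::'a). ennreal (gaussian_density u) * (ennreal (gaussian_density w) * h (u, w)))"
  have [measurable]: "G \<in> borel_measurable (borel \<Otimes>\<^sub>M borel)" unfolding G_def by measurable
  have red: "(\<integral>\<^sup>+p. k p \<partial>(std_gaussian \<Otimes>\<^sub>M std_gaussian)) =
     (\<integral>\<^sup>+x. (\<integral>\<^sup>+z. ennreal (gaussian_density x) * (ennreal (gaussian_density z) * k (x, z)) \<partial>lborel) \<partial>lborel)"
    if [measurable]: "k \<in> borel_measurable (borel \<Otimes>\<^sub>M borel)" for k :: "'a \<times> 'a \<Rightarrow> ennreal"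
    by (subst std_gaussian.nn_integral_fst[symmetric])
       (simp_all add: nn_integral_std_gaussian nn_integral_cmult)
  have "(\<integral>\<^sup>+p. h (rot \<theta> p) \<partial>(std_gaussian \<Otimes>\<^sub>M std_gaussian)) =
    (\<integral>\<^sup>+x. (\<integral>\<^sup>+z. G (rot \<theta> (x, z)) \<partial>lborel) \<partial>lborel)"
    by (subst red)
      (auto simp: G_def rot_def mult.assoc[symmetric] ennreal_mult'[symmetric] gaussian_density_rot)
  also have "\<dots> = (\<integral>\<^sup>+x. (\<integral>\<^sup>+z. G (c *\<^sub>R x + s *\<^sub>R z, s *\<^sub>R x - c *\<^sub>R z) \<partial>lborel) \<partial>lborel)"
    by (simp add: rot_def c_def s_def)
  \<comment> \<open>Substitution \<open>u = c x + s z\<close> for fixed \<open>x\<close>. The second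
    component \<open>s x - c z\<close> becomes \<open>(x - c u) / s\<close> because
    \<open>1 - c\<^sup>2 = s\<^sup>2\<close>.\<close>
  also have "\<dots> = (\<integral>\<^sup>+x. ennreal (1 / s ^ DIM('a)) * (\<integral>\<^sup>+u. G (u, (1/s) *\<^sub>R x - (c/s) *\<^sub>R u) \<partial>lborel) \<partial>lborel)"
  proof (rule nn_integral_cong)
    fix x :: 'a
    have *: "(1/s) *\<^sub>R x - (c/s) *\<^sub>R (c *\<^sub>R x + s *\<^sub>R z) = s *\<^sub>R x - c *\<^sub>R z" for z
    proof -
      have "(1/s) *\<^sub>R x - (c/s) *\<^sub>R (c *\<^sub>R x + s *\<^sub>R z) = (1/s - c * c / s) *\<^sub>R x - c *\<^sub>R z"
        using sp by (simp add: algebra_simps)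
      also have "1/s - c * c / s = s" using sp cs by (simp add: field_simps power2_eq_square)
      finally show ?thesis .
    qed
    have "(\<integral>\<^sup>+u. G (u, (1/s) *\<^sub>R x - (c/s) *\<^sub>R u) \<partial>lborel) =
      ennreal (\<bar>s\<bar> ^ DIM('a)) * (\<integral>\<^sup>+z. G (c *\<^sub>R x + s *\<^sub>R z, (1/s) *\<^sub>R x - (c/s) *\<^sub>R (c *\<^sub>R x + s *\<^sub>R z)) \<partial>lborel)"
      by (rule nn_integral_lborel_scale) (use sp in auto)
    then have "ennreal (1 / s ^ DIM('a)) * (\<integral>\<^sup>+u. G (u, (1/s) *\<^sub>R x - (c/s) *\<^sub>R u) \<partial>lborel) =
      ennreal (1 / s ^ DIM('a) * s ^ DIM('a)) * (\<integral>\<^sup>+z. G (c *\<^sub>R x + s *\<^sub>R z, s *\<^sub>R x - c *\<^sub>R z) \<partial>lborel)"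
      unfolding * using sp by (simp add: mult.assoc[symmetric] ennreal_mult'[symmetric])
    then show "(\<integral>\<^sup>+z. G (c *\<^sub>R x + s *\<^sub>R z, s *\<^sub>R x - c *\<^sub>R z) \<partial>lborel) =
      ennreal (1 / s ^ DIM('a)) * (\<integral>\<^sup>+u. G (u, (1/s) *\<^sub>R x - (c/s) *\<^sub>R u) \<partial>lborel)"
      using sp by simp
  qed
  also have "\<dots> = ennreal (1 / s ^ DIM('a)) * (\<integral>\<^sup>+x. (\<integral>\<^sup>+u. G (u, (1/s) *\<^sub>R x - (c/s) *\<^sub>R u) \<partial>lborel) \<partial>lborel)"
    by (rule nn_integral_cmult) measurable
  also have "(\<integral>\<^sup>+x. (\<integral>\<^sup>+u. G (u, (1/s) *\<^sub>R x - (c/s) *\<^sub>R u) \<partial>lborel) \<partial>lborel) =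
     (\<integral>\<^sup>+u. (\<integral>\<^sup>+x. G (u, (1/s) *\<^sub>R x - (c/s) *\<^sub>R u) \<partial>lborel) \<partial>lborel)"
    by (rule lborel_pair.Fubini') measurable
  \<comment> \<open>Now \<open>u\<close> is fixed and \<open>x = c u + s w\<close>, which makes
    \<open>w\<close> the second component; the Jacobian \<open>s ^ DIM('a)\<close> cancels the
    earlier one.\<close>
  also have "\<dots> = (\<integral>\<^sup>+u. ennreal (s ^ DIM('a)) * (\<integral>\<^sup>+w. G (u, w) \<partial>lborel) \<partial>lborel)"
  proof (rule nn_integral_cong)
    fix u :: 'a
    have *: "(1/s) *\<^sub>R (c *\<^sub>R u + s *\<^sub>R w) - (c/s) *\<^sub>R u = w" for w
      using sp by (simp add: algebra_simps)
    have "(\<integral>\<^sup>+x. G (u, (1/s) *\<^sub>R x - (c/s) *\<^sub>R u) \<partial>lborel) =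
      ennreal (\<bar>s\<bar> ^ DIM('a)) * (\<integral>\<^sup>+w. G (u, (1/s) *\<^sub>R (c *\<^sub>R u + s *\<^sub>R w) - (c/s) *\<^sub>R u) \<partial>lborel)"
      by (rule nn_integral_lborel_scale) (use sp in auto)
    then show "(\<integral>\<^sup>+x. G (u, (1/s) *\<^sub>R x - (c/s) *\<^sub>R u) \<partial>lborel) = ennreal (s ^ DIM('a)) * (\<integral>\<^sup>+w. G (u, w) \<partial>lborel)"
      unfolding * using sp by simp
  qed
  also have "\<dots> = ennreal (s ^ DIM('a)) * (\<integral>\<^sup>+u. (\<integral>\<^sup>+w. G (u, w) \<partial>lborel) \<partial>lborel)"
    by (rule nn_integral_cmult) measurable
  also have "ennreal (1 / s ^ DIM('a)) * \<dots> = (\<integral>\<^sup>+u. (\<integral>\<^sup>+w. G (u, w) \<partial>lborel) \<partial>lborel)"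
    using sp by (simp add: mult.assoc[symmetric] ennreal_mult'[symmetric])
  also have "\<dots> = (\<integral>\<^sup>+p. h p \<partial>(std_gaussian \<Otimes>\<^sub>M std_gaussian))"
    by (subst red) (auto simp: G_def)
  finally show ?thesis .
qed

abbreviation gauss2 :: "('a::euclidean_space \<times> 'a) measure" where
  "gauss2 \<equiv> std_gaussian \<Otimes>\<^sub>M std_gaussian"

text \<open>Invariance of the measure itself transfers at once to integrals and integrability of
  functions with values in any Banach space.\<close>

lemma distr_rot:
  assumes "sin \<theta> > 0"
  shows "distr gauss2 gauss2 (rot \<theta>) = (gauss2 :: ('a::euclidean_space \<times> 'a) measure)"
proof (rule measure_eqI)
  fix A assume "A \<in> sets (distr gauss2 gauss2 (rot \<theta>) :: ('a \<times> 'a) measure)"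
  then have [measurable]: "A \<in> sets (borel \<Otimes>\<^sub>M borel)" by (simp cong: sets_pair_measure_cong)
  have "emeasure (distr gauss2 gauss2 (rot \<theta>)) A = (\<integral>\<^sup>+p. indicator A p \<partial>distr gauss2 gauss2 (rot \<theta>))"
    by (simp cong: sets_pair_measure_cong)
  also have "\<dots> = (\<integral>\<^sup>+p. indicator A (rot \<theta> p) \<partial>gauss2)"
    by (rule nn_integral_distr) simp_all
  also have "\<dots> = emeasure gauss2 A"
    by (subst nn_integral_rot) (use assms in \<open>auto cong: sets_pair_measure_cong\<close>)
  finally show "emeasure (distr gauss2 gauss2 (rot \<theta>)) A = emeasure gauss2 A" .
qed simp

lemma
  fixes h :: "'a::euclidean_space \<times> 'a \<Rightarrow> 'b::{banach, second_countable_topology}"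
  assumes [measurable]: "h \<in> borel_measurable (borel \<Otimes>\<^sub>M borel)" and s: "sin \<theta> > 0"
  shows integral_rot: "(LINT p|gauss2. h (rot \<theta> p)) = (LINT p|gauss2. h p)"
    and integrable_rot: "integrable gauss2 (\<lambda>p. h (rot \<theta> p)) \<longleftrightarrow> integrable gauss2 h"
proof -
  show "(LINT p|gauss2. h (rot \<theta> p)) = (LINT p|gauss2. h p)"
    by (subst (2) distr_rot[OF s, symmetric]) (simp add: integral_distr)
  have "integrable (distr gauss2 gauss2 (rot \<theta>)) h \<longleftrightarrow> integrable gauss2 (\<lambda>p. h (rot \<theta> p))"
    by (rule integrable_distr_eq) simp_all
  then show "integrable gauss2 (\<lambda>p. h (rot \<theta> p)) \<longleftrightarrow> integrable gauss2 h"
    by (simp add: distr_rot[OF s])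
qed

lemma rot_rot [simp]: "rot \<theta> (rot \<theta> p) = p"
proof (cases p)
  case (Pair x z)
  have a: "c *\<^sub>R (c *\<^sub>R x + s *\<^sub>R z) + s *\<^sub>R (s *\<^sub>R x - c *\<^sub>R z) = (c\<^sup>2 + s\<^sup>2) *\<^sub>R x"
    and b: "s *\<^sub>R (c *\<^sub>R x + s *\<^sub>R z) - c *\<^sub>R (s *\<^sub>R x - c *\<^sub>R z) = (c\<^sup>2 + s\<^sup>2) *\<^sub>R z" for c s
    by (simp_all add: algebra_simps power2_eq_square)
  show ?thesis unfolding Pair rot_def by (simp add: a b)
qed

section \<open>Differentiation under the integral and integration by parts\<close>

text \<open>The mean value inequality on the ball bounds all difference quotients by
  \<open>B\<close>, so dominated convergence applies along sequences. The derivative is represented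
  by an inner product with \<open>G\<close>, which covers both a space variable and, with real
  \<open>'b\<close>, the angle.\<close>

lemma has_derivative_integral_param:
  fixes f :: "'b::euclidean_space \<Rightarrow> 'c \<Rightarrow> real" and G :: "'b \<Rightarrow> 'c \<Rightarrow> 'b"
  assumes r: "r > 0"
    and int: "\<And>x. x \<in> ball x0 r \<Longrightarrow> integrable M (f x)"
    and G [measurable]: "G x0 \<in> borel_measurable M"
    and der: "\<And>x y. x \<in> ball x0 r \<Longrightarrow> y \<in> space M \<Longrightarrow>
        ((\<lambda>x. f x y) has_derivative (\<lambda>h. G x y \<bullet> h)) (at x)"
    and bnd: "\<And>x y. x \<in> ball x0 r \<Longrightarrow> y \<in> space M \<Longrightarrow> norm (G x y) \<le> B y"
    and B: "integrable M B"
  shows "((\<lambda>x. LINT y|M. f x y) has_derivative (\<lambda>h. (LINT y|M. G x0 y) \<bullet> h)) (at x0)"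
proof -
  have x0: "x0 \<in> ball x0 r" using r by simp
  have G_int: "integrable M (G x0)"
  proof (rule Bochner_Integration.integrable_bound[OF B])
    show "AE y in M. norm (G x0 y) \<le> norm (B y)"
      using bnd[OF x0] norm_ge_zero order_trans by (intro AE_I2) (smt (verit) real_norm_def)
  qed simp
  have Lip: "\<bar>f x y - f x0 y\<bar> \<le> B y * norm (x - x0)" if "x \<in> ball x0 r" "y \<in> space M" for x y
  proof -
    have "norm (f x y - f x0 y) \<le> B y * norm (x - x0)"
    proof (rule differentiable_bound[of "ball x0 r" "\<lambda>x. f x y" "\<lambda>x h. G x y \<bullet> h"])
      show "onorm (\<lambda>h. G x y \<bullet> h) \<le> B y" if "x \<in> ball x0 r" for x
      proof (rule onorm_bound)
        have b: "norm (G x y) \<le> B y" using bnd \<open>x \<in> ball x0 r\<close> \<open>y \<in> space M\<close> .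
        then show "0 \<le> B y" using norm_ge_zero order_trans by blast
        show "norm (G x y \<bullet> h) \<le> B y * norm h" for h
          using b Cauchy_Schwarz_ineq2[of "G x y" h] mult_right_mono[OF b norm_ge_zero[of h]] by simp
      qed
    qed (use that der x0 in \<open>auto intro: has_derivative_at_withinI\<close>)
    then show ?thesis by simp
  qed
  show ?thesis
    unfolding has_derivative_iff_norm at_within_open[OF x0 open_ball, symmetric]
  proof (intro conjI bounded_linear_inner_right, unfold tendsto_at_iff_sequentially, intro allI impI)
    fix X :: "nat \<Rightarrow> 'b" assume "\<forall>i. X i \<in> ball x0 r - {x0}" and lim: "X \<longlonglongrightarrow> x0"
    then have X: "X i \<in> ball x0 r" "X i \<noteq> x0" for i by auto
    \<comment> \<open>The remainder divided by the size of the increment. In the majorant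
      \<open>2 * B\<close> one \<open>B\<close> pays for the difference quotient and the other for
      the linear term.\<close>
    define q where "q i y = (f (X i) y - f x0 y - G x0 y \<bullet> (X i - x0)) / norm (X i - x0)" for i y
    have q_int: "(LINT y|M. q i y) = ((LINT y|M. f (X i) y) - (LINT y|M. f x0 y) -
        (LINT y|M. G x0 y) \<bullet> (X i - x0)) / norm (X i - x0)" for i
      unfolding q_def using int[OF X(1), of i] int[OF x0] G_int by (simp add: integral_inner_left)
    have "(\<lambda>i. LINT y|M. q i y) \<longlonglongrightarrow> (LINT y|M. 0)"
    proof (rule integral_dominated_convergence)
      show "integrable M (\<lambda>y. 2 * B y)" using B by simp
      show "q i \<in> borel_measurable M" for i
        unfolding q_def using int[OF X(1), of i] int[OF x0] by (intro borel_measurable_divide borel_measurable_diff) auto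
      show "AE y in M. (\<lambda>i. q i y) \<longlonglongrightarrow> 0"
      proof (rule AE_I2)
        fix y assume y: "y \<in> space M"
        have "((\<lambda>x. norm ((f x y - f x0 y) - G x0 y \<bullet> (x - x0)) / norm (x - x0)) \<longlongrightarrow> 0) (at x0)"
          using der[OF x0 y] unfolding has_derivative_iff_norm by blast
        then have "((\<lambda>x. norm ((f x y - f x0 y) - G x0 y \<bullet> (x - x0)) / norm (x - x0)) \<circ> X) \<longlonglongrightarrow> 0"
          unfolding tendsto_at_iff_sequentially using X lim by auto
        then have "(\<lambda>i. norm (q i y)) \<longlonglongrightarrow> 0" by (simp add: o_def q_def)
        then show "(\<lambda>i. q i y) \<longlonglongrightarrow> 0" by (rule tendsto_norm_zero_cancel)
      qed
      show "AE y in M. norm (q i y) \<le> 2 * B y" for i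
      proof (rule AE_I2)
        fix y assume y: "y \<in> space M"
        have "\<bar>G x0 y \<bullet> (X i - x0)\<bar> \<le> B y * norm (X i - x0)"
          using Cauchy_Schwarz_ineq2[of "G x0 y" "X i - x0"] mult_right_mono[OF bnd[OF x0 y] norm_ge_zero[of "X i - x0"]] by simp
        then have "\<bar>f (X i) y - f x0 y - G x0 y \<bullet> (X i - x0)\<bar> \<le> 2 * B y * norm (X i - x0)"
          using Lip[OF X(1)[of i] y] by linarith
        then show "norm (q i y) \<le> 2 * B y" using X(2)[of i] by (simp add: q_def abs_mult field_simps)
      qed
    qed simp
    then have "(\<lambda>i. norm (LINT y|M. q i y)) \<longlonglongrightarrow> 0" unfolding Bochner_Integration.integral_zero by (rule tendsto_norm_zero)
    moreover have "((\<lambda>y. norm ((LINT ya|M. f y ya) - (LINT y|M. f x0 y) - (LINT y|M. G x0 y) \<bullet> (y - x0)) / norm (y - x0)) \<circ> X)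
        = (\<lambda>i. norm (LINT y|M. q i y))"
      by (simp only: o_def q_int norm_divide real_norm_def abs_divide abs_norm_cancel)
    ultimately show "((\<lambda>y. norm ((LINT ya|M. f y ya) - (LINT y|M. f x0 y) - (LINT y|M. G x0 y) \<bullet> (y - x0)) / norm (y - x0)) \<circ> X) \<longlonglongrightarrow> 0"
      by (simp only:)
  qed
qed

section \<open>Translations, derivatives along lines and Gaussian integration by parts\<close>

lemma
  fixes h :: "'a::euclidean_space \<Rightarrow> 'b::{banach, second_countable_topology}"
  assumes [measurable]: "h \<in> borel_measurable borel"
  shows integral_lborel_shift: "(LINT x|lborel. h (x + a)) = (LINT x|lborel. h x)"
    and integrable_lborel_shift: "integrable lborel (\<lambda>x. h (x + a)) \<longleftrightarrow> integrable lborel h"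
proof -
  show "(LINT x|lborel. h (x + a)) = (LINT x|lborel. h x)"
    by (subst (2) lborel_distr_plus[of a, symmetric]) (simp add: integral_distr add.commute)
  have "integrable (distr lborel borel ((+) a)) h \<longleftrightarrow> integrable lborel (\<lambda>x. h (a + x))"
    by (rule integrable_distr_eq) simp_all
  then show "integrable lborel (\<lambda>x. h (x + a)) \<longleftrightarrow> integrable lborel h"
    by (simp add: lborel_distr_plus add.commute)
qed

text \<open>The fundamental theorem of calculus on the segment from \<open>x\<close> to
  \<open>x + a\<close> writes the increment as an integral of \<open>D\<close> over \<open>t\<close>
  in \<open>{0..1}\<close>; Fubini and translation invariance remove \<open>t\<close>. For
  integrable \<Psi> the increment has integral 0, which is integration by parts without boundary
  terms.\<close>

lemma
  fixes \<Psi> D :: "'a::euclidean_space \<Rightarrow> real"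
  assumes der: "\<And>x t. ((\<lambda>t. \<Psi> (x + t *\<^sub>R a)) has_real_derivative D (x + t *\<^sub>R a)) (at t)"
    and cont: "continuous_on UNIV D" and D: "integrable lborel D"
    and [measurable]: "\<Psi> \<in> borel_measurable borel"
  shows integrable_shift_diff: "integrable lborel (\<lambda>x. \<Psi> (x + a) - \<Psi> x)"
    and L1_shift_diff_le: "(LINT x|lborel. \<bar>\<Psi> (x + a) - \<Psi> x\<bar>) \<le> (LINT x|lborel. \<bar>D x\<bar>)"
    and integral_derivative_eq_0: "integrable lborel \<Psi> \<Longrightarrow> (LINT x|lborel. D x) = 0"
proof -
  have [measurable]: "D \<in> borel_measurable borel" using cont by (rule borel_measurable_continuous_onI)
  define k where "k = (\<lambda>(x, t). indicator {0..1::real} t *\<^sub>R D (x + t *\<^sub>R a))"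
  have [measurable]: "k \<in> borel_measurable (borel \<Otimes>\<^sub>M borel)" unfolding k_def by measurable
  have ftc: "(LINT t|lborel. k (x, t)) = \<Psi> (x + a) - \<Psi> x" for x
  proof -
    have "(LINT t|lborel. indicator {0..1::real} t *\<^sub>R D (x + t *\<^sub>R a)) = \<Psi> (x + 1 *\<^sub>R a) - \<Psi> (x + 0 *\<^sub>R a)"
    proof (rule integral_FTC_Icc)
      show "continuous_on {0..1} (\<lambda>t. D (x + t *\<^sub>R a))"
        by (intro continuous_intros continuous_on_compose2[OF cont]) auto
      show "((\<lambda>t. \<Psi> (x + t *\<^sub>R a)) has_vector_derivative D (x + t *\<^sub>R a)) (at t within {0..1})" for t
        using der[of x t] by (simp add: has_real_derivative_iff_has_vector_derivative has_vector_derivative_at_within)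
    qed simp
    then show ?thesis by (simp add: k_def)
  qed
  have k_int: "integrable (lborel \<Otimes>\<^sub>M lborel) k"
  proof -
    \<comment> \<open>With \<open>t\<close> as outer variable each slice is a translate of
      \<open>D\<close>, so its L1 norm does not depend on \<open>t\<close> in the unit
      interval.\<close>
    have "integrable (lborel \<Otimes>\<^sub>M lborel) (\<lambda>(t, x). k (x, t))"
    proof (rule lborel_pair.Fubini_integrable)
      have "(LINT x|lborel. norm (k (x, t))) = indicator {0..1} t * (LINT x|lborel. \<bar>D x\<bar>)" for t
        using integral_lborel_shift[of "\<lambda>x. \<bar>D x\<bar>" "t *\<^sub>R a"] by (simp add: k_def abs_mult)
      then show "integrable lborel (\<lambda>t. LINT x|lborel. norm (case (t, x) of (t, x) \<Rightarrow> k (x, t)))"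
        by simp
      show "AE t in lborel. integrable lborel (\<lambda>x. case (t, x) of (t, x) \<Rightarrow> k (x, t))"
        using integrable_lborel_shift[of D] D by (auto simp: k_def)
    qed measurable
    then show ?thesis by (subst lborel_pair.integrable_product_swap_iff[symmetric]) simp
  qed
  show "integrable lborel (\<lambda>x. \<Psi> (x + a) - \<Psi> x)"
    using lborel_pair.integrable_fst'[OF k_int] by (simp add: ftc)
  have kn_int: "integrable (lborel \<Otimes>\<^sub>M lborel) (\<lambda>p. \<bar>k p\<bar>)" using k_int by simp
  have swap: "(LINT x|lborel. (LINT t|lborel. g (x, t))) = (LINT t|lborel. (LINT x|lborel. g (x, t)))"
    if "integrable (lborel \<Otimes>\<^sub>M lborel) g" for g :: "'a \<times> real \<Rightarrow> real"
    using lborel_pair.Fubini_integral[of "\<lambda>x t. g (x, t)"] that by simp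
  have "(LINT x|lborel. \<bar>\<Psi> (x + a) - \<Psi> x\<bar>) \<le> (LINT x|lborel. (LINT t|lborel. \<bar>k (x, t)\<bar>))"
  proof (rule integral_mono)
    show "integrable lborel (\<lambda>x. \<bar>\<Psi> (x + a) - \<Psi> x\<bar>)"
      using lborel_pair.integrable_fst'[OF k_int] by (simp add: ftc)
    show "integrable lborel (\<lambda>x. LINT t|lborel. \<bar>k (x, t)\<bar>)"
      using lborel_pair.integrable_fst'[OF kn_int] by simp
    show "\<bar>\<Psi> (x + a) - \<Psi> x\<bar> \<le> (LINT t|lborel. \<bar>k (x, t)\<bar>)" for x
      unfolding ftc[symmetric] by (rule integral_abs_bound)
  qed
  also have "\<dots> = (LINT t|lborel. (LINT x|lborel. \<bar>k (x, t)\<bar>))"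
    using swap[OF kn_int] by simp
  also have "\<dots> = (LINT t|lborel. indicator {0..1::real} t * (LINT x|lborel. \<bar>D x\<bar>))"
    using integral_lborel_shift[of "\<lambda>x. \<bar>D x\<bar>"] by (simp add: k_def abs_mult)
  also have "\<dots> = (LINT x|lborel. \<bar>D x\<bar>)" by simp
  finally show "(LINT x|lborel. \<bar>\<Psi> (x + a) - \<Psi> x\<bar>) \<le> (LINT x|lborel. \<bar>D x\<bar>)" .
  assume \<Psi>: "integrable lborel \<Psi>"
  then have "integrable lborel (\<lambda>x. \<Psi> (x + a))" by (simp add: integrable_lborel_shift)
  then have "0 = (LINT x|lborel. \<Psi> (x + a) - \<Psi> x)"
    using \<Psi> by (simp add: integral_lborel_shift)
  also have "\<dots> = (LINT t|lborel. (LINT x|lborel. k (x, t)))"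
    using swap[OF k_int] by (simp add: ftc)
  also have "\<dots> = (LINT t|lborel. indicator {0..1::real} t * (LINT x|lborel. D x))"
    using integral_lborel_shift[of D] by (simp add: k_def)
  also have "\<dots> = (LINT x|lborel. D x)" by simp
  finally show "(LINT x|lborel. D x) = 0" by (rule sym)
qed

lemma has_derivative_along:
  fixes G :: "'a::euclidean_space \<Rightarrow> real"
  assumes "\<And>x. (G has_derivative (\<lambda>h. V x \<bullet> h)) (at x)"
  shows "((\<lambda>t. G (x + t *\<^sub>R a)) has_real_derivative (V (x + t *\<^sub>R a) \<bullet> a)) (at t)"
proof -
  have "((\<lambda>t. G (x + t *\<^sub>R a)) has_derivative (\<lambda>h. V (x + t *\<^sub>R a) \<bullet> (h *\<^sub>R a))) (at t)"
    by (rule has_derivative_compose[where f="\<lambda>t. x + t *\<^sub>R a", OF _ assms])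
       (auto intro!: derivative_eq_intros)
  then show ?thesis by (simp add: has_field_derivative_def mult.commute[of _ "V (x + t *\<^sub>R a) \<bullet> a"])
qed

lemma gaussian_density_has_derivative:
  "(gaussian_density has_derivative (\<lambda>h. (- gaussian_density x *\<^sub>R x) \<bullet> h)) (at (x::'a::euclidean_space))"
proof -
  define C where "C = (2 * pi) powr (- (real DIM('a) / 2))"
  have q: "((\<lambda>x::'a. - (x \<bullet> x) / 2) has_derivative (\<lambda>h. - (x \<bullet> h))) (at x)"
    by (rule has_derivative_eq_rhs, (rule derivative_eq_intros refl)+) (simp_all add: inner_commute)
  have "((\<lambda>x::'a. C * exp (- (x \<bullet> x) / 2)) has_derivative
     (\<lambda>h. C * (exp (- (x \<bullet> x) / 2) * - (x \<bullet> h)))) (at x)"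
    by (rule has_derivative_eq_rhs[OF has_derivative_mult_right[OF has_derivative_exp[OF q]]])
       (simp add: mult_ac)
  moreover have "C * (exp (- (x \<bullet> x) / 2) * - (x \<bullet> h)) = (- gaussian_density x *\<^sub>R x) \<bullet> h" for h
    unfolding gaussian_density_def C_def power2_norm_eq_inner by simp
  ultimately show ?thesis
    by (simp add: gaussian_density_def[abs_def] power2_norm_eq_inner C_def mult_ac)
qed

lemma gaussian_density_continuous: "continuous_on A gaussian_density"
  unfolding gaussian_density_def[abs_def] by (intro continuous_intros) auto

lemma integrable_gaussian_norm: "integrable lborel (\<lambda>x::'a::euclidean_space. gaussian_density x * norm x)"
  using integrable_std_gaussian_norm by (subst (asm) integrable_std_gaussian_iff) auto

lemma integrable_gaussian_inner: "integrable lborel (\<lambda>x::'a::euclidean_space. gaussian_density x * (x \<bullet> a))"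
proof (rule Bochner_Integration.integrable_bound)
  show "integrable lborel (\<lambda>x::'a. norm a * (gaussian_density x * norm x))"
    using integrable_gaussian_norm[where 'a='a] by simp
  show "AE x in lborel. norm (gaussian_density (x::'a) * (x \<bullet> a)) \<le> norm (norm a * (gaussian_density x * norm x))"
  proof (rule AE_I2)
    fix x :: 'a
    show "norm (gaussian_density x * (x \<bullet> a)) \<le> norm (norm a * (gaussian_density x * norm x))"
      using mult_left_mono[OF Cauchy_Schwarz_ineq2[of x a] gaussian_density_nonneg[of x]]
      by (simp add: abs_mult mult_ac)
  qed
qed measurable

text \<open>The mean length of a Gaussian vector, the only dimensional constant of the L1 estimates.
  It depends on the space alone, hence the type argument.\<close>

definition gauss_mean_norm :: "'a::euclidean_space itself \<Rightarrow> real" where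
  "gauss_mean_norm _ = (LINT x|(std_gaussian :: 'a measure). norm x)"

lemma gauss_mean_norm_nonneg: "0 \<le> gauss_mean_norm TYPE('a::euclidean_space)"
  by (simp add: gauss_mean_norm_def)

text \<open>The derivative of the density in direction \<open>h\<close> is minus
  \<open>(x \<bullet> h)\<close> times the density, and its L1 norm is at most \<open>norm h\<close>
  times the mean length. This is a total variation bound for a translated Gaussian; it lets averages
  of merely bounded functions be compared at two points.\<close>

lemma gaussian_density_shift_L1:
  fixes h :: "'a::euclidean_space"
  shows "integrable lborel (\<lambda>z. gaussian_density (z + h) - gaussian_density z)"
    and "(LINT z|lborel. \<bar>gaussian_density (z + h) - gaussian_density z\<bar>) \<le> norm h * gauss_mean_norm TYPE('a)"
proof -
  define D where "D = (\<lambda>x::'a. (- gaussian_density x *\<^sub>R x) \<bullet> h)"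
  have der: "((\<lambda>t. gaussian_density (x + t *\<^sub>R h)) has_real_derivative D (x + t *\<^sub>R h)) (at t)" for x t
    unfolding D_def by (rule has_derivative_along[OF gaussian_density_has_derivative])
  have cont: "continuous_on UNIV D" unfolding D_def
    by (intro continuous_intros gaussian_density_continuous)
  have D: "integrable lborel D" using integrable_gaussian_inner[of h] by (simp add: D_def)
  show "integrable lborel (\<lambda>z. gaussian_density (z + h) - gaussian_density z)"
    by (rule integrable_shift_diff[OF der cont D]) measurable
  have "(LINT z|lborel. \<bar>gaussian_density (z + h) - gaussian_density z\<bar>) \<le> (LINT x|lborel. \<bar>D x\<bar>)"
    by (rule L1_shift_diff_le[OF der cont D]) measurable
  also have "\<dots> \<le> (LINT x|lborel. norm h * (gaussian_density (x::'a) * norm x))"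
  proof (rule integral_mono)
    show "\<bar>D x\<bar> \<le> norm h * (gaussian_density x * norm x)" for x
      using Cauchy_Schwarz_ineq2[of x h] mult_left_mono[OF Cauchy_Schwarz_ineq2[of x h] gaussian_density_nonneg[of x]]
      by (simp add: D_def abs_mult mult.left_commute mult.commute)
  qed (use D integrable_gaussian_norm[where 'a='a] in auto)
  also have "\<dots> = norm h * gauss_mean_norm TYPE('a)"
    by (simp add: gauss_mean_norm_def integral_std_gaussian)
  finally show "(LINT z|lborel. \<bar>gaussian_density (z + h) - gaussian_density z\<bar>) \<le> norm h * gauss_mean_norm TYPE('a)" .
qed

lemma std_gaussian_integrable_bounded:
  fixes h :: "'a::euclidean_space \<Rightarrow> 'b::{banach, second_countable_topology}"
  assumes "h \<in> borel_measurable borel" "\<And>x. norm (h x) \<le> K"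
  shows "integrable std_gaussian h"
  by (rule std_gaussian.integrable_const_bound[of _ K]) (use assms in auto)

text \<open>The product of the density with \<open>G\<close> has directional derivative
  \<open>D\<close>, the density times \<open>V x \<bullet> a - (x \<bullet> a) * G x\<close>, and
  such a derivative integrates to 0. The bounds on \<open>G\<close> and \<open>V\<close> make the
  two halves separately integrable.\<close>

lemma gaussian_integration_by_parts:
  fixes G :: "'a::euclidean_space \<Rightarrow> real"
  assumes der: "\<And>x. (G has_derivative (\<lambda>h. V x \<bullet> h)) (at x)"
    and cont: "continuous_on UNIV V" and K: "\<And>x. \<bar>G x\<bar> \<le> K" and L: "\<And>x. norm (V x) \<le> L"
  shows "(LINT w|std_gaussian. (w \<bullet> a) * G w) = (LINT w|std_gaussian. V w \<bullet> a)"
proof -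
  have contG: "continuous_on UNIV G"
    using der by (meson continuous_at_imp_continuous_on has_derivative_continuous)
  have [measurable]: "V \<in> borel_measurable borel" "G \<in> borel_measurable borel"
    using cont contG by (auto intro: borel_measurable_continuous_onI)
  define \<Psi> where "\<Psi> = (\<lambda>x. gaussian_density x * G x)"
  define W where "W = (\<lambda>x. gaussian_density x *\<^sub>R V x - (G x * gaussian_density x) *\<^sub>R x)"
  define D where "D = (\<lambda>x. W x \<bullet> a)"
  have "(\<Psi> has_derivative (\<lambda>h. W x \<bullet> h)) (at x)" for x
    unfolding \<Psi>_def
    by (rule has_derivative_eq_rhs[OF has_derivative_mult[OF gaussian_density_has_derivative der]])
       (auto simp: W_def inner_diff_left)
  then have 1: "((\<lambda>t. \<Psi> (x + t *\<^sub>R a)) has_real_derivative D (x + t *\<^sub>R a)) (at t)" for x t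
    unfolding D_def by (rule has_derivative_along)
  have 2: "continuous_on UNIV D" unfolding D_def W_def
    by (intro continuous_intros gaussian_density_continuous cont contG)
  have i1: "integrable lborel (\<lambda>x. gaussian_density x * (V x \<bullet> a))"
  proof (rule Bochner_Integration.integrable_bound)
    show "integrable lborel (\<lambda>x::'a. (L * norm a) * gaussian_density x)"
      using integrable_gaussian_density[where 'a='a] by simp
    have "\<bar>V x \<bullet> a\<bar> \<le> L * norm a" for x
      using Cauchy_Schwarz_ineq2[of "V x" a] mult_right_mono[OF L[of x] norm_ge_zero[of a]] by linarith
    then have "gaussian_density x * \<bar>V x \<bullet> a\<bar> \<le> gaussian_density x * (L * norm a)" for x
      by (intro mult_left_mono) auto
    then have "norm (gaussian_density x * (V x \<bullet> a)) \<le> (L * norm a) * gaussian_density x" for x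
      by (simp add: abs_mult mult.commute)
    then show "AE x in lborel. norm (gaussian_density x * (V x \<bullet> a)) \<le> norm ((L * norm a) * gaussian_density x)"
      by (intro AE_I2) (metis abs_ge_self order_trans real_norm_def)
  qed measurable
  have i2: "integrable lborel (\<lambda>x. gaussian_density x * ((x \<bullet> a) * G x))"
  proof (rule Bochner_Integration.integrable_bound)
    show "integrable lborel (\<lambda>x::'a. K * (gaussian_density x * (x \<bullet> a)))"
      using integrable_gaussian_inner[of a] by simp
    have "\<bar>G x\<bar> * u \<le> \<bar>K\<bar> * u" if "u \<ge> 0" for x u
      using K[of x] that by (intro mult_right_mono) auto
    from this[of "\<bar>gaussian_density x * (x \<bullet> a)\<bar>" x for x]
    show "AE x in lborel. norm (gaussian_density x * ((x \<bullet> a) * G x)) \<le> norm (K * (gaussian_density x * (x \<bullet> a)))"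
      by (intro AE_I2) (simp add: abs_mult mult_ac)
  qed measurable
  have 3: "integrable lborel D"
    using i1 i2 by (simp add: D_def W_def inner_diff_left mult_ac)
  have 4: "integrable lborel \<Psi>"
  proof (rule Bochner_Integration.integrable_bound)
    show "integrable lborel (\<lambda>x::'a. K * gaussian_density x)"
      using integrable_gaussian_density[where 'a='a] by simp
    have "gaussian_density x * \<bar>G x\<bar> \<le> gaussian_density x * K" for x
      using K by (intro mult_left_mono) auto
    then have "norm (\<Psi> x) \<le> K * gaussian_density x" for x
      by (simp add: \<Psi>_def abs_mult mult.commute)
    then show "AE x in lborel. norm (\<Psi> x) \<le> norm (K * gaussian_density x)"
      by (intro AE_I2) (metis abs_ge_self order_trans real_norm_def)
  qed (simp add: \<Psi>_def)
  have "(LINT x|lborel. D x) = 0"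
    by (rule integral_derivative_eq_0[OF 1 2 3 _ 4]) (simp add: \<Psi>_def)
  moreover have "(LINT x|lborel. D x) = (LINT x|lborel. gaussian_density x * (V x \<bullet> a)) - (LINT x|lborel. gaussian_density x * ((x \<bullet> a) * G x))"
    using i1 i2 by (simp add: D_def W_def inner_diff_left mult_ac)
  ultimately show ?thesis by (simp add: integral_std_gaussian)
qed

section \<open>Rotation averages of smooth densities\<close>

text \<open>Mehler's formula with \<open>cos \<theta>\<close> in place of \<open>exp (- t)\<close>:
  angle 0 gives the identity and \<open>pi / 2\<close> the constant Gaussian mean. The values may be
  vectors because gradients and fields of directions are averaged as well.\<close>

definition avg :: "real \<Rightarrow> ('a::euclidean_space \<Rightarrow> 'b::{banach, second_countable_topology}) \<Rightarrow> 'a \<Rightarrow> 'b" where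
  "avg \<theta> h x = (LINT z|std_gaussian. h (cos \<theta> *\<^sub>R x + sin \<theta> *\<^sub>R z))"

lemma avg_measurable [measurable]:
  assumes [measurable]: "h \<in> borel_measurable borel"
  shows "avg \<theta> h \<in> borel_measurable borel"
  unfolding avg_def[abs_def] by measurable

lemma norm_avg_le:
  assumes "h \<in> borel_measurable borel" "\<And>x. norm (h x) \<le> C"
  shows "norm (avg \<theta> h x) \<le> C"
proof -
  have "norm (avg \<theta> h x) \<le> (LINT z|std_gaussian. norm (h (cos \<theta> *\<^sub>R x + sin \<theta> *\<^sub>R z)))"
    unfolding avg_def by (rule integral_norm_bound)
  also have "\<dots> \<le> (LINT z|(std_gaussian :: 'a measure). C)"
    using assms order_trans[OF norm_ge_zero assms(2)]
    by (intro integral_mono std_gaussian_integrable_bounded[where K=C]) auto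
  finally show ?thesis by (simp add: std_gaussian.prob_space[simplified])
qed

lemma continuous_on_avg:
  fixes h :: "'a::euclidean_space \<Rightarrow> 'b::{banach, second_countable_topology}"
  assumes cont: "continuous_on UNIV h" and bnd: "\<And>x. norm (h x) \<le> C"
  shows "continuous_on UNIV (avg \<theta> h)"
proof (rule continuous_on_sequentiallyI)
  fix u :: "nat \<Rightarrow> 'a" and x assume u: "u \<longlonglongrightarrow> x"
  have [measurable]: "h \<in> borel_measurable borel" using cont by (rule borel_measurable_continuous_onI)
  show "(\<lambda>n. avg \<theta> h (u n)) \<longlonglongrightarrow> avg \<theta> h x"
    unfolding avg_def
  proof (rule integral_dominated_convergence[where w="\<lambda>_. C"])
    show "AE z in std_gaussian. (\<lambda>i. h (cos \<theta> *\<^sub>R u i + sin \<theta> *\<^sub>R z)) \<longlonglongrightarrow> h (cos \<theta> *\<^sub>R x + sin \<theta> *\<^sub>R z)"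
      by (intro AE_I2 continuous_on_tendsto_compose[OF cont] tendsto_intros u) auto
  qed (use bnd in auto)
qed

lemma gauss2_bounded:
  fixes h :: "'a::euclidean_space \<times> 'a \<Rightarrow> 'b::{banach, second_countable_topology}"
  assumes "h \<in> borel_measurable (borel \<Otimes>\<^sub>M borel)" "\<And>x. norm (h x) \<le> K"
  shows "integrable gauss2 h"
  by (rule std_gaussian_pair.integrable_const_bound[of _ K]) (use assms in auto)

lemma
  fixes h :: "'a::euclidean_space \<Rightarrow> 'b::{banach, second_countable_topology}"
  assumes h: "integrable std_gaussian h"
  shows gauss2_integrable_fst: "integrable gauss2 (\<lambda>p. h (fst p))"
    and gauss2_integrable_snd: "integrable gauss2 (\<lambda>p. h (snd p))"
proof -
  have [measurable]: "h \<in> borel_measurable borel" using borel_measurable_integrable[OF h] by simp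
  show "integrable gauss2 (\<lambda>p. h (fst p))" "integrable gauss2 (\<lambda>p. h (snd p))"
    by (rule std_gaussian_pair.Fubini_integrable; use h in \<open>simp add: std_gaussian.prob_space[simplified]\<close>)+
qed

lemma integral_gauss2:
  fixes h :: "'a::euclidean_space \<times> 'a \<Rightarrow> real"
  assumes "integrable gauss2 h"
  shows "(LINT p|gauss2. h p) = (LINT x|std_gaussian. (LINT z|std_gaussian. h (x, z)))"
  using std_gaussian_pair.integral_fst'[OF assms] by simp

lemma gauss2_integral_fst:
  fixes h :: "'a::euclidean_space \<Rightarrow> real"
  assumes h: "integrable std_gaussian h"
  shows "(LINT p|gauss2. h (fst p)) = (LINT x|std_gaussian. h x)"
  by (subst integral_gauss2[OF gauss2_integrable_fst[OF h]]) (simp add: std_gaussian.prob_space[simplified])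

lemma gauss2_product:
  fixes h k :: "'a::euclidean_space \<Rightarrow> real"
  assumes h: "integrable std_gaussian h" and k: "integrable std_gaussian k"
  shows "integrable gauss2 (\<lambda>p. h (fst p) * k (snd p))"
    and "(LINT p|gauss2. h (fst p) * k (snd p)) = (LINT x|std_gaussian. h x) * (LINT x|std_gaussian. k x)"
proof -
  have [measurable]: "h \<in> borel_measurable borel" "k \<in> borel_measurable borel"
    using borel_measurable_integrable[OF h] borel_measurable_integrable[OF k] by simp_all
  show i: "integrable gauss2 (\<lambda>p. h (fst p) * k (snd p))"
  proof (rule std_gaussian_pair.Fubini_integrable)
    show "integrable std_gaussian (\<lambda>x. LINT y|std_gaussian. norm (h (fst (x, y)) * k (snd (x, y))))"
      using h by (simp add: abs_mult)
  qed (use k in auto)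
  show "(LINT p|gauss2. h (fst p) * k (snd p)) = (LINT x|std_gaussian. h x) * (LINT x|std_gaussian. k x)"
    by (subst integral_gauss2[OF i]) simp
qed

text \<open>Since \<open>c u + s z = s (z + (c / s) u)\<close>, moving the base point from 0 to
  \<open>u\<close> amounts to translating the Gaussian variable by a multiple \<open>c / s\<close>
  of \<open>u\<close>. The total variation bound for that translation replaces any regularity of
  \<open>w\<close>.\<close>

lemma avg_shift_le:
  fixes w :: "'a::euclidean_space \<Rightarrow> 'b::{banach, second_countable_topology}"
  assumes [measurable]: "w \<in> borel_measurable borel" and w: "\<And>x. norm (w x) \<le> 1"
    and s: "sin \<theta> > 0" and c: "cos \<theta> \<ge> 0"
  shows "norm (avg \<theta> w u - avg \<theta> w 0) \<le> cos \<theta> / sin \<theta> * norm u * gauss_mean_norm TYPE('a)"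
proof -
  define h where "h = - (cos \<theta> / sin \<theta>) *\<^sub>R u"
  have i: "integrable lborel (\<lambda>z. gaussian_density (z + v) *\<^sub>R w (sin \<theta> *\<^sub>R z))" for v
  proof (rule Bochner_Integration.integrable_bound)
    show "integrable lborel (\<lambda>z. gaussian_density (z + v))"
      using integrable_gaussian_density[where 'a='a] by (subst integrable_lborel_shift) auto
    show "AE z in lborel. norm (gaussian_density (z + v) *\<^sub>R w (sin \<theta> *\<^sub>R z)) \<le> norm (gaussian_density (z + v))"
      using w by (intro AE_I2) (simp add: mult_left_le)
  qed measurable
  have *: "avg \<theta> w u = (LINT z|lborel. gaussian_density (z + h) *\<^sub>R w (sin \<theta> *\<^sub>R z))"
  proof -
    have "avg \<theta> w u = (LINT z|lborel. gaussian_density z *\<^sub>R w (cos \<theta> *\<^sub>R u + sin \<theta> *\<^sub>R z))"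
      unfolding avg_def by (rule integral_std_gaussian) measurable
    also have "\<dots> = (LINT z|lborel. gaussian_density (z + h) *\<^sub>R w (cos \<theta> *\<^sub>R u + sin \<theta> *\<^sub>R (z + h)))"
      by (rule integral_lborel_shift[symmetric]) measurable
    also have "(\<lambda>z. cos \<theta> *\<^sub>R u + sin \<theta> *\<^sub>R (z + h)) = (\<lambda>z. sin \<theta> *\<^sub>R z)"
      using s by (simp add: h_def algebra_simps)
    finally show ?thesis .
  qed
  have **: "avg \<theta> w 0 = (LINT z|lborel. gaussian_density (z + 0) *\<^sub>R w (sin \<theta> *\<^sub>R z))"
    unfolding avg_def by (subst integral_std_gaussian) auto
  have "avg \<theta> w u - avg \<theta> w 0 = (LINT z|lborel. (gaussian_density (z + h) - gaussian_density z) *\<^sub>R w (sin \<theta> *\<^sub>R z))"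
    unfolding * ** using i[of h] i[of 0] by (subst Bochner_Integration.integral_diff[symmetric]) (auto simp: scaleR_diff_left)
  also have "norm \<dots> \<le> (LINT z|lborel. norm ((gaussian_density (z + h) - gaussian_density z) *\<^sub>R w (sin \<theta> *\<^sub>R z)))"
    by (rule integral_norm_bound)
  also have "\<dots> \<le> (LINT z|lborel. \<bar>gaussian_density (z + h) - gaussian_density z\<bar>)"
  proof (rule integral_mono)
    show "integrable lborel (\<lambda>z. norm ((gaussian_density (z + h) - gaussian_density z) *\<^sub>R w (sin \<theta> *\<^sub>R z)))"
      using i[of h] i[of 0] by (simp only: scaleR_diff_left, intro integrable_norm Bochner_Integration.integrable_diff) simp_all
  qed (use gaussian_density_shift_L1(1)[of h] w in \<open>auto simp: mult_left_le\<close>)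
  also have "\<dots> \<le> norm h * gauss_mean_norm TYPE('a)" by (rule gaussian_density_shift_L1)
  also have "norm h = cos \<theta> / sin \<theta> * norm u" using s c by (simp add: h_def)
  finally show ?thesis .
qed

section \<open>Regularity and bounds of the averages of a smooth density\<close>

text \<open>Two-sided positive bounds and a bounded continuous gradient keep logarithms and
  quotients bounded, so all exchanges of limits, derivatives and integrals hold with majorants of
  polynomial growth. The mass is left free because the approximants used later are not
  normalized.\<close>

locale nice_density =
  fixes f :: "'a::euclidean_space \<Rightarrow> real" and V :: "'a \<Rightarrow> 'a" and a K L :: real
  assumes der: "\<And>x. (f has_derivative (\<lambda>h. V x \<bullet> h)) (at x)"
    and contV: "continuous_on UNIV V"
    and a_pos: "0 < a" and f_ge: "\<And>x. a \<le> f x" and f_le: "\<And>x. f x \<le> K"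
    and V_le: "\<And>x. norm (V x) \<le> L"
begin

abbreviation "F \<theta> \<equiv> avg \<theta> f"
abbreviation "Q \<theta> \<equiv> avg \<theta> V"

lemma f_pos: "0 < f x" using a_pos f_ge[of x] by linarith

lemma f_nonneg [simp]: "0 \<le> f x" using f_pos[of x] by simp

lemma K_pos: "0 < K" using f_pos[of undefined] f_le[of undefined] by linarith

lemma L_nonneg: "0 \<le> L" using norm_ge_zero V_le order_trans by blast

lemma contf: "continuous_on UNIV f"
  using der by (meson continuous_at_imp_continuous_on has_derivative_continuous)

lemma f_meas [measurable]: "f \<in> borel_measurable borel"
  using contf by (rule borel_measurable_continuous_onI)

lemma V_meas [measurable]: "V \<in> borel_measurable borel"
  using contV by (rule borel_measurable_continuous_onI)

lemma f_abs_le: "norm (f x) \<le> K" using f_le[of x] by simp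

lemma f_int: "integrable std_gaussian (\<lambda>z. f (u + c *\<^sub>R z))"
  by (rule std_gaussian_integrable_bounded[OF _ f_abs_le]) measurable

lemma V_int: "integrable std_gaussian (\<lambda>z. V (u + c *\<^sub>R z))"
  by (rule std_gaussian_integrable_bounded[OF _ V_le]) measurable

lemma F_le: "F \<theta> x \<le> K"
  using norm_avg_le[OF f_meas f_abs_le, of \<theta> x] by simp

lemma F_ge: "a \<le> F \<theta> x"
proof -
  have "(LINT z|(std_gaussian :: 'a measure). a) \<le> F \<theta> x"
    unfolding avg_def by (intro integral_mono f_int f_ge) auto
  then show ?thesis by (simp add: std_gaussian.prob_space[simplified])
qed

lemma F_pos: "0 < F \<theta> x" using a_pos F_ge[of \<theta> x] by linarith

lemma Q_le: "norm (Q \<theta> x) \<le> L" by (rule norm_avg_le[OF V_meas V_le])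

lemma Q_cont: "continuous_on UNIV (Q \<theta>)" by (rule continuous_on_avg[OF contV V_le])

lemma F_cont: "continuous_on UNIV (F \<theta>)" by (rule continuous_on_avg[OF contf f_abs_le])

text \<open>The base point enters through \<open>cos \<theta> *\<^sub>R x\<close>, so a spatial
  derivative of an average carries one factor \<open>cos \<theta>\<close>. This is the cosine that
  reappears in the entropy rate.\<close>

lemma F_der: "(F \<theta> has_derivative (\<lambda>h. (cos \<theta> *\<^sub>R Q \<theta> x) \<bullet> h)) (at x)"
proof -
  have "((\<lambda>x. LINT z|std_gaussian. f (cos \<theta> *\<^sub>R x + sin \<theta> *\<^sub>R z)) has_derivative
     (\<lambda>h. (LINT z|std_gaussian. cos \<theta> *\<^sub>R V (cos \<theta> *\<^sub>R x + sin \<theta> *\<^sub>R z)) \<bullet> h)) (at x)"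
  proof (rule has_derivative_integral_param[where r=1 and B="\<lambda>_. L"])
    fix x z :: 'a
    have "((\<lambda>x. f (cos \<theta> *\<^sub>R x + sin \<theta> *\<^sub>R z)) has_derivative (\<lambda>h. V (cos \<theta> *\<^sub>R x + sin \<theta> *\<^sub>R z) \<bullet> (cos \<theta> *\<^sub>R h))) (at x)"
      by (rule has_derivative_compose[where f="\<lambda>x. cos \<theta> *\<^sub>R x + sin \<theta> *\<^sub>R z", OF _ der])
         (auto intro!: derivative_eq_intros)
    then show "((\<lambda>x. f (cos \<theta> *\<^sub>R x + sin \<theta> *\<^sub>R z)) has_derivative (\<lambda>h. (cos \<theta> *\<^sub>R V (cos \<theta> *\<^sub>R x + sin \<theta> *\<^sub>R z)) \<bullet> h)) (at x)"
      by simp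
    show "norm (cos \<theta> *\<^sub>R V (cos \<theta> *\<^sub>R x + sin \<theta> *\<^sub>R z)) \<le> L"
      using mult_mono[OF abs_cos_le_one[of \<theta>] V_le[of "cos \<theta> *\<^sub>R x + sin \<theta> *\<^sub>R z"]] by simp
  qed (use f_int in auto)
  then show ?thesis by (simp add: avg_def[abs_def])
qed

text \<open>The angular derivative of \<open>F \<theta> x\<close>. The vector
  \<open>cos \<theta> *\<^sub>R z - sin \<theta> *\<^sub>R x\<close> is the velocity of the moving
  point and minus the second component of \<open>rot \<theta> (x, z)\<close>, which is what makes
  the change of variables useful.\<close>

definition T :: "real \<Rightarrow> 'a \<Rightarrow> real" where
  "T \<theta> x = (LINT z|std_gaussian. V (cos \<theta> *\<^sub>R x + sin \<theta> *\<^sub>R z) \<bullet> (cos \<theta> *\<^sub>R z - sin \<theta> *\<^sub>R x))"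

lemma T_meas [measurable]: "T \<theta> \<in> borel_measurable borel"
  unfolding T_def[abs_def] by measurable

lemma V_inner_le: "\<bar>V y \<bullet> (cos \<theta> *\<^sub>R z - sin \<theta> *\<^sub>R x)\<bar> \<le> L * (norm x + norm z)"
proof -
  have "\<bar>V y \<bullet> (cos \<theta> *\<^sub>R z - sin \<theta> *\<^sub>R x)\<bar> \<le> norm (V y) * norm (cos \<theta> *\<^sub>R z - sin \<theta> *\<^sub>R x)"
    by (rule Cauchy_Schwarz_ineq2)
  also have "\<dots> \<le> L * (norm x + norm z)"
  proof (rule mult_mono[OF V_le _ L_nonneg])
    have "norm (cos \<theta> *\<^sub>R z - sin \<theta> *\<^sub>R x) \<le> \<bar>cos \<theta>\<bar> * norm z + \<bar>sin \<theta>\<bar> * norm x"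
      using norm_triangle_ineq4[of "cos \<theta> *\<^sub>R z" "sin \<theta> *\<^sub>R x"] by simp
    also have "\<dots> \<le> 1 * norm z + 1 * norm x" by (intro add_mono mult_right_mono) auto
    finally show "norm (cos \<theta> *\<^sub>R z - sin \<theta> *\<^sub>R x) \<le> norm x + norm z" by simp
  qed simp
  finally show ?thesis .
qed

lemma norm_int: "integrable std_gaussian (\<lambda>z::'a. C * (norm x + norm z))" for x :: 'a
  using integrable_std_gaussian_norm[where 'a='a] by simp

lemma T_int: "integrable std_gaussian (\<lambda>z. V (cos \<theta> *\<^sub>R x + sin \<theta> *\<^sub>R z) \<bullet> (cos \<theta> *\<^sub>R z - sin \<theta> *\<^sub>R x))"
  by (rule Bochner_Integration.integrable_bound[OF norm_int[of L x]])
     (auto intro!: order_trans[OF V_inner_le])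

lemma T_le: "\<bar>T \<theta> x\<bar> \<le> L * (norm x + gauss_mean_norm TYPE('a))"
proof -
  have "\<bar>T \<theta> x\<bar> \<le> (LINT z|std_gaussian. \<bar>V (cos \<theta> *\<^sub>R x + sin \<theta> *\<^sub>R z) \<bullet> (cos \<theta> *\<^sub>R z - sin \<theta> *\<^sub>R x)\<bar>)"
    unfolding T_def by (rule integral_abs_bound)
  also have "\<dots> \<le> (LINT z|(std_gaussian :: 'a measure). L * (norm x + norm z))"
    by (intro integral_mono integrable_abs T_int norm_int V_inner_le)
  also have "\<dots> = L * (norm x + gauss_mean_norm TYPE('a))"
    using integrable_std_gaussian_norm[where 'a='a]
    by (simp add: gauss_mean_norm_def std_gaussian.prob_space[simplified])
  finally show ?thesis .
qed

lemma F_der_angle: "((\<lambda>\<theta>. F \<theta> x) has_derivative (\<lambda>h. T \<theta> x \<bullet> h)) (at \<theta>)"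
proof -
  have "((\<lambda>\<theta>. LINT z|std_gaussian. f (cos \<theta> *\<^sub>R x + sin \<theta> *\<^sub>R z)) has_derivative
     (\<lambda>h. (LINT z|std_gaussian. V (cos \<theta> *\<^sub>R x + sin \<theta> *\<^sub>R z) \<bullet> (cos \<theta> *\<^sub>R z - sin \<theta> *\<^sub>R x)) \<bullet> h)) (at \<theta>)"
  proof (rule has_derivative_integral_param[where r=1 and B="\<lambda>z. L * (norm x + norm z)"])
    fix \<theta> z
    have "((\<lambda>\<theta>. f (cos \<theta> *\<^sub>R x + sin \<theta> *\<^sub>R z)) has_derivative
       (\<lambda>h. V (cos \<theta> *\<^sub>R x + sin \<theta> *\<^sub>R z) \<bullet> (h *\<^sub>R (cos \<theta> *\<^sub>R z - sin \<theta> *\<^sub>R x)))) (at \<theta>)"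
      by (rule has_derivative_compose[where f="\<lambda>\<theta>. cos \<theta> *\<^sub>R x + sin \<theta> *\<^sub>R z", OF _ der])
         (auto intro!: derivative_eq_intros simp: algebra_simps)
    then show "((\<lambda>\<theta>. f (cos \<theta> *\<^sub>R x + sin \<theta> *\<^sub>R z)) has_derivative
       (\<lambda>h. (V (cos \<theta> *\<^sub>R x + sin \<theta> *\<^sub>R z) \<bullet> (cos \<theta> *\<^sub>R z - sin \<theta> *\<^sub>R x)) \<bullet> h)) (at \<theta>)"
      by (simp add: mult.commute)
  qed (use f_int norm_int V_inner_le in auto)
  then show ?thesis by (simp add: avg_def[abs_def] T_def)
qed

lemma F_DERIV: "((\<lambda>\<theta>. F \<theta> x) has_real_derivative T \<theta> x) (at \<theta>)"
  using F_der_angle by (simp add: has_field_derivative_def)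

definition mass :: real where "mass = (LINT x|std_gaussian. f x)"
definition fisher :: real where "fisher = (LINT x|std_gaussian. (norm (V x))\<^sup>2 / f x)"
definition ent :: "real \<Rightarrow> real" where "ent \<theta> = (LINT x|std_gaussian. F \<theta> x * ln (F \<theta> x))"
definition fish :: "real \<Rightarrow> real" where "fish \<theta> = (LINT x|std_gaussian. (norm (Q \<theta> x))\<^sup>2 / F \<theta> x)"
definition VL1 :: real where "VL1 = (LINT x|std_gaussian. norm (V x))"
text \<open>The summand 1 accounts for \<open>ln t + 1\<close>, the derivative of
  \<open>t * ln t\<close>.\<close>

definition lnb :: real where "lnb = \<bar>ln a\<bar> + \<bar>ln K\<bar> + 1"

lemma ln_F_le: "\<bar>ln (F \<theta> x)\<bar> \<le> lnb - 1"
proof -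
  have "ln a \<le> ln (F \<theta> x)" "ln (F \<theta> x) \<le> ln K" using F_ge[of \<theta> x] F_le[of \<theta> x] a_pos F_pos[of \<theta> x] by simp_all
  then show ?thesis by (simp add: lnb_def)
qed

lemma lnF_le: "\<bar>ln (F \<theta> x) + 1\<bar> \<le> lnb" using ln_F_le[of \<theta> x] by linarith

text \<open>The bounds on \<open>F\<close> keep its logarithm bounded, so the angular derivative of
  the integrand has a majorant that is affine in \<open>norm x\<close> and independent of the
  angle.\<close>

lemma ent_DERIV:
  "(ent has_real_derivative (LINT x|std_gaussian. T \<theta> x * (ln (F \<theta> x) + 1))) (at \<theta>)"
proof -
  have "((\<lambda>\<theta>. LINT x|std_gaussian. F \<theta> x * ln (F \<theta> x)) has_derivative
     (\<lambda>h. (LINT x|std_gaussian. T \<theta> x * (ln (F \<theta> x) + 1)) \<bullet> h)) (at \<theta>)"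
  proof (rule has_derivative_integral_param[where r=1 and B="\<lambda>x. L * (norm x + gauss_mean_norm TYPE('a)) * lnb"])
    fix \<theta> x
    have "((\<lambda>\<theta>. F \<theta> x * ln (F \<theta> x)) has_real_derivative (T \<theta> x * (ln (F \<theta> x) + 1))) (at \<theta>)"
      by (auto intro!: derivative_eq_intros F_DERIV F_pos simp: F_pos less_imp_neq[OF F_pos, symmetric] algebra_simps)
    then show "((\<lambda>\<theta>. F \<theta> x * ln (F \<theta> x)) has_derivative (\<lambda>h. (T \<theta> x * (ln (F \<theta> x) + 1)) \<bullet> h)) (at \<theta>)"
      by (simp add: has_field_derivative_def)
    show "norm (T \<theta> x * (ln (F \<theta> x) + 1)) \<le> L * (norm x + gauss_mean_norm TYPE('a)) * lnb"
      unfolding real_norm_def abs_mult using T_le lnF_le L_nonneg gauss_mean_norm_nonneg[where 'a='a] by (intro mult_mono) auto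
    show "integrable std_gaussian (\<lambda>x. F \<theta> x * ln (F \<theta> x))"
    proof (rule std_gaussian_integrable_bounded)
      show "norm (F \<theta> x * ln (F \<theta> x)) \<le> K * lnb" for x
        unfolding real_norm_def abs_mult
        using F_le[of \<theta> x] F_pos[of \<theta> x] ln_F_le[of \<theta> x] K_pos by (intro mult_mono) auto
    qed measurable
  next
    show "integrable std_gaussian (\<lambda>x::'a. L * (norm x + gauss_mean_norm TYPE('a)) * lnb)"
      using integrable_std_gaussian_norm[where 'a='a] by simp
  qed auto
  then show ?thesis by (simp add: has_field_derivative_def ent_def[abs_def])
qed

end

lemma fst_rot: "fst (rot \<theta> (x, z)) = cos \<theta> *\<^sub>R x + sin \<theta> *\<^sub>R z"
  and snd_rot: "snd (rot \<theta> (x, z)) = sin \<theta> *\<^sub>R x - cos \<theta> *\<^sub>R z"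
  by (simp_all add: rot_def)

lemma gauss2_integral_fst_rot:
  fixes h :: "'a::euclidean_space \<Rightarrow> real"
  assumes h: "integrable std_gaussian h" and s: "sin \<theta> > 0"
  shows "(LINT p|gauss2. h (fst (rot \<theta> p))) = (LINT x|std_gaussian. h x)"
proof -
  have [measurable]: "h \<in> borel_measurable borel" using borel_measurable_integrable[OF h] by simp
  have "(LINT p|gauss2. h (fst (rot \<theta> p))) = (LINT p|gauss2. h (fst p))"
    by (rule integral_rot[OF _ s, of "\<lambda>p. h (fst p)"]) measurable
  then show ?thesis by (simp add: gauss2_integral_fst[OF h])
qed

section \<open>Entropy rate, loss of Fisher information, averaged gradient and L1 Poincare
  inequality\<close>

context nice_density
begin

text \<open>The de Bruijn identity along the rotation: rotating to the variables \<open>(u, w)\<close> in which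
  \<open>V\<close> depends on \<open>u\<close> only, integrating by parts in \<open>w\<close>, and rotating back.\<close>

lemma ent_rate:
  assumes s: "sin \<theta> > 0"
  shows "(LINT x|std_gaussian. T \<theta> x * (ln (F \<theta> x) + 1)) = - (sin \<theta> * cos \<theta>) * fish \<theta>"
proof -
  have [measurable]: "F \<theta> \<in> borel_measurable borel" "Q \<theta> \<in> borel_measurable borel" by measurable
  define \<Phi> where "\<Phi> = (\<lambda>p. (V (fst (rot \<theta> p)) \<bullet> (- snd (rot \<theta> p))) * (ln (F \<theta> (fst p)) + 1))"
  have [measurable]: "\<Phi> \<in> borel_measurable (borel \<Otimes>\<^sub>M borel)" unfolding \<Phi>_def by measurable
  have \<Phi>_eq: "\<Phi> (x, z) = (V (cos \<theta> *\<^sub>R x + sin \<theta> *\<^sub>R z) \<bullet> (cos \<theta> *\<^sub>R z - sin \<theta> *\<^sub>R x)) * (ln (F \<theta> x) + 1)" for x z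
    by (simp add: \<Phi>_def fst_rot snd_rot inner_minus_right[symmetric] del: inner_minus_right)
  have \<Phi>_int: "integrable gauss2 \<Phi>"
  proof (rule Bochner_Integration.integrable_bound)
    show "integrable gauss2 (\<lambda>p::'a\<times>'a. L * (norm (fst p) + norm (snd p)) * lnb)"
      using gauss2_integrable_fst[OF integrable_std_gaussian_norm[where 'a='a]]
        gauss2_integrable_snd[OF integrable_std_gaussian_norm[where 'a='a]] by simp
    have "norm (\<Phi> (x, z)) \<le> L * (norm x + norm z) * lnb" for x z
      unfolding \<Phi>_eq real_norm_def abs_mult
      by (intro mult_mono V_inner_le lnF_le mult_nonneg_nonneg L_nonneg) auto
    from this[of "fst p" "snd p" for p]
    have "norm (\<Phi> p) \<le> L * (norm (fst p) + norm (snd p)) * lnb" for p by simp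
    then show "AE p in gauss2. norm (\<Phi> p) \<le> norm (L * (norm (fst p) + norm (snd p)) * lnb)"
      by (intro AE_I2) (metis abs_ge_self order_trans real_norm_def)
  qed simp
  define \<Xi> where "\<Xi> = (\<lambda>p. Q \<theta> (fst p) \<bullet> V (fst (rot \<theta> p)) / F \<theta> (fst p))"
  have [measurable]: "\<Xi> \<in> borel_measurable (borel \<Otimes>\<^sub>M borel)" unfolding \<Xi>_def by measurable
  have QF: "norm (Q \<theta> x) / F \<theta> x \<le> L / a" for x
    by (rule frac_le) (use Q_le F_ge a_pos L_nonneg in auto)
  have \<Xi>_le: "norm (\<Xi> p) \<le> L / a * L" for p
  proof -
    have "norm (\<Xi> p) = \<bar>Q \<theta> (fst p) \<bullet> V (fst (rot \<theta> p))\<bar> / F \<theta> (fst p)"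
      using F_pos[of \<theta> "fst p"] by (simp add: \<Xi>_def)
    also have "\<dots> \<le> norm (Q \<theta> (fst p)) * norm (V (fst (rot \<theta> p))) / F \<theta> (fst p)"
      using F_pos[of \<theta> "fst p"] by (intro divide_right_mono Cauchy_Schwarz_ineq2) auto
    also have "\<dots> = norm (Q \<theta> (fst p)) / F \<theta> (fst p) * norm (V (fst (rot \<theta> p)))" by simp
    also have "\<dots> \<le> L / a * L" by (intro mult_mono QF V_le) (use L_nonneg a_pos in auto)
    finally show ?thesis .
  qed
  have \<Xi>_int: "integrable gauss2 \<Xi>" by (rule gauss2_bounded[OF _ \<Xi>_le]) measurable
  \<comment> \<open>In the new variables \<open>V\<close> sits at \<open>u\<close>, the velocity is
    \<open>- w\<close>, and \<open>F \<theta>\<close> sits at \<open>y w = c u + s w\<close>. The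
    chain rule gives \<open>sin \<theta>\<close> from \<open>y\<close> and
    \<open>cos \<theta>\<close> from the gradient of \<open>F \<theta>\<close>.\<close>
  have ibp: "(LINT w|std_gaussian. \<Phi> (rot \<theta> (u, w))) = - (sin \<theta> * cos \<theta>) * (LINT w|std_gaussian. \<Xi> (rot \<theta> (u, w)))" for u
  proof -
    define y where "y = (\<lambda>w. cos \<theta> *\<^sub>R u + sin \<theta> *\<^sub>R w)"
    define W where "W = (\<lambda>w. ((sin \<theta> * cos \<theta>) / F \<theta> (y w)) *\<^sub>R Q \<theta> (y w))"
    have "(LINT w|std_gaussian. \<Phi> (rot \<theta> (u, w))) = (LINT w|std_gaussian. - ((w \<bullet> V u) * (ln (F \<theta> (y w)) + 1)))"
      by (simp add: \<Phi>_def fst_rot y_def inner_commute)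
    also have "\<dots> = - (LINT w|std_gaussian. (w \<bullet> V u) * (ln (F \<theta> (y w)) + 1))" by simp
    also have "(LINT w|std_gaussian. (w \<bullet> V u) * (ln (F \<theta> (y w)) + 1)) = (LINT w|std_gaussian. W w \<bullet> V u)"
    proof (rule gaussian_integration_by_parts)
      have "(y has_derivative (\<lambda>h. sin \<theta> *\<^sub>R h)) (at w)" for w
        unfolding y_def by (auto intro!: derivative_eq_intros)
      from has_derivative_compose[OF this F_der]
      have "((\<lambda>w. F \<theta> (y w)) has_derivative (\<lambda>h. (cos \<theta> *\<^sub>R Q \<theta> (y w)) \<bullet> (sin \<theta> *\<^sub>R h))) (at w)" for w .
      then have "((\<lambda>w. ln (F \<theta> (y w)) + 1) has_derivative (\<lambda>h. (cos \<theta> *\<^sub>R Q \<theta> (y w)) \<bullet> (sin \<theta> *\<^sub>R h) * inverse (F \<theta> (y w)) + 0)) (at w)" for w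
        by (intro has_derivative_add has_derivative_ln has_derivative_const) (simp_all add: F_pos)
      then show "((\<lambda>w. ln (F \<theta> (y w)) + 1) has_derivative (\<lambda>h. W w \<bullet> h)) (at w)" for w
        by (rule has_derivative_eq_rhs) (simp add: W_def divide_inverse fun_eq_iff)
      have yc: "continuous_on UNIV y" unfolding y_def by (intro continuous_intros)
      have nz: "F \<theta> x \<noteq> 0" for x using F_pos[of \<theta> x] by simp
      show "continuous_on UNIV W" unfolding W_def
        by (intro continuous_intros continuous_on_compose2[OF F_cont yc] continuous_on_compose2[OF Q_cont yc]) (use nz in auto)
      show "\<bar>ln (F \<theta> (y w)) + 1\<bar> \<le> lnb" for w by (rule lnF_le)
      show "norm (W w) \<le> 1 * (L / a)" for w
      proof -
        have "norm (W w) = \<bar>sin \<theta> * cos \<theta>\<bar> * (norm (Q \<theta> (y w)) / F \<theta> (y w))"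
          using F_pos[of \<theta> "y w"] by (simp add: W_def)
        also have "\<dots> \<le> 1 * (L / a)"
        proof (rule mult_mono[OF _ QF])
          show "\<bar>sin \<theta> * cos \<theta>\<bar> \<le> 1"
            unfolding abs_mult using mult_mono[OF abs_sin_le_one[of \<theta>] abs_cos_le_one[of \<theta>]] by simp
        qed (use F_pos[of \<theta> "y w"] in auto)
        finally show ?thesis .
      qed
    qed
    also have "(LINT w|std_gaussian. W w \<bullet> V u) = (LINT w|std_gaussian. (sin \<theta> * cos \<theta>) * \<Xi> (rot \<theta> (u, w)))"
      by (simp add: \<Xi>_def fst_rot y_def W_def)
    finally show ?thesis by simp
  qed
  have "(LINT x|std_gaussian. T \<theta> x * (ln (F \<theta> x) + 1)) = (LINT p|gauss2. \<Phi> p)"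
    by (simp add: integral_gauss2[OF \<Phi>_int] \<Phi>_eq T_def)
  also have "\<dots> = (LINT p|gauss2. \<Phi> (rot \<theta> p))" by (rule integral_rot[OF _ s, symmetric]) measurable
  also have "\<dots> = (LINT u|std_gaussian. (LINT w|std_gaussian. \<Phi> (rot \<theta> (u, w))))"
    by (rule integral_gauss2) (use \<Phi>_int integrable_rot[OF _ s, of \<Phi>] in simp)
  also have "\<dots> = - (sin \<theta> * cos \<theta>) * (LINT u|std_gaussian. (LINT w|std_gaussian. \<Xi> (rot \<theta> (u, w))))"
    by (simp add: ibp)
  also have "(LINT u|std_gaussian. (LINT w|std_gaussian. \<Xi> (rot \<theta> (u, w)))) = (LINT p|gauss2. \<Xi> (rot \<theta> p))"
    by (rule integral_gauss2[symmetric]) (use \<Xi>_int integrable_rot[OF _ s, of \<Xi>] in simp)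
  also have "\<dots> = (LINT p|gauss2. \<Xi> p)" by (rule integral_rot[OF _ s]) measurable
  \<comment> \<open>For fixed \<open>x\<close> only \<open>V\<close> still depends on
    \<open>z\<close>; its mean is \<open>Q \<theta> x\<close>, which completes the square
    \<open>Q \<bullet> Q / F\<close>.\<close>
  also have "\<dots> = (LINT x|std_gaussian. (LINT z|std_gaussian. \<Xi> (x, z)))" by (rule integral_gauss2[OF \<Xi>_int])
  also have "\<dots> = fish \<theta>"
    unfolding \<Xi>_def fish_def fst_rot fst_conv
    using V_int by (simp add: avg_def[symmetric] power2_norm_eq_inner)
  finally show ?thesis .
qed

text \<open>With \<open>b\<close> and \<open>v\<close> the values of \<open>f\<close> and
  \<open>V\<close> at the rotated point and \<open>q = Q / F\<close>, the gap is exactly the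
  integral over pairs of \<open>norm (v - b q)\<^sup>2 / b\<close>. Young's inequality with weight
  \<open>b\<close> and parameter \<open>l\<close>, together with the triangle inequality, bounds the
  integrand below by a quantity linear in \<open>norm v\<close> and \<open>b * norm q\<close>, whose
  integrals are the two L1 norms.\<close>

lemma fish_bound:
  assumes s: "sin \<theta> > 0" and l: "l \<ge> 0"
  shows "2 * l * (VL1 - (LINT x|std_gaussian. norm (Q \<theta> x))) - l\<^sup>2 * mass \<le> fisher - fish \<theta>"
proof -
  have [measurable]: "F \<theta> \<in> borel_measurable borel" "Q \<theta> \<in> borel_measurable borel" by measurable
  define b where "b = (\<lambda>p. f (fst (rot \<theta> p)))"
  define v where "v = (\<lambda>p. V (fst (rot \<theta> p)))"
  define q where "q = (\<lambda>x. (1 / F \<theta> x) *\<^sub>R Q \<theta> x)"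
  have [measurable]: "b \<in> borel_measurable (borel \<Otimes>\<^sub>M borel)" "v \<in> borel_measurable (borel \<Otimes>\<^sub>M borel)"
    "q \<in> borel_measurable borel"
    unfolding b_def v_def q_def by measurable
  have q_le: "norm (q x) \<le> L / a" for x
  proof -
    have "norm (Q \<theta> x) / F \<theta> x \<le> L / a" by (rule frac_le) (use Q_le F_ge a_pos L_nonneg in auto)
    then show ?thesis using F_pos[of \<theta> x] by (simp add: q_def)
  qed
  have La: "0 \<le> L / a" using L_nonneg a_pos by simp
  have b: "0 < b p" "b p \<le> K" "a \<le> b p" for p by (auto simp: b_def f_pos f_le f_ge)
  have v: "norm (v p) \<le> L" for p by (simp add: v_def V_le)
  have pointwise: "2 * l * norm (v p) - 2 * l * (b p * norm (q (fst p))) - l\<^sup>2 * b p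
     \<le> (norm (v p))\<^sup>2 / b p - 2 * (v p \<bullet> q (fst p)) + b p * (norm (q (fst p)))\<^sup>2" for p
  proof -
    \<comment> \<open>The deviation of the gradient at the rotated point from the value it would
      have if the logarithmic gradient were \<open>q\<close> at the base point.\<close>
    define y where "y = v p - b p *\<^sub>R q (fst p)"
    have "norm (v p) - b p * norm (q (fst p)) \<le> norm y"
      unfolding y_def using norm_triangle_ineq2[of "v p" "b p *\<^sub>R q (fst p)"] b(1)[of p] by simp
    then have "2 * l * (norm (v p) - b p * norm (q (fst p))) \<le> 2 * l * norm y"
      using l by (intro mult_left_mono) auto
    also have "2 * l * norm y \<le> l\<^sup>2 * b p + (norm y)\<^sup>2 / b p"
    proof -
      have "0 \<le> (l * b p - norm y)\<^sup>2 / b p" using b(1)[of p] by simp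
      then show ?thesis using b(1)[of p] by (simp add: power2_eq_square field_simps)
    qed
    also have "(norm y)\<^sup>2 / b p = (norm (v p))\<^sup>2 / b p - 2 * (v p \<bullet> q (fst p)) + b p * (norm (q (fst p)))\<^sup>2"
      unfolding y_def power2_norm_eq_inner using b(1)[of p]
      by (simp add: inner_diff_left inner_diff_right inner_commute field_simps)
    finally show ?thesis by (simp add: algebra_simps)
  qed
  have i1: "integrable gauss2 (\<lambda>p. norm (v p))"
    by (rule gauss2_bounded[of _ L]) (use v in auto)
  have bqn: "b p * norm (q (fst p)) \<le> K * (L / a)" for p
    using b[of p] q_le[of "fst p"] K_pos by (intro mult_mono) auto
  have i2: "integrable gauss2 (\<lambda>p. b p * norm (q (fst p)))"
    by (rule gauss2_bounded[of _ "K * (L / a)"]) (use bqn b(1) in \<open>simp_all add: abs_mult abs_of_pos\<close>)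
  have i3: "integrable gauss2 b" by (rule gauss2_bounded[of _ K]) (use b in \<open>auto simp: less_imp_le\<close>)
  have i4: "integrable gauss2 (\<lambda>p. (norm (v p))\<^sup>2 / b p)"
  proof (rule gauss2_bounded)
    show "norm ((norm (v p))\<^sup>2 / b p) \<le> L\<^sup>2 / a" for p
    proof -
      have "(norm (v p))\<^sup>2 / b p \<le> L\<^sup>2 / a"
        by (rule frac_le) (use power_mono[OF v[of p] norm_ge_zero, of 2] b[of p] a_pos in simp_all)
      then show ?thesis using b(1)[of p] by simp
    qed
  qed measurable
  have i5: "integrable gauss2 (\<lambda>p. v p \<bullet> q (fst p))"
  proof (rule gauss2_bounded)
    show "norm (v p \<bullet> q (fst p)) \<le> L * (L / a)" for p
      using Cauchy_Schwarz_ineq2[of "v p" "q (fst p)"] mult_mono[OF v[of p] q_le[of "fst p"] L_nonneg norm_ge_zero] by simp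
  qed measurable
  have bq: "norm (b p * (norm (q (fst p)))\<^sup>2) \<le> K * (L / a)\<^sup>2" for p
  proof -
    have "b p * (norm (q (fst p)))\<^sup>2 \<le> K * (L / a)\<^sup>2"
      using b[of p] K_pos q_le[of "fst p"] by (intro mult_mono power_mono) auto
    then show ?thesis using b(1)[of p] by (simp add: abs_mult)
  qed
  have i6: "integrable gauss2 (\<lambda>p. b p * (norm (q (fst p)))\<^sup>2)"
    by (rule gauss2_bounded[OF _ bq]) measurable
  have e1: "(LINT p|gauss2. norm (v p)) = VL1"
    unfolding v_def VL1_def
    by (rule gauss2_integral_fst_rot[OF _ s]) (rule std_gaussian_integrable_bounded[of _ L], use V_le in auto)
  have Fint: "(LINT z|std_gaussian. b (x, z) * c) = F \<theta> x * c" for x c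
    unfolding b_def fst_rot avg_def using f_int by simp
  have e2: "(LINT p|gauss2. b p * norm (q (fst p))) = (LINT x|std_gaussian. norm (Q \<theta> x))"
    unfolding integral_gauss2[OF i2] fst_conv Fint using F_pos by (simp add: q_def less_imp_le less_imp_neq[OF F_pos, symmetric])
  have e3: "(LINT p|gauss2. b p) = mass"
    unfolding b_def mass_def
    by (rule gauss2_integral_fst_rot[OF _ s]) (rule std_gaussian_integrable_bounded[OF _ f_abs_le], measurable)
  have e4: "(LINT p|gauss2. (norm (v p))\<^sup>2 / b p) = fisher"
    unfolding b_def v_def fisher_def
  proof (rule gauss2_integral_fst_rot[OF _ s, of "\<lambda>x. (norm (V x))\<^sup>2 / f x"], rule std_gaussian_integrable_bounded)
    show "norm ((norm (V x))\<^sup>2 / f x) \<le> L\<^sup>2 / a" for x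
    proof -
      have "(norm (V x))\<^sup>2 / f x \<le> L\<^sup>2 / a"
        by (rule frac_le) (use V_le f_ge a_pos in \<open>auto intro: power_mono\<close>)
      then show ?thesis using f_pos[of x] by simp
    qed
  qed measurable
  \<comment> \<open>Integrating out \<open>z\<close> turns \<open>v\<close> into \<open>Q\<close>
    and \<open>b\<close> into \<open>F\<close>. Thus the cross term and the quadratic term both
    equal \<open>fish \<theta>\<close>, and the expansion of the square leaves one of them with a
    minus sign.\<close>
  have e5: "(LINT p|gauss2. v p \<bullet> q (fst p)) = fish \<theta>"
    unfolding integral_gauss2[OF i5] unfolding fst_conv v_def fst_rot fish_def q_def
    using V_int by (simp add: avg_def[symmetric] power2_norm_eq_inner)
  have e6: "(LINT p|gauss2. b p * (norm (q (fst p)))\<^sup>2) = fish \<theta>"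
    unfolding integral_gauss2[OF i6] fst_conv Fint fish_def
    by (simp add: q_def power_mult_distrib power_divide power2_eq_square less_imp_neq[OF F_pos, symmetric])
  have "(LINT p|gauss2. 2 * l * norm (v p) - 2 * l * (b p * norm (q (fst p))) - l\<^sup>2 * b p)
     \<le> (LINT p|gauss2. (norm (v p))\<^sup>2 / b p - 2 * (v p \<bullet> q (fst p)) + b p * (norm (q (fst p)))\<^sup>2)"
    using i1 i2 i3 i4 i5 i6 by (intro integral_mono pointwise) auto
  also have "\<dots> = fisher - 2 * fish \<theta> + fish \<theta>"
    using i4 i5 i6 by (simp add: e4 e5 e6)
  also have "(LINT p|gauss2. 2 * l * norm (v p) - 2 * l * (b p * norm (q (fst p))) - l\<^sup>2 * b p)
     = 2 * l * VL1 - 2 * l * (LINT x|std_gaussian. norm (Q \<theta> x)) - l\<^sup>2 * mass"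
    using i1 i2 i3 by (simp add: e1 e2 e3)
  finally show ?thesis by (simp add: algebra_simps)
qed


text \<open>The first moment without division by \<open>mass\<close>; it is linear in
  \<open>f\<close> and needs no positivity of the mass.\<close>

definition barycenter :: 'a where "barycenter = (LINT x|std_gaussian. f x *\<^sub>R x)"
definition moment2 :: real where "moment2 = (LINT x|std_gaussian. (norm x)\<^sup>2 * f x)"

lemma mass_nonneg: "0 \<le> mass" by (simp add: mass_def)

lemma f_moments:
  shows f_integrable: "integrable std_gaussian f"
    and f_moment1_integrable: "integrable std_gaussian (\<lambda>x. f x *\<^sub>R x)"
    and f_moment2_integrable: "integrable std_gaussian (\<lambda>x. (norm x)\<^sup>2 * f x)"
proof -
  show "integrable std_gaussian f" by (rule std_gaussian_integrable_bounded[OF _ f_abs_le]) measurable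
  show "integrable std_gaussian (\<lambda>x. f x *\<^sub>R x)"
  proof (rule Bochner_Integration.integrable_bound)
    show "integrable std_gaussian (\<lambda>x::'a. K * norm x)"
      using integrable_std_gaussian_norm[where 'a='a] by simp
  qed (use f_le K_pos in \<open>auto intro!: mult_right_mono simp: abs_mult\<close>)
  show "integrable std_gaussian (\<lambda>x. (norm x)\<^sup>2 * f x)"
  proof (rule Bochner_Integration.integrable_bound)
    show "integrable std_gaussian (\<lambda>x::'a. (norm x)\<^sup>2 * K)"
      using integrable_std_gaussian_norm_sq[where 'a='a] by simp
  qed (use f_le K_pos in \<open>auto intro!: mult_left_mono simp: abs_mult\<close>)
qed

text \<open>Writing \<open>\<parallel>Q\<parallel>\<close> as \<open>Q \<bullet> sgn Q\<close>, an integration by parts in \<open>z\<close> and a rotation move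
  everything onto \<open>f\<close> tested against the smoothed field \<open>avg \<theta> (sgn \<circ> Q)\<close>, which is nearly
  constant when \<open>cos \<theta>\<close> is small; the constant part only sees the barycenter.\<close>

lemma Q_L1_le:
  assumes s: "sin \<theta> > 0" and c: "cos \<theta> \<ge> 0"
  shows "(LINT x|std_gaussian. norm (Q \<theta> x)) \<le>
     norm barycenter + cos \<theta> / sin \<theta> * gauss_mean_norm TYPE('a) * (mass + moment2)"
proof -
  define M where "M = gauss_mean_norm TYPE('a)"
  \<comment> \<open>The field only has to be measurable and bounded by 1, so the discontinuity of
    \<open>sgn\<close> at zeros of \<open>Q \<theta>\<close> does no harm.\<close>
  define w where "w = (\<lambda>x. sgn (Q \<theta> x))"
  have [measurable]: "Q \<theta> \<in> borel_measurable borel" by measurable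
  have [measurable]: "w \<in> borel_measurable borel" unfolding w_def sgn_div_norm by measurable
  have w_le: "norm (w x) \<le> 1" for x by (simp add: w_def norm_sgn)
  have Qw: "Q \<theta> x \<bullet> w x = norm (Q \<theta> x)" for x
    by (cases "Q \<theta> x = 0") (simp_all add: w_def sgn_div_norm power2_norm_eq_inner[symmetric] power2_eq_square)
  have ibp: "sin \<theta> * (Q \<theta> x \<bullet> e) = (LINT z|std_gaussian. (z \<bullet> e) * f (cos \<theta> *\<^sub>R x + sin \<theta> *\<^sub>R z))" for x e
  proof -
    have "(LINT z|std_gaussian. (z \<bullet> e) * f (cos \<theta> *\<^sub>R x + sin \<theta> *\<^sub>R z)) =
      (LINT z|std_gaussian. (sin \<theta> *\<^sub>R V (cos \<theta> *\<^sub>R x + sin \<theta> *\<^sub>R z)) \<bullet> e)"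
    proof (rule gaussian_integration_by_parts)
      fix z
      have "((\<lambda>z. f (cos \<theta> *\<^sub>R x + sin \<theta> *\<^sub>R z)) has_derivative (\<lambda>h. V (cos \<theta> *\<^sub>R x + sin \<theta> *\<^sub>R z) \<bullet> (sin \<theta> *\<^sub>R h))) (at z)"
        by (rule has_derivative_compose[where f="\<lambda>z. cos \<theta> *\<^sub>R x + sin \<theta> *\<^sub>R z", OF _ der])
           (auto intro!: derivative_eq_intros)
      then show "((\<lambda>z. f (cos \<theta> *\<^sub>R x + sin \<theta> *\<^sub>R z)) has_derivative (\<lambda>h. (sin \<theta> *\<^sub>R V (cos \<theta> *\<^sub>R x + sin \<theta> *\<^sub>R z)) \<bullet> h)) (at z)"
        by simp
      show "\<bar>f (cos \<theta> *\<^sub>R x + sin \<theta> *\<^sub>R z)\<bar> \<le> K" using f_abs_le by simp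
      show "norm (sin \<theta> *\<^sub>R V (cos \<theta> *\<^sub>R x + sin \<theta> *\<^sub>R z)) \<le> 1 * L"
        unfolding norm_scaleR by (intro mult_mono V_le) auto
      show "continuous_on UNIV (\<lambda>z. sin \<theta> *\<^sub>R V (cos \<theta> *\<^sub>R x + sin \<theta> *\<^sub>R z))"
        by (intro continuous_intros continuous_on_compose2[OF contV]) auto
    qed
    then show ?thesis unfolding avg_def using V_int by simp
  qed
  define \<Phi> where "\<Phi> = (\<lambda>p. (snd p \<bullet> w (fst p)) * f (fst (rot \<theta> p)))"
  have [measurable]: "\<Phi> \<in> borel_measurable (borel \<Otimes>\<^sub>M borel)" unfolding \<Phi>_def by measurable
  have in_le: "\<bar>y \<bullet> w x\<bar> \<le> norm y" for x y
    using Cauchy_Schwarz_ineq2[of y "w x"] mult_left_mono[OF w_le[of x] norm_ge_zero[of y]] by simp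
  have \<Phi>_int: "integrable gauss2 \<Phi>"
  proof (rule Bochner_Integration.integrable_bound)
    show "integrable gauss2 (\<lambda>p::'a\<times>'a. norm (snd p) * K)"
      using gauss2_integrable_snd[OF integrable_std_gaussian_norm[where 'a='a]] by simp
    have "norm (\<Phi> p) \<le> norm (snd p) * K" for p
      unfolding \<Phi>_def real_norm_def abs_mult using f_abs_le by (intro mult_mono in_le) auto
    then show "AE p in gauss2. norm (\<Phi> p) \<le> norm (norm (snd p) * K)"
      by (intro AE_I2) (metis abs_ge_self order_trans real_norm_def)
  qed simp
  have inner_int: "integrable std_gaussian (\<lambda>v. v \<bullet> w (cos \<theta> *\<^sub>R u + sin \<theta> *\<^sub>R v))" for u
    by (rule Bochner_Integration.integrable_bound[OF integrable_std_gaussian_norm[where 'a='a]])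
       (use in_le in auto)
  have w_int: "integrable std_gaussian (\<lambda>v. w (cos \<theta> *\<^sub>R u + sin \<theta> *\<^sub>R v))" for u
    by (rule std_gaussian_integrable_bounded[OF _ w_le]) measurable
  have M0: "0 \<le> M" by (simp add: M_def gauss_mean_norm_nonneg)
  \<comment> \<open>After the change of variables \<open>z\<close> is \<open>s u - c v\<close> and
    the argument of \<open>w\<close> is \<open>c u + s v\<close>. The part in \<open>v\<close> is at
    most \<open>c * M\<close>; in the part in \<open>u\<close> the smoothed field is frozen at 0, at
    a cost of \<open>c * M * (norm u)\<^sup>2\<close>.\<close>
  have inner: "(LINT v|std_gaussian. \<Phi> (rot \<theta> (u, v))) \<le>
     sin \<theta> * ((f u *\<^sub>R u) \<bullet> avg \<theta> w 0) + cos \<theta> * M * ((norm u)\<^sup>2 * f u) + cos \<theta> * M * f u" for u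
  proof -
    define k where "k = (LINT v|std_gaussian. v \<bullet> w (cos \<theta> *\<^sub>R u + sin \<theta> *\<^sub>R v))"
    have "\<Phi> (rot \<theta> (u, v)) = f u * (sin \<theta> * (u \<bullet> w (cos \<theta> *\<^sub>R u + sin \<theta> *\<^sub>R v)) - cos \<theta> * (v \<bullet> w (cos \<theta> *\<^sub>R u + sin \<theta> *\<^sub>R v)))" for v
      unfolding \<Phi>_def fst_rot snd_rot rot_rot by (simp add: inner_diff_left mult.commute)
    then have "(LINT v|std_gaussian. \<Phi> (rot \<theta> (u, v))) = f u * (sin \<theta> * (u \<bullet> avg \<theta> w u) - cos \<theta> * k)"
      using inner_int[of u] w_int[of u] by (simp add: avg_def k_def)
    also have "\<dots> \<le> f u * (sin \<theta> * (u \<bullet> avg \<theta> w 0) + cos \<theta> * M * (norm u)\<^sup>2 + cos \<theta> * M)"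
    proof (rule mult_left_mono)
      have "\<bar>k\<bar> \<le> (LINT v|std_gaussian. \<bar>v \<bullet> w (cos \<theta> *\<^sub>R u + sin \<theta> *\<^sub>R v)\<bar>)"
        unfolding k_def by (rule integral_abs_bound)
      also have "\<dots> \<le> M" unfolding M_def gauss_mean_norm_def
        by (intro integral_mono integrable_abs inner_int integrable_std_gaussian_norm in_le)
      finally have "- cos \<theta> * k \<le> cos \<theta> * M"
        using c mult_left_mono[of "-k" M "cos \<theta>"] by simp
      moreover have "sin \<theta> * (u \<bullet> (avg \<theta> w u - avg \<theta> w 0)) \<le> cos \<theta> * M * (norm u)\<^sup>2"
      proof -
        have "u \<bullet> (avg \<theta> w u - avg \<theta> w 0) \<le> norm u * norm (avg \<theta> w u - avg \<theta> w 0)"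
          by (rule norm_cauchy_schwarz)
        also have "\<dots> \<le> norm u * (cos \<theta> / sin \<theta> * norm u * M)"
          unfolding M_def by (intro mult_left_mono avg_shift_le w_le s c) auto
        finally have "sin \<theta> * (u \<bullet> (avg \<theta> w u - avg \<theta> w 0)) \<le> sin \<theta> * (norm u * (cos \<theta> / sin \<theta> * norm u * M))"
          using s by (intro mult_left_mono) auto
        also have "\<dots> = cos \<theta> * M * (norm u)\<^sup>2" using s by (simp add: power2_eq_square)
        finally show ?thesis .
      qed
      ultimately show "sin \<theta> * (u \<bullet> avg \<theta> w u) - cos \<theta> * k \<le> sin \<theta> * (u \<bullet> avg \<theta> w 0) + cos \<theta> * M * (norm u)\<^sup>2 + cos \<theta> * M"
        by (simp add: inner_diff_right algebra_simps)
    qed simp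
    finally show ?thesis by (simp add: algebra_simps)
  qed
  have "sin \<theta> * (LINT x|std_gaussian. norm (Q \<theta> x)) = (LINT x|std_gaussian. sin \<theta> * (Q \<theta> x \<bullet> w x))"
    by (simp add: Qw)
  also have "\<dots> = (LINT p|gauss2. \<Phi> p)"
    unfolding ibp integral_gauss2[OF \<Phi>_int] by (simp add: \<Phi>_def fst_rot)
  also have "\<dots> = (LINT p|gauss2. \<Phi> (rot \<theta> p))" by (rule integral_rot[OF _ s, symmetric]) measurable
  also have "\<dots> = (LINT u|std_gaussian. (LINT v|std_gaussian. \<Phi> (rot \<theta> (u, v))))"
    by (rule integral_gauss2) (use \<Phi>_int integrable_rot[OF _ s, of \<Phi>] in simp)
  also have "\<dots> \<le> (LINT u|std_gaussian. sin \<theta> * ((f u *\<^sub>R u) \<bullet> avg \<theta> w 0) + cos \<theta> * M * ((norm u)\<^sup>2 * f u) + cos \<theta> * M * f u)"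
  proof (rule integral_mono[OF _ _ inner])
    show "integrable std_gaussian (\<lambda>u. LINT v|std_gaussian. \<Phi> (rot \<theta> (u, v)))"
      using std_gaussian_pair.integrable_fst'[of "\<lambda>p. \<Phi> (rot \<theta> p)"] \<Phi>_int integrable_rot[OF _ s, of \<Phi>] by simp
    show "integrable std_gaussian (\<lambda>u. sin \<theta> * ((f u *\<^sub>R u) \<bullet> avg \<theta> w 0) + cos \<theta> * M * ((norm u)\<^sup>2 * f u) + cos \<theta> * M * f u)"
      using f_moments by (intro Bochner_Integration.integrable_add integrable_mult_right integrable_inner_left) auto
  qed
  also have "\<dots> = sin \<theta> * (barycenter \<bullet> avg \<theta> w 0) + cos \<theta> * M * moment2 + cos \<theta> * M * mass"
    unfolding barycenter_def moment2_def mass_def using f_moments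
    by (subst Bochner_Integration.integral_add | intro Bochner_Integration.integrable_add integrable_mult_right integrable_inner_left
        | simp add: integral_inner_left del: inner_scaleR_left)+
  also have "barycenter \<bullet> avg \<theta> w 0 \<le> norm barycenter * 1"
    by (intro order_trans[OF norm_cauchy_schwarz] mult_left_mono norm_avg_le w_le) auto
  finally have "sin \<theta> * (LINT x|std_gaussian. norm (Q \<theta> x)) \<le>
      sin \<theta> * norm barycenter + cos \<theta> * M * moment2 + cos \<theta> * M * mass"
    using s by simp
  also have "\<dots> = sin \<theta> * (norm barycenter + cos \<theta> / sin \<theta> * M * (mass + moment2))"
    using s by (simp add: field_simps)
  finally show ?thesis using s by (simp add: M_def)
qed

text \<open>Pisier's rotation argument: the averages join \<open>f\<close> to its mean along a
  quarter circle, whose length is the factor \<open>pi / 2\<close>. Testing against the sign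
  \<open>w\<close> of \<open>f - mass\<close> turns the L1 norm into the increment of a scalar
  function of the angle, whose derivative is at most the mean length times
  \<open>VL1\<close>.\<close>

lemma L1_poincare:
  "(LINT x|std_gaussian. \<bar>f x - mass\<bar>) \<le> pi / 2 * gauss_mean_norm TYPE('a) * VL1"
proof -
  define M where "M = gauss_mean_norm TYPE('a)"
  define w where "w x = sgn (f x - mass)" for x
  have [measurable]: "w \<in> borel_measurable borel" unfolding w_def[abs_def] by measurable
  have w_le: "\<bar>w x\<bar> \<le> 1" for x by (simp add: w_def sgn_real_def)
  define k where "k \<theta> = (LINT x|std_gaussian. F \<theta> x * w x)" for \<theta>
  have k_der: "(k has_real_derivative (LINT x|std_gaussian. T \<theta> x * w x)) (at \<theta>)" for \<theta>
  proof -
    have "((\<lambda>\<theta>. LINT x|std_gaussian. F \<theta> x * w x) has_derivative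
       (\<lambda>h. (LINT x|std_gaussian. T \<theta> x * w x) \<bullet> h)) (at \<theta>)"
    proof (rule has_derivative_integral_param[where r=1 and B="\<lambda>x. L * (norm x + M) * 1"])
      fix \<theta> x
      have "((\<lambda>\<theta>. F \<theta> x * w x) has_real_derivative (T \<theta> x * w x)) (at \<theta>)"
        by (auto intro!: derivative_eq_intros F_DERIV)
      then show "((\<lambda>\<theta>. F \<theta> x * w x) has_derivative (\<lambda>h. (T \<theta> x * w x) \<bullet> h)) (at \<theta>)"
        by (simp add: has_field_derivative_def)
      show "norm (T \<theta> x * w x) \<le> L * (norm x + M) * 1"
        unfolding real_norm_def abs_mult M_def using T_le w_le L_nonneg gauss_mean_norm_nonneg[where 'a='a] by (intro mult_mono) auto
      show "integrable std_gaussian (\<lambda>x. F \<theta> x * w x)"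
      proof (rule std_gaussian_integrable_bounded)
        show "norm (F \<theta> x * w x) \<le> K * 1" for x
          unfolding real_norm_def abs_mult
          using F_le[of \<theta> x] F_pos[of \<theta> x] w_le K_pos by (intro mult_mono) auto
      qed measurable
    next
      show "integrable std_gaussian (\<lambda>x::'a. L * (norm x + M) * 1)"
        using integrable_std_gaussian_norm[where 'a='a] by simp
    qed auto
    then show ?thesis by (simp add: has_field_derivative_def k_def[abs_def])
  qed
  \<comment> \<open>After the change of variables the gradient and the velocity depend on different
    components of the pair, so the integral of the product of their norms factors.\<close>
  have k_bound: "\<bar>LINT x|std_gaussian. T \<theta> x * w x\<bar> \<le> M * VL1" if s: "sin \<theta> > 0" for \<theta>
  proof -
    define \<Phi> where "\<Phi> = (\<lambda>p. norm (V (fst (rot \<theta> p))) * norm (snd (rot \<theta> p)))"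
    have [measurable]: "\<Phi> \<in> borel_measurable (borel \<Otimes>\<^sub>M borel)" unfolding \<Phi>_def by measurable
    have nV: "integrable std_gaussian (\<lambda>x. norm (V x))"
      by (rule std_gaussian_integrable_bounded[of _ L]) (use V_le in auto)
    note prd = gauss2_product[OF nV integrable_std_gaussian_norm]
    have \<Phi>_int: "integrable gauss2 \<Phi>"
      using prd(1) integrable_rot[OF _ s, of "\<lambda>p. norm (V (fst p)) * norm (snd p)"] unfolding \<Phi>_def by simp
    have \<Phi>_val: "(LINT p|gauss2. \<Phi> p) = VL1 * M"
      using prd(2) integral_rot[OF _ s, of "\<lambda>p. norm (V (fst p)) * norm (snd p)"] unfolding \<Phi>_def
      by (simp add: VL1_def M_def gauss_mean_norm_def)
    have Tb: "\<bar>T \<theta> x * w x\<bar> \<le> (LINT z|std_gaussian. \<Phi> (x, z))" if "integrable std_gaussian (\<lambda>z. \<Phi> (x, z))" for x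
    proof -
      have "\<bar>T \<theta> x * w x\<bar> \<le> \<bar>T \<theta> x\<bar>" using w_le[of x] by (simp add: abs_mult mult_left_le)
      also have "\<dots> \<le> (LINT z|std_gaussian. \<bar>V (cos \<theta> *\<^sub>R x + sin \<theta> *\<^sub>R z) \<bullet> (cos \<theta> *\<^sub>R z - sin \<theta> *\<^sub>R x)\<bar>)"
        unfolding T_def by (rule integral_abs_bound)
      also have "\<dots> \<le> (LINT z|std_gaussian. \<Phi> (x, z))"
      proof (intro integral_mono integrable_abs T_int that)
        show "\<bar>V (cos \<theta> *\<^sub>R x + sin \<theta> *\<^sub>R z) \<bullet> (cos \<theta> *\<^sub>R z - sin \<theta> *\<^sub>R x)\<bar> \<le> \<Phi> (x, z)" for z
          unfolding \<Phi>_def fst_rot snd_rot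
          using Cauchy_Schwarz_ineq2[of "V (cos \<theta> *\<^sub>R x + sin \<theta> *\<^sub>R z)" "cos \<theta> *\<^sub>R z - sin \<theta> *\<^sub>R x"]
          by (simp add: norm_minus_commute)
      qed
      finally show ?thesis .
    qed
    have "\<bar>LINT x|std_gaussian. T \<theta> x * w x\<bar> \<le> (LINT x|std_gaussian. \<bar>T \<theta> x * w x\<bar>)"
      by (rule integral_abs_bound)
    also have "\<dots> \<le> (LINT x|std_gaussian. (LINT z|std_gaussian. \<Phi> (x, z)))"
    proof (rule integral_mono_AE)
      show "AE x in std_gaussian. \<bar>T \<theta> x * w x\<bar> \<le> (LINT z|std_gaussian. \<Phi> (x, z))"
        using std_gaussian_pair.AE_integrable_fst'[OF \<Phi>_int] by eventually_elim (rule Tb)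
      show "integrable std_gaussian (\<lambda>x. LINT z|std_gaussian. \<Phi> (x, z))"
        using std_gaussian_pair.integrable_fst'[OF \<Phi>_int] .
      show "integrable std_gaussian (\<lambda>x. \<bar>T \<theta> x * w x\<bar>)"
      proof (rule Bochner_Integration.integrable_bound)
        show "integrable std_gaussian (\<lambda>x::'a. L * (norm x + M))"
          using integrable_std_gaussian_norm[where 'a='a] by simp
        have "\<bar>T \<theta> x * w x\<bar> \<le> L * (norm x + M)" for x
          using T_le[of \<theta> x] mult_left_mono[OF w_le[of x] abs_ge_zero[of "T \<theta> x"]] by (simp add: abs_mult M_def)
        then show "AE x in std_gaussian. norm \<bar>T \<theta> x * w x\<bar> \<le> norm (L * (norm x + M))"
          by (intro AE_I2) (simp, metis abs_ge_self order_trans)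
      qed measurable
    qed
    also have "\<dots> = VL1 * M" using \<Phi>_val integral_gauss2[OF \<Phi>_int] by simp
    finally show ?thesis by (simp add: mult.commute)
  qed
  have fw: "integrable std_gaussian (\<lambda>x. f x * w x)" "integrable std_gaussian w"
    by (rule std_gaussian_integrable_bounded[of _ K], measurable, simp add: abs_mult mult_mono'[OF f_le w_le, simplified])
       (rule std_gaussian_integrable_bounded[of _ 1], use w_le in auto)
  have "(LINT x|std_gaussian. \<bar>f x - mass\<bar>) = (LINT x|std_gaussian. f x * w x - mass * w x)"
    by (intro Bochner_Integration.integral_cong) (auto simp: w_def sgn_real_def)
  \<comment> \<open>At angle 0 the average is \<open>f\<close>, at \<open>pi / 2\<close> it is the
    constant \<open>mass\<close>.\<close>
  also have "\<dots> = k 0 - k (pi / 2)"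
    using fw by (simp add: k_def avg_def mass_def[symmetric] std_gaussian.prob_space[simplified])
  also have "\<dots> \<le> pi / 2 * (M * VL1)"
  proof -
    \<comment> \<open>The mean value theorem asks for the derivative bound at an interior angle
      only, where the sine is positive and the change of variables is available.\<close>
    obtain \<xi> where \<xi>: "0 < \<xi>" "\<xi> < pi / 2" "k (pi / 2) - k 0 = (pi / 2 - 0) * (LINT x|std_gaussian. T \<xi> x * w x)"
      using MVT2[of 0 "pi / 2" k "\<lambda>\<theta>. LINT x|std_gaussian. T \<theta> x * w x"] k_der by auto
    have "sin \<xi> > 0" using \<xi> by (intro sin_gt_zero) auto
    from k_bound[OF this] have "- (LINT x|std_gaussian. T \<xi> x * w x) \<le> M * VL1" by linarith
    then have "pi / 2 * - (LINT x|std_gaussian. T \<xi> x * w x) \<le> pi / 2 * (M * VL1)" by (intro mult_left_mono) auto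
    then show ?thesis using \<xi>(3) by simp
  qed
  finally show ?thesis by (simp add: M_def)
qed

end

section \<open>The stability inequality and its closure under limits\<close>

text \<open>An upper bound for the entropy: \<open>m * ln m\<close> is the entropy at angle
  \<open>pi / 2\<close>, \<open>J / 2\<close> the usual Fisher term, and the rest the gain from
  angles beyond \<theta>. Here \<kappa> is the L1 Poincare constant, \<eta> bounds the L1 norm of
  the averaged gradient, and \<mu> is the free Young parameter, rescaled as
  \<open>l = \<kappa> * \<mu>\<close>. The Fisher information is a separate argument so that it can
  follow its own limit.\<close>

definition stab_rhs :: "real \<Rightarrow> real \<Rightarrow> ('a::euclidean_space \<Rightarrow> real) \<Rightarrow> real \<Rightarrow> real" where
  "stab_rhs \<theta> \<mu> f J = (let m = (LINT x|std_gaussian. f x); M = gauss_mean_norm TYPE('a); \<kappa> = pi / 2 * M;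
      \<eta> = norm (LINT x|std_gaussian. f x *\<^sub>R x) + cos \<theta> / sin \<theta> * M * (m + (LINT x|std_gaussian. (norm x)\<^sup>2 * f x))
    in m * ln m + J / 2 - (cos \<theta>)\<^sup>2 / 2 *
      (2 * \<mu> * ((LINT x|std_gaussian. \<bar>f x - m\<bar>) - \<kappa> * \<eta>) - (\<kappa> * \<mu>)\<^sup>2 * m))"

context nice_density
begin

text \<open>The entropy has rate \<open>- (sin \<theta> * cos \<theta>) * fish \<theta>\<close> and
  \<open>(sin \<theta>)\<^sup>2 / 2\<close> has rate \<open>sin \<theta> * cos \<theta>\<close>.
  Bounding \<open>fish\<close> by \<open>fisher\<close> below \<open>\<theta>0\<close> and by
  \<open>fisher - r\<close> above it, the gain \<open>r\<close> is weighted by the remaining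
  increment \<open>(1 - (sin \<theta>0)\<^sup>2) / 2\<close>.\<close>

lemma stability:
  assumes \<theta>0: "0 < \<theta>0" "\<theta>0 < pi / 2" and \<mu>: "0 \<le> \<mu>"
  shows "(LINT x|std_gaussian. f x * ln (f x)) \<le> stab_rhs \<theta>0 \<mu> f fisher"
proof -
  define M where "M = gauss_mean_norm TYPE('a)"
  define \<kappa> where "\<kappa> = pi / 2 * M"
  define \<eta> where "\<eta> = norm barycenter + cos \<theta>0 / sin \<theta>0 * M * (mass + moment2)"
  define N where "N = (LINT x|std_gaussian. \<bar>f x - mass\<bar>)"
  define r where "r = 2 * \<mu> * (N - \<kappa> * \<eta>) - (\<kappa> * \<mu>)\<^sup>2 * mass"
  have M0: "0 \<le> M" by (simp add: M_def gauss_mean_norm_nonneg)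
  have \<kappa>0: "0 \<le> \<kappa>" using M0 by (simp add: \<kappa>_def)
  have mom0: "0 \<le> moment2" by (simp add: moment2_def)
  have sin_pos: "sin \<theta> > 0" if "0 < \<theta>" "\<theta> \<le> pi / 2" for \<theta>
    using that pi_gt_zero by (intro sin_gt_zero) linarith+
  have cos_nonneg: "cos \<theta> \<ge> 0" if "0 < \<theta>" "\<theta> \<le> pi / 2" for \<theta>
    using that by (intro cos_ge_zero) auto
  \<comment> \<open>The parameter \<open>l = 0\<close> leaves just the monotonicity of the Fisher
    information.\<close>
  have fish1: "fish \<theta> \<le> fisher" if "0 < \<theta>" "\<theta> \<le> pi / 2" for \<theta>
    using fish_bound[OF sin_pos[OF that], of 0] by simp
  have fish2: "fish \<theta> \<le> fisher - r" if \<theta>: "\<theta>0 \<le> \<theta>" "\<theta> \<le> pi / 2" for \<theta>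
  proof -
    have \<theta>': "0 < \<theta>" using \<theta> \<theta>0 by simp
    define q where "q = (LINT x|std_gaussian. norm (Q \<theta> x))"
    have "q \<le> norm barycenter + cos \<theta> / sin \<theta> * M * (mass + moment2)"
      unfolding q_def M_def by (rule Q_L1_le[OF sin_pos cos_nonneg]) (use \<theta> \<theta>' in auto)
    \<comment> \<open>The cotangent decreases, so its value at \<open>\<theta>0\<close> serves all
      larger angles.\<close>
    also have "\<dots> \<le> \<eta>"
      unfolding \<eta>_def
    proof (intro add_left_mono mult_right_mono frac_le)
      show "cos \<theta> \<le> cos \<theta>0" using \<theta> \<theta>0 by (intro cos_monotone_0_pi_le) auto
      show "sin \<theta>0 \<le> sin \<theta>" using \<theta> \<theta>0 by (intro sin_monotone_2pi_le) auto
    qed (use \<theta>0 sin_pos[of \<theta>0] cos_nonneg[of \<theta>0] M0 mass_nonneg mom0 in auto)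
    finally have "\<kappa> * q \<le> \<kappa> * \<eta>" using \<kappa>0 by (rule mult_left_mono)
    moreover have "N \<le> \<kappa> * VL1" using L1_poincare by (simp add: N_def \<kappa>_def M_def)
    \<comment> \<open>The Poincare inequality trades the gradient norm for \<open>N\<close>. Using
      \<open>l = \<kappa> * \<mu>\<close> afterwards absorbs \<kappa> without dividing by
      it.\<close>
    ultimately have "\<mu> * (N - \<kappa> * \<eta>) \<le> \<mu> * (\<kappa> * (VL1 - q))"
      using \<mu> by (intro mult_left_mono) (auto simp: algebra_simps)
    then have "r \<le> 2 * (\<kappa> * \<mu>) * (VL1 - q) - (\<kappa> * \<mu>)\<^sup>2 * mass"
      by (simp add: r_def algebra_simps)
    also have "\<dots> \<le> fisher - fish \<theta>"
      unfolding q_def by (rule fish_bound[OF sin_pos]) (use \<theta> \<theta>' \<kappa>0 \<mu> in auto)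
    finally show ?thesis by simp
  qed
  \<comment> \<open>A differential inequality in place of an integral of \<open>fish\<close>:
    neither continuity nor measurability of \<open>fish\<close> in the angle is required, and
    derivatives are taken in the open interval only.\<close>
  have mono: "ent u + b * ((sin u)\<^sup>2 / 2) \<le> ent v + b * ((sin v)\<^sup>2 / 2)"
    if u: "0 \<le> u" "u \<le> v" "v \<le> pi / 2" and b: "\<And>\<theta>. u < \<theta> \<Longrightarrow> \<theta> < v \<Longrightarrow> fish \<theta> \<le> b" for u v b
  proof (rule DERIV_nonneg_imp_increasing_open[where f="\<lambda>\<theta>. ent \<theta> + b * ((sin \<theta>)\<^sup>2 / 2)", OF u(2)])
    fix \<theta> assume \<theta>: "u < \<theta>" "\<theta> < v"
    have s: "sin \<theta> > 0" and c: "cos \<theta> \<ge> 0" using \<theta> u by (auto intro!: sin_pos cos_nonneg)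
    have "((\<lambda>\<theta>. ent \<theta> + b * ((sin \<theta>)\<^sup>2 / 2)) has_real_derivative - (sin \<theta> * cos \<theta>) * fish \<theta> + b * (sin \<theta> * cos \<theta>)) (at \<theta>)"
      by (auto intro!: derivative_eq_intros ent_DERIV[of \<theta>, unfolded ent_rate[OF s]])
    moreover have "0 \<le> - (sin \<theta> * cos \<theta>) * fish \<theta> + b * (sin \<theta> * cos \<theta>)"
      using mult_left_mono[OF b[OF \<theta>], of "sin \<theta> * cos \<theta>"] s c by (simp add: algebra_simps)
    ultimately show "\<exists>y. ((\<lambda>\<theta>. ent \<theta> + b * ((sin \<theta>)\<^sup>2 / 2)) has_real_derivative y) (at \<theta>) \<and> 0 \<le> y" by blast
  next
    have "continuous_on {u..v} ent"
      using ent_DERIV by (meson DERIV_isCont continuous_at_imp_continuous_on)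
    then show "continuous_on {u..v} (\<lambda>\<theta>. ent \<theta> + b * ((sin \<theta>)\<^sup>2 / 2))" by (intro continuous_intros) auto
  qed
  have "ent 0 + fisher * ((sin 0)\<^sup>2 / 2) \<le> ent \<theta>0 + fisher * ((sin \<theta>0)\<^sup>2 / 2)"
    by (rule mono) (use \<theta>0 fish1 in auto)
  moreover have "ent \<theta>0 + (fisher - r) * ((sin \<theta>0)\<^sup>2 / 2) \<le> ent (pi / 2) + (fisher - r) * ((sin (pi / 2))\<^sup>2 / 2)"
    by (rule mono) (use \<theta>0 fish2 in auto)
  moreover have "ent (pi / 2) = mass * ln mass"
    by (simp add: ent_def avg_def mass_def[symmetric] std_gaussian.prob_space[simplified])
  moreover have "(sin \<theta>0)\<^sup>2 = 1 - (cos \<theta>0)\<^sup>2" by (simp add: sin_squared_eq)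
  ultimately have "ent 0 \<le> mass * ln mass + fisher / 2 - (cos \<theta>0)\<^sup>2 / 2 * r"
    by (simp add: field_simps)
  moreover have "ent 0 = (LINT x|std_gaussian. f x * ln (f x))"
    by (simp add: ent_def avg_def std_gaussian.prob_space[simplified])
  ultimately show ?thesis
    by (simp add: stab_rhs_def Let_def r_def N_def \<eta>_def \<kappa>_def M_def mass_def barycenter_def moment2_def)
qed

end

section \<open>Closure of the stability inequality under weighted L1 limits\<close>

lemma x_ln_x_ge: "(0::real) \<le> t \<Longrightarrow> -1 \<le> t * ln t"
proof (cases "t = 0")
  case False
  assume "0 \<le> t"
  with False have t: "0 < t" by simp
  have "ln (1 / t) \<le> 1 / t - 1" using t by (intro ln_le_minus_one) auto
  then have "- ln t \<le> 1 / t - 1" using t by (simp add: ln_div)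
  then have "t * - ln t \<le> t * (1 / t - 1)" using t by (intro mult_left_mono) auto
  then show ?thesis using t by (simp add: algebra_simps)
qed simp

text \<open>The entropy enters as a nonnegative integral, shifted by 2, so that no integrability of
  \<open>f * ln f\<close> has to be assumed and so that the left-hand side is at least 1.\<close>

definition stable :: "('a::euclidean_space \<Rightarrow> real) \<Rightarrow> real \<Rightarrow> bool" where
  "stable f J \<longleftrightarrow> f \<in> borel_measurable borel \<and> (\<forall>x. 0 \<le> f x) \<and> integrable std_gaussian f \<and>
     integrable std_gaussian (\<lambda>x. (norm x)\<^sup>2 * f x) \<and>
     (\<forall>\<theta> \<mu>. 0 < \<theta> \<longrightarrow> \<theta> < pi / 2 \<longrightarrow> 0 \<le> \<mu> \<longrightarrow>
        (\<integral>\<^sup>+x. ennreal (f x * ln (f x) + 2) \<partial>std_gaussian) \<le> ennreal (2 + stab_rhs \<theta> \<mu> f J))"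

lemma (in nice_density) stable: "stable f fisher"
  unfolding stable_def
proof (intro conjI allI impI f_meas f_integrable f_moment2_integrable)
  fix \<theta> \<mu> :: real assume a: "0 < \<theta>" "\<theta> < pi / 2" "0 \<le> \<mu>"
  have i: "integrable std_gaussian (\<lambda>x. f x * ln (f x))"
  proof (rule std_gaussian_integrable_bounded)
    show "norm (f x * ln (f x)) \<le> K * lnb" for x
    proof -
      have "F 0 x = f x" by (simp add: avg_def std_gaussian.prob_space[simplified])
      then show ?thesis
        unfolding real_norm_def abs_mult
        using f_le[of x] f_pos[of x] ln_F_le[of 0 x] K_pos by (intro mult_mono) auto
    qed
  qed measurable
  have nn: "0 \<le> f x * ln (f x) + 2" for x using x_ln_x_ge[of "f x"] by simp
  have "(\<integral>\<^sup>+x. ennreal (f x * ln (f x) + 2) \<partial>std_gaussian) = ennreal (LINT x|std_gaussian. f x * ln (f x) + 2)"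
    using i nn by (intro nn_integral_eq_integral) auto
  also have "(LINT x|std_gaussian. f x * ln (f x) + 2) = (LINT x|std_gaussian. f x * ln (f x)) + 2"
    using i by (simp add: std_gaussian.prob_space[simplified])
  also have "ennreal \<dots> \<le> ennreal (2 + stab_rhs \<theta> \<mu> f fisher)"
    using stability[OF a] by (intro ennreal_leI) simp
  finally show "(\<integral>\<^sup>+x. ennreal (f x * ln (f x) + 2) \<partial>std_gaussian) \<le> ennreal (2 + stab_rhs \<theta> \<mu> f fisher)" .
qed simp

text \<open>One sequence of real majorants \<open>b\<close> controls integrands with values in any
  Banach space, so mass, barycenter and second moment can share the same \<open>b\<close>.\<close>

lemma tendsto_integral_L1:
  fixes h :: "nat \<Rightarrow> 'a \<Rightarrow> 'b::{banach, second_countable_topology}"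
  assumes "\<And>j. integrable M (h j)" "integrable M h0" "\<And>j. integrable M (b j)"
    and "(\<lambda>j. LINT x|M. b j x) \<longlonglongrightarrow> 0" and "\<And>j x. norm (h j x - h0 x) \<le> b j x"
  shows "(\<lambda>j. LINT x|M. h j x) \<longlonglongrightarrow> (LINT x|M. h0 x)"
proof (rule Lim_null[THEN iffD2], rule Lim_null_comparison[OF _ assms(4)], rule always_eventually, rule allI)
  fix j
  have "norm ((LINT x|M. h j x) - (LINT x|M. h0 x)) = norm (LINT x|M. h j x - h0 x)"
    using assms by simp
  also have "\<dots> \<le> (LINT x|M. norm (h j x - h0 x))" by (rule integral_norm_bound)
  also have "\<dots> \<le> (LINT x|M. b j x)" using assms by (intro integral_mono) auto
  finally show "norm ((LINT x|M. h j x) - (LINT x|M. h0 x)) \<le> (LINT x|M. b j x)" .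
qed

lemma x_ln_x_tendsto:
  assumes "u \<longlonglongrightarrow> (t::real)" "0 < t" shows "(\<lambda>n. u n * ln (u n)) \<longlonglongrightarrow> t * ln t"
  using assms by (intro tendsto_intros) auto

lemma integrable_weighted:
  fixes f :: "'a::euclidean_space \<Rightarrow> real"
  assumes [measurable]: "f \<in> borel_measurable borel"
    and i: "integrable std_gaussian f" "integrable std_gaussian (\<lambda>x. (norm x)\<^sup>2 * f x)"
  shows "integrable std_gaussian (\<lambda>x. f x *\<^sub>R x)"
proof (rule Bochner_Integration.integrable_bound)
  show "integrable std_gaussian (\<lambda>x. \<bar>f x\<bar> + \<bar>(norm x)\<^sup>2 * f x\<bar>)"
    using i by (intro Bochner_Integration.integrable_add integrable_abs)
  have "r \<le> 1 + r\<^sup>2" for r :: real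
    using sum_power2_ge_zero[of "r-1/2" 0] by (simp add: power2_eq_square algebra_simps)
  from mult_left_mono[OF this, of "\<bar>f x\<bar>" "norm x" for x]
  show "AE x in std_gaussian. norm (f x *\<^sub>R x) \<le> norm (\<bar>f x\<bar> + \<bar>(norm x)\<^sup>2 * f x\<bar>)"
    by (auto simp: abs_mult algebra_simps)
qed measurable

text \<open>Convergence with weight \<open>1 + (norm x)\<^sup>2\<close> makes the mass, the first
  and second moments and the L1 deviation converge, hence the whole right-hand side; positivity of
  the limiting mass gives continuity of \<open>m * ln m\<close>. On the left the shifted integrand
  is nonnegative and Fatou's lemma applies along an almost everywhere convergent
  subsequence.\<close>

lemma stable_limit:
  fixes f :: "nat \<Rightarrow> 'a::euclidean_space \<Rightarrow> real"
  assumes st: "\<And>j. stable (f j) (J j)" and J: "J \<longlonglongrightarrow> J0"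
    and [measurable]: "f0 \<in> borel_measurable borel" and f0: "\<And>x. 0 \<le> f0 x"
    and i0: "integrable std_gaussian f0" "integrable std_gaussian (\<lambda>x. (norm x)\<^sup>2 * f0 x)"
    and m0: "0 < (LINT x|std_gaussian. f0 x)"
    and lim: "(\<lambda>j. LINT x|std_gaussian. (1 + (norm x)\<^sup>2) * \<bar>f j x - f0 x\<bar>) \<longlonglongrightarrow> 0"
  shows "stable f0 J0"
proof -
  have [measurable]: "f j \<in> borel_measurable borel" and fj: "0 \<le> f j x"
    and ij: "integrable std_gaussian (f j)" "integrable std_gaussian (\<lambda>x. (norm x)\<^sup>2 * f j x)" for j x
    using st by (auto simp: stable_def)
  have sc: "\<bar>(norm x)\<^sup>2 * u - (norm x)\<^sup>2 * v\<bar> = (norm x)\<^sup>2 * \<bar>u - v\<bar>" for x :: 'a and u v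
    by (simp add: right_diff_distrib[symmetric] abs_mult)
  define b where "b j x = (1 + (norm x)\<^sup>2) * \<bar>f j x - f0 x\<bar>" for j and x :: 'a
  have bi: "integrable std_gaussian (b j)" for j
  proof -
    have "integrable std_gaussian (\<lambda>x. \<bar>f j x - f0 x\<bar> + \<bar>(norm x)\<^sup>2 * f j x - (norm x)\<^sup>2 * f0 x\<bar>)"
      using ij i0 by (intro Bochner_Integration.integrable_add integrable_abs Bochner_Integration.integrable_diff)
    moreover have "(\<lambda>x. \<bar>f j x - f0 x\<bar> + \<bar>(norm x)\<^sup>2 * f j x - (norm x)\<^sup>2 * f0 x\<bar>) = b j"
      by (simp add: b_def[abs_def] sc distrib_right)
    ultimately show ?thesis by simp
  qed
  have lim: "(\<lambda>j. LINT x|std_gaussian. b j x) \<longlonglongrightarrow> 0" using lim by (simp add: b_def)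
  have b1: "\<bar>f j x - f0 x\<bar> \<le> b j x" for j x
    using mult_right_mono[of 1 "1 + (norm x)\<^sup>2" "\<bar>f j x - f0 x\<bar>"] by (simp add: b_def)
  have mass: "(\<lambda>j. LINT x|std_gaussian. f j x) \<longlonglongrightarrow> (LINT x|std_gaussian. f0 x)"
    by (rule tendsto_integral_L1[OF ij(1) i0(1) bi lim]) (use b1 in auto)
  have mom: "(\<lambda>j. LINT x|std_gaussian. (norm x)\<^sup>2 * f j x) \<longlonglongrightarrow> (LINT x|std_gaussian. (norm x)\<^sup>2 * f0 x)"
    by (rule tendsto_integral_L1[OF ij(2) i0(2) bi lim])
       (simp add: b_def sc distrib_right)
  have bary: "(\<lambda>j. LINT x|std_gaussian. f j x *\<^sub>R x) \<longlonglongrightarrow> (LINT x|std_gaussian. f0 x *\<^sub>R x)"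
  proof (rule tendsto_integral_L1[OF _ _ bi lim])
    show "integrable std_gaussian (\<lambda>x. f j x *\<^sub>R x)" for j by (rule integrable_weighted) (use ij in auto)
    show "integrable std_gaussian (\<lambda>x. f0 x *\<^sub>R x)" by (rule integrable_weighted) (use i0 in auto)
    have r: "r \<le> 1 + r\<^sup>2" for r :: real
      using sum_power2_ge_zero[of "r-1/2" 0] by (simp add: power2_eq_square algebra_simps)
    show "norm (f j x *\<^sub>R x - f0 x *\<^sub>R x) \<le> b j x" for j x
      using mult_right_mono[OF r[of "norm x"], of "\<bar>f j x - f0 x\<bar>"]
      by (simp add: b_def scaleR_diff_left[symmetric] mult.commute)
  qed
  have dev: "(\<lambda>j. LINT x|std_gaussian. \<bar>f j x - (LINT x|std_gaussian. f j x)\<bar>) \<longlonglongrightarrow>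
      (LINT x|std_gaussian. \<bar>f0 x - (LINT x|std_gaussian. f0 x)\<bar>)"
  proof (rule tendsto_integral_L1)
    show "integrable std_gaussian (\<lambda>x. b j x + \<bar>(LINT x|std_gaussian. f j x) - (LINT x|std_gaussian. f0 x)\<bar>)" for j
      using bi[of j] by simp
    have "(\<lambda>j. (LINT x|std_gaussian. b j x) + \<bar>(LINT x|std_gaussian. f j x) - (LINT x|std_gaussian. f0 x)\<bar>) \<longlonglongrightarrow>
       0 + \<bar>(LINT x|std_gaussian. f0 x) - (LINT x|std_gaussian. f0 x)\<bar>"
      by (intro tendsto_intros lim mass)
    then show "(\<lambda>j. LINT x|std_gaussian. b j x + \<bar>(LINT x|std_gaussian. f j x) - (LINT x|std_gaussian. f0 x)\<bar>) \<longlonglongrightarrow> 0"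
      using bi by (simp add: std_gaussian.prob_space[simplified])
    show "norm (\<bar>f j x - (LINT x|std_gaussian. f j x)\<bar> - \<bar>f0 x - (LINT x|std_gaussian. f0 x)\<bar>)
       \<le> b j x + \<bar>(LINT x|std_gaussian. f j x) - (LINT x|std_gaussian. f0 x)\<bar>" for j x
      using b1[of j x] by (simp add: abs_if split: if_splits)
  qed (use ij i0 in auto)
  have "(\<lambda>j. LINT x|std_gaussian. norm (f j x - f0 x)) \<longlonglongrightarrow> 0"
  proof (rule tendsto_sandwich[OF _ _ tendsto_const lim])
    show "\<forall>\<^sub>F j in sequentially. (LINT x|std_gaussian. norm (f j x - f0 x)) \<le> (LINT x|std_gaussian. b j x)"
      using ij i0 bi b1 by (intro always_eventually allI integral_mono) auto
  qed simp
  then obtain r where r: "strict_mono r" and ae: "AE x in std_gaussian. (\<lambda>n. f (r n) x - f0 x) \<longlonglongrightarrow> 0"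
    using tendsto_L1_AE_subseq[of std_gaussian "\<lambda>j x. f j x - f0 x"] ij i0 by auto
  show ?thesis
    unfolding stable_def
  proof (intro conjI allI impI i0 f0)
    fix \<theta> \<mu> :: real assume a: "0 < \<theta>" "\<theta> < pi / 2" "0 \<le> \<mu>"
    have rhs: "(\<lambda>j. stab_rhs \<theta> \<mu> (f j) (J j)) \<longlonglongrightarrow> stab_rhs \<theta> \<mu> f0 J0"
      unfolding stab_rhs_def Let_def
      by (intro tendsto_intros mass mom bary dev J x_ln_x_tendsto m0) auto
    have rhs: "(\<lambda>j. ennreal (2 + stab_rhs \<theta> \<mu> (f (r j)) (J (r j)))) \<longlonglongrightarrow> ennreal (2 + stab_rhs \<theta> \<mu> f0 J0)"
      using LIMSEQ_subseq_LIMSEQ[OF rhs r] by (intro tendsto_ennrealI tendsto_intros) (simp add: o_def)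
    have "(\<integral>\<^sup>+x. ennreal (f0 x * ln (f0 x) + 2) \<partial>std_gaussian)
       = (\<integral>\<^sup>+x. liminf (\<lambda>j. ennreal (f (r j) x * ln (f (r j) x) + 2)) \<partial>std_gaussian)"
    proof (rule nn_integral_cong_AE, use ae in eventually_elim)
      fix x assume "(\<lambda>n. f (r n) x - f0 x) \<longlonglongrightarrow> 0"
      then have l: "(\<lambda>n. f (r n) x) \<longlonglongrightarrow> f0 x" by (rule LIM_zero_cancel)
      have "(\<lambda>n. f (r n) x * ln (f (r n) x)) \<longlonglongrightarrow> f0 x * ln (f0 x)"
      proof (cases "f0 x = 0")
        case False
        then show ?thesis using f0[of x] by (intro x_ln_x_tendsto l) auto
      next
        case True
        \<comment> \<open>At zeros of \<open>f0\<close> the approximants may be positive or zero: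
          the right-hand limit handles the former, the convention \<open>0 * ln 0 = 0\<close> the
          latter.\<close>
        have c: "((\<lambda>t::real. t * ln t) \<longlongrightarrow> 0) (at_right 0)" by real_asymp
        show ?thesis unfolding True
        proof (rule LIMSEQ_I)
          fix e :: real assume "0 < e"
          with c have "\<forall>\<^sub>F t::real in at_right 0. norm (t * ln t - 0) < e"
            by (auto simp: tendsto_iff dist_norm)
          then obtain d :: real where d: "d > 0" "\<And>t. 0 < t \<Longrightarrow> t < d \<Longrightarrow> norm (t * ln t) < e"
            by (auto simp: eventually_at_right_field)
          from LIMSEQ_D[OF l d(1)] obtain no where "\<forall>n\<ge>no. norm (f (r n) x - f0 x) < d" by blast
          then have "norm (f (r n) x * ln (f (r n) x) - 0 * ln 0) < e" if "n \<ge> no" for n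
            using that d(2)[of "f (r n) x"] True fj[of "r n" x] \<open>0 < e\<close> by (cases "f (r n) x = 0") auto
          then show "\<exists>no. \<forall>n\<ge>no. norm (f (r n) x * ln (f (r n) x) - 0 * ln 0) < e" by blast
        qed
      qed
      then have "(\<lambda>n. ennreal (f (r n) x * ln (f (r n) x) + 2)) \<longlonglongrightarrow> ennreal (f0 x * ln (f0 x) + 2)"
        by (intro tendsto_ennrealI tendsto_add tendsto_const)
      then show "ennreal (f0 x * ln (f0 x) + 2) = liminf (\<lambda>j. ennreal (f (r j) x * ln (f (r j) x) + 2))"
        by (intro lim_imp_Liminf[symmetric]) auto
    qed
    also have "\<dots> \<le> liminf (\<lambda>j. \<integral>\<^sup>+x. ennreal (f (r j) x * ln (f (r j) x) + 2) \<partial>std_gaussian)"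
      by (rule nn_integral_liminf) measurable
    also have "\<dots> \<le> liminf (\<lambda>j. ennreal (2 + stab_rhs \<theta> \<mu> (f (r j)) (J (r j))))"
      using st a by (intro Liminf_mono always_eventually allI) (auto simp: stable_def)
    also have "\<dots> = ennreal (2 + stab_rhs \<theta> \<mu> f0 J0)"
      using rhs by (intro lim_imp_Liminf) auto
    finally show "(\<integral>\<^sup>+x. ennreal (f0 x * ln (f0 x) + 2) \<partial>std_gaussian) \<le> ennreal (2 + stab_rhs \<theta> \<mu> f0 J0)" .
  qed measurable
qed

section \<open>Mollifiers\<close>

text \<open>The functions \<open>p(1/t) exp(-1/t)\<close>, extended by 0, are closed under
  differentiation: with \<open>s = 1/t\<close> the polynomial \<open>p\<close> is replaced by
  \<open>s\<^sup>2 (p - p')\<close>. The polynomial is a parameter for this reason, and smoothness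
  follows by induction.\<close>

definition flat_exp :: "real poly \<Rightarrow> real \<Rightarrow> real" where
  "flat_exp p t = (if t > 0 then poly p (1 / t) * exp (- (1 / t)) else 0)"

lemma poly_times_exp_minus_tendsto_0:
  fixes p :: "real poly"
  shows "((\<lambda>s. poly p s * exp (- s)) \<longlongrightarrow> 0) at_top"
proof -
  have "((\<lambda>s. \<Sum>i\<le>degree p. coeff p i * (s ^ i / exp s)) \<longlongrightarrow> (\<Sum>i\<le>degree p. coeff p i * 0)) at_top"
    by (intro tendsto_intros tendsto_power_div_exp_0)
  then show ?thesis
    by (simp add: poly_altdef sum_distrib_right exp_minus divide_inverse mult.assoc)
qed

lemma flat_exp_DERIV:
  "(flat_exp p has_real_derivative flat_exp (monom 1 2 * (p - pderiv p)) t) (at t)"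
proof -
  consider "t > 0" | "t < 0" | "t = 0" by linarith
  then show ?thesis
  proof cases
    case 1
    have "((\<lambda>t. poly p (1 / t) * exp (- (1 / t))) has_real_derivative
        flat_exp (monom 1 2 * (p - pderiv p)) t) (at t)"
      using 1 by (auto intro!: derivative_eq_intros DERIV_chain2[OF poly_DERIV]
        simp: flat_exp_def poly_monom field_simps power2_eq_square)
    then show ?thesis
      by (rule has_field_derivative_transform_within_open[of _ _ _ "{0<..}"]) (use 1 in \<open>auto simp: flat_exp_def\<close>)
  next
    case 2
    have "((\<lambda>t. 0) has_real_derivative flat_exp (monom 1 2 * (p - pderiv p)) t) (at t)"
      using 2 by (simp add: flat_exp_def)
    then show ?thesis
      by (rule has_field_derivative_transform_within_open[of _ _ _ "{..<0}"]) (use 2 in \<open>auto simp: flat_exp_def\<close>)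
  next
    case 3
    \<comment> \<open>Dividing by \<open>h\<close> multiplies the polynomial in \<open>1 / h\<close>
      by its variable, hence \<open>pCons 0 p\<close>; the exponential still dominates.\<close>
    have "((\<lambda>h. flat_exp p h / h) \<longlongrightarrow> 0) (at_right 0)"
    proof (rule Lim_transform_eventually)
      show "((\<lambda>h. poly (pCons 0 p) (inverse h) * exp (- inverse h)) \<longlongrightarrow> 0) (at_right (0::real))"
        by (rule filterlim_compose[OF poly_times_exp_minus_tendsto_0 filterlim_inverse_at_top_right])
      show "\<forall>\<^sub>F h in at_right 0. poly (pCons 0 p) (inverse h) * exp (- inverse h) = flat_exp p h / h"
        by (auto simp: eventually_at_right_field flat_exp_def divide_inverse intro!: exI[of _ 1])
    qed
    moreover have "((\<lambda>h. flat_exp p h / h) \<longlongrightarrow> 0) (at_left 0)"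
      by (rule Lim_transform_eventually[OF tendsto_const])
         (auto simp: eventually_at_left_field flat_exp_def intro!: exI[of _ "-1"])
    ultimately have "((\<lambda>h. flat_exp p h / h) \<longlongrightarrow> 0) (at 0)" by (simp add: filterlim_split_at)
    then show ?thesis unfolding 3 DERIV_def by (simp add: flat_exp_def)
  qed
qed

section \<open>Calculus of the classes \<open>Ck\<close>, gradients and supports of test
  functions\<close>

lemma partial_deriv_eq:
  assumes "(\<phi> has_derivative D) (at x)" shows "partial_deriv i \<phi> x = D i"
  using frechet_derivative_at[OF assms] by (simp add: partial_deriv_def)

lemma Ck_Suc_imp: "Ck (Suc k) \<phi> \<Longrightarrow> Ck k \<phi>"
proof (induction k arbitrary: \<phi>)
  case 0
  then show ?case
    by (auto intro!: continuous_at_imp_continuous_on differentiable_imp_continuous_within)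
next
  case (Suc k)
  then show ?case by (metis Ck.simps(2))
qed

lemma Ck_const: "Ck k (\<lambda>x. c)"
proof (induction k arbitrary: c)
  case (Suc k)
  have "partial_deriv i (\<lambda>x::'a. c) = (\<lambda>x. 0)" for i
    by (rule ext, rule partial_deriv_eq[where D="\<lambda>_. 0"]) simp
  then show ?case using Suc by simp
qed simp

lemma Ck_add: "Ck k f \<Longrightarrow> Ck k g \<Longrightarrow> Ck k (\<lambda>x. f x + g x)"
proof (induction k arbitrary: f g)
  case 0
  then show ?case by (auto intro: continuous_intros)
next
  case (Suc k)
  have "partial_deriv i (\<lambda>x. f x + g x) = (\<lambda>x. partial_deriv i f x + partial_deriv i g x)" for i
  proof
    fix x
    show "partial_deriv i (\<lambda>x. f x + g x) x = partial_deriv i f x + partial_deriv i g x"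
      unfolding partial_deriv_def[of i f] partial_deriv_def[of i g]
      by (rule partial_deriv_eq) (use Suc.prems in \<open>auto intro!: has_derivative_add simp: frechet_derivative_works[symmetric]\<close>)
  qed
  then show ?case using Suc by auto
qed

lemma Ck_mult: "Ck k f \<Longrightarrow> Ck k g \<Longrightarrow> Ck k (\<lambda>x. f x * g x)"
proof (induction k arbitrary: f g)
  case 0
  then show ?case by (auto intro: continuous_intros)
next
  case (Suc k)
  have "partial_deriv i (\<lambda>x. f x * g x) = (\<lambda>x. f x * partial_deriv i g x + partial_deriv i f x * g x)" for i
  proof
    fix x
    show "partial_deriv i (\<lambda>x. f x * g x) x = f x * partial_deriv i g x + partial_deriv i f x * g x"
      unfolding partial_deriv_def[of i f] partial_deriv_def[of i g]
      by (rule partial_deriv_eq) (use Suc.prems in \<open>auto intro!: has_derivative_mult simp: frechet_derivative_works[symmetric]\<close>)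
  qed
  moreover have "Ck k f" "Ck k g" using Suc.prems by (auto intro: Ck_Suc_imp)
  ultimately show ?case using Suc by (auto intro!: Ck_add)
qed

lemma Ck_prod: "finite A \<Longrightarrow> (\<And>i. i \<in> A \<Longrightarrow> Ck k (f i)) \<Longrightarrow> Ck k (\<lambda>x. \<Prod>i\<in>A. f i x)"
  by (induction A rule: finite_induct) (auto intro: Ck_const Ck_mult)

lemma Ck_shift: "Ck k \<phi> \<Longrightarrow> Ck k (\<lambda>y. \<phi> (y - x))"
proof (induction k arbitrary: \<phi>)
  case 0
  then show ?case by (auto intro!: continuous_intros continuous_on_compose2[of UNIV \<phi>])
next
  case (Suc k)
  have d: "((\<lambda>y. \<phi> (y - x)) has_derivative frechet_derivative \<phi> (at (y - x))) (at y)" for y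
  proof -
    have "(\<phi> has_derivative frechet_derivative \<phi> (at (y - x))) (at (y - x))"
      using Suc.prems by (simp add: frechet_derivative_works[symmetric])
    then show ?thesis
      by (rule has_derivative_compose[where f="\<lambda>y. y - x" and f'="\<lambda>h. h", rotated])
         (auto intro!: derivative_eq_intros)
  qed
  have "partial_deriv i (\<lambda>y. \<phi> (y - x)) = (\<lambda>y. partial_deriv i \<phi> (y - x))" for i
    by (rule ext) (simp add: partial_deriv_eq[OF d], simp add: partial_deriv_def)
  moreover have "(\<lambda>y. \<phi> (y - x)) differentiable (at y)" for y using d[of y] by (auto simp: differentiable_def)
  ultimately show ?case using Suc by auto
qed

text \<open>The factor \<open>c\<close> and the polynomial \<open>p\<close> stay arbitrary, so that
  the partial derivatives belong to the same family and the induction closes.\<close>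

lemma Ck_flat_exp: "Ck k (\<lambda>x. c * flat_exp p (a + s * (x \<bullet> j)))"
proof (induction k arbitrary: c p)
  case 0
  have "continuous_on UNIV (flat_exp p)"
    using flat_exp_DERIV by (meson DERIV_isCont continuous_at_imp_continuous_on)
  then show ?case by (auto intro!: continuous_intros continuous_on_compose2[of UNIV "flat_exp p"])
next
  case (Suc k)
  define q where "q = monom 1 2 * (p - pderiv p)"
  have d: "((\<lambda>x. c * flat_exp p (a + s * (x \<bullet> j))) has_derivative
      (\<lambda>h. c * (flat_exp q (a + s * (x \<bullet> j)) * (s * (h \<bullet> j))))) (at x)" for x
  proof (rule has_derivative_mult_right)
    show "((\<lambda>x. flat_exp p (a + s * (x \<bullet> j))) has_derivative
      (\<lambda>h. flat_exp q (a + s * (x \<bullet> j)) * (s * (h \<bullet> j)))) (at x)"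
      unfolding q_def
      by (rule has_derivative_compose[where f="\<lambda>x. a + s * (x \<bullet> j)", OF _ flat_exp_DERIV[unfolded has_field_derivative_def]])
         (auto intro!: derivative_eq_intros)
  qed
  have "partial_deriv i (\<lambda>x. c * flat_exp p (a + s * (x \<bullet> j))) = (\<lambda>x. (c * (s * (i \<bullet> j))) * flat_exp q (a + s * (x \<bullet> j)))" for i
    by (rule ext) (simp add: partial_deriv_eq[OF d])
  moreover have "(\<lambda>x. c * flat_exp p (a + s * (x \<bullet> j))) differentiable (at x)" for x
    using d[of x] by (auto simp: differentiable_def)
  ultimately show ?case using Suc by auto
qed

definition grad :: "('a::euclidean_space \<Rightarrow> real) \<Rightarrow> 'a \<Rightarrow> 'a" where
  "grad \<phi> x = (\<Sum>i\<in>Basis. partial_deriv i \<phi> x *\<^sub>R i)"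

lemma grad_inner: "i \<in> Basis \<Longrightarrow> grad \<phi> x \<bullet> i = partial_deriv i \<phi> x"
  by (simp add: grad_def inner_sum_left inner_Basis if_distrib sum.delta cong: if_cong)

lemma has_derivative_grad:
  assumes "\<phi> differentiable (at x)"
  shows "(\<phi> has_derivative (\<lambda>h. grad \<phi> x \<bullet> h)) (at x)"
proof -
  have d: "(\<phi> has_derivative frechet_derivative \<phi> (at x)) (at x)"
    using assms by (simp add: frechet_derivative_works[symmetric])
  have l: "linear (frechet_derivative \<phi> (at x))" using assms by (simp add: linear_frechet_derivative)
  have "frechet_derivative \<phi> (at x) h = grad \<phi> x \<bullet> h" for h
  proof -
    have "frechet_derivative \<phi> (at x) h = frechet_derivative \<phi> (at x) (\<Sum>i\<in>Basis. (h \<bullet> i) *\<^sub>R i)"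
      by (simp add: euclidean_representation)
    also have "\<dots> = (\<Sum>i\<in>Basis. (h \<bullet> i) * partial_deriv i \<phi> x)"
      by (simp add: linear_sum[OF l] linear_scale[OF l] partial_deriv_def)
    also have "\<dots> = grad \<phi> x \<bullet> h"
      by (simp add: grad_def inner_sum_left inner_commute[of h] mult.commute)
    finally show ?thesis .
  qed
  then have "frechet_derivative \<phi> (at x) = (\<lambda>h. grad \<phi> x \<bullet> h)" by auto
  then show ?thesis using d by simp
qed

lemma test_function_Ck: "test_function \<phi> \<Longrightarrow> Ck k \<phi>" by (simp add: test_function_def)

lemma test_function_has_derivative:
  "test_function \<phi> \<Longrightarrow> (\<phi> has_derivative (\<lambda>h. grad \<phi> x \<bullet> h)) (at x)"
  by (rule has_derivative_grad) (use test_function_Ck[of \<phi> "Suc 0"] in simp)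

lemma test_function_continuous: "test_function \<phi> \<Longrightarrow> continuous_on A \<phi>"
  using test_function_Ck[of \<phi> 0] by (auto intro: continuous_on_subset)

lemma test_function_grad_continuous: "test_function \<phi> \<Longrightarrow> continuous_on A (grad \<phi>)"
  unfolding grad_def[abs_def]
  using test_function_Ck[of \<phi> "Suc 0"] by (auto intro!: continuous_intros intro: continuous_on_subset)

text \<open>The radius exceeds a bound of the closed support by 1. From there on the function
  vanishes in a neighbourhood of each point, which forces the gradient to vanish too.\<close>

lemma test_function_bounded_support:
  assumes "test_function \<phi>"
  obtains R where "0 < R" "\<And>x. R \<le> norm x \<Longrightarrow> \<phi> x = 0" "\<And>x. R \<le> norm x \<Longrightarrow> grad \<phi> x = 0"
proof -
  have "bounded (closure {x. \<phi> x \<noteq> 0})" using assms by (simp add: test_function_def compact_imp_bounded)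
  then obtain R where R: "\<And>x. x \<in> closure {x. \<phi> x \<noteq> 0} \<Longrightarrow> norm x \<le> R" by (auto simp: bounded_iff)
  have z: "\<phi> x = 0" if "norm x > R" for x
    using R[of x] closure_subset[of "{x. \<phi> x \<noteq> 0}"] that by force
  have "grad \<phi> x = 0" if "norm x > R" for x
  proof -
    have op: "open {x. R < norm x}" by (intro open_Collect_less continuous_intros)
    have "((\<lambda>_. 0) has_derivative (\<lambda>_. 0)) (at x)" by simp
    then have "(\<phi> has_derivative (\<lambda>_. 0)) (at x)"
      by (rule has_derivative_transform_within_open[OF _ op]) (use that z in auto)
    then have "partial_deriv i \<phi> x = 0" for i by (rule partial_deriv_eq)
    then show ?thesis by (simp add: grad_def)
  qed
  with z show ?thesis by (intro that[of "\<bar>R\<bar> + 1"]) auto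
qed

section \<open>Smooth bumps and mollifier kernels\<close>

text \<open>A product of one-dimensional bumps, supported in the cube of half-side \<open>r\<close>.
  Every factor depends on a single coordinate affinely, so smoothness follows from that of
  \<open>flat_exp\<close> without composing with the norm.\<close>

definition bump :: "real \<Rightarrow> 'a::euclidean_space \<Rightarrow> real" where
  "bump r x = (\<Prod>i\<in>Basis. flat_exp 1 (r + x \<bullet> i) * flat_exp 1 (r - x \<bullet> i))"

lemma flat_exp_1: "0 \<le> flat_exp 1 t" "flat_exp 1 t \<le> 1" "0 < t \<Longrightarrow> 0 < flat_exp 1 t" "t \<le> 0 \<Longrightarrow> flat_exp 1 t = 0"
  by (auto simp: flat_exp_def)

lemma bump_nonneg: "0 \<le> bump r x"
  unfolding bump_def by (intro prod_nonneg mult_nonneg_nonneg flat_exp_1)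

lemma bump_0: "0 < r \<Longrightarrow> 0 < bump r 0"
  unfolding bump_def by (intro prod_pos ballI mult_pos_pos flat_exp_1) auto

text \<open>If all coordinates were smaller than \<open>r\<close> in absolute value, the sum of
  their absolute values, and with it the norm, would be at most \<open>DIM('a) * r\<close>.\<close>

lemma bump_eq_0:
  assumes "norm x > real DIM('a) * r" shows "bump r (x::'a::euclidean_space) = 0"
proof -
  have "\<exists>i\<in>Basis. r \<le> \<bar>x \<bullet> i\<bar>"
  proof (rule ccontr)
    assume "\<not> (\<exists>i\<in>Basis. r \<le> \<bar>x \<bullet> i\<bar>)"
    then have "(\<Sum>i\<in>Basis. \<bar>x \<bullet> i\<bar>) \<le> (\<Sum>i\<in>(Basis::'a set). r)" by (intro sum_mono) auto
    then show False using norm_le_l1[of x] assms by simp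
  qed
  then obtain i where i: "i \<in> Basis" "r \<le> \<bar>x \<bullet> i\<bar>" by blast
  then have "flat_exp 1 (r + x \<bullet> i) * flat_exp 1 (r - x \<bullet> i) = 0"
    by (cases "x \<bullet> i \<ge> 0") (auto intro!: flat_exp_1)
  then show ?thesis unfolding bump_def using i(1) by (auto simp: prod_zero_iff)
qed

lemma Ck_bump: "Ck k (bump r)"
  unfolding bump_def[abs_def]
proof (intro Ck_prod Ck_mult)
  fix i :: 'a
  show "Ck k (\<lambda>x. flat_exp 1 (r + x \<bullet> i))" using Ck_flat_exp[of k 1 1 r 1 i] by simp
  show "Ck k (\<lambda>x. flat_exp 1 (r - x \<bullet> i))" using Ck_flat_exp[of k 1 1 r "-1" i] by simp
qed simp

lemma test_function_shift:
  assumes "\<And>k. Ck k \<phi>" "\<And>x. R < norm x \<Longrightarrow> \<phi> x = 0"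
  shows "test_function (\<lambda>y. \<phi> (y - x))"
  unfolding test_function_def
proof (intro conjI allI Ck_shift assms)
  have "{y. \<phi> (y - x) \<noteq> 0} \<subseteq> cball x R"
    using assms(2) by (force simp: dist_norm not_less norm_minus_commute)
  then have "closure {y. \<phi> (y - x) \<noteq> 0} \<subseteq> cball x R" by (intro closure_minimal) auto
  then show "compact (closure {y. \<phi> (y - x) \<noteq> 0})"
    using bounded_subset[OF bounded_cball] by (simp add: compact_eq_bounded_closed)
qed

lemma bounded_if_compact_support:
  fixes h :: "'a::euclidean_space \<Rightarrow> 'b::real_normed_vector"
  assumes "continuous_on UNIV h" and z: "\<And>x. R \<le> norm x \<Longrightarrow> h x = 0"
  obtains C where "0 < C" "\<And>x. norm (h x) \<le> C"
proof -
  have "compact (h ` cball 0 R)"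
    using assms(1) by (intro compact_continuous_image) (auto intro: continuous_on_subset)
  then obtain C where C: "0 < C" "\<And>x. norm x \<le> R \<Longrightarrow> norm (h x) \<le> C"
    using compact_imp_bounded[of "h ` cball 0 R"] unfolding bounded_pos by auto
  show ?thesis
  proof (rule that[OF C(1)])
    show "norm (h x) \<le> C" for x
      using C z[of x] by (cases "norm x \<le> R") auto
  qed
qed

lemma integrable_if_compact_support:
  fixes h :: "'a::euclidean_space \<Rightarrow> 'b::{banach, second_countable_topology}"
  assumes c: "continuous_on UNIV h" and z: "\<And>x. R \<le> norm x \<Longrightarrow> h x = 0"
  shows "integrable lborel h"
proof -
  obtain C where C: "\<And>x. norm (h x) \<le> C" using bounded_if_compact_support[OF assms] by metis
  have [measurable]: "h \<in> borel_measurable borel" using c by (rule borel_measurable_continuous_onI)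
  have "integrable lborel (\<lambda>x::'a. indicat_real (cball 0 R) x * C)"
    using emeasure_lborel_cball_finite[of "0::'a" R] by (intro integrable_mult_left integrable_real_indicator) auto
  then show ?thesis
  proof (rule Bochner_Integration.integrable_bound)
    show "AE x in lborel. norm (h x) \<le> norm (indicat_real (cball 0 R) x * C)"
      using C z by (intro AE_I2) (force split: split_indicator intro: order_trans[OF C abs_ge_self])
  qed measurable
qed

text \<open>Dividing the half-side by the dimension puts the supporting cube inside the ball of
  radius \<open>1 / Suc n\<close>, so the kernel never reaches beyond distance 1.\<close>

definition mol :: "nat \<Rightarrow> 'a::euclidean_space \<Rightarrow> real" where
  "mol n x = bump (1 / (real DIM('a) * Suc n)) x / (LINT y|lborel. bump (1 / (real DIM('a) * Suc n)) (y::'a))"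

lemma bump_continuous: "continuous_on UNIV (bump r)" using Ck_bump[of 0 r] by simp

lemma bump_measurable [measurable]: "bump r \<in> borel_measurable borel"
  using bump_continuous by (rule borel_measurable_continuous_onI)

lemma bump_integrable: "integrable lborel (bump r :: 'a::euclidean_space \<Rightarrow> real)"
  by (rule integrable_if_compact_support[OF bump_continuous, of "real DIM('a) * r + 1"]) (auto intro!: bump_eq_0)

lemma bump_integral_pos:
  assumes "0 < r" shows "0 < (LINT x|lborel. bump r (x::'a::euclidean_space))"
proof -
  have "isCont (bump r) (0::'a)" using bump_continuous[of r, where 'a='a] by (simp add: continuous_on_eq_continuous_at)
  then have "\<forall>\<^sub>F x in at (0::'a). bump r x > bump r (0::'a) / 2"
    using bump_0[OF assms, where 'a='a] by (intro order_tendstoD(1)[of _ "bump r 0"]) (auto simp: isCont_def)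
  then obtain d where d: "d > 0" "\<And>x::'a. x \<noteq> 0 \<Longrightarrow> dist x 0 < d \<Longrightarrow> bump r x > bump r (0::'a) / 2"
    by (auto simp: eventually_at)
  have b: "bump r (0::'a) / 2 \<le> bump r x" if "x \<in> ball 0 d" for x :: 'a
    using d(2)[of x] that bump_0[OF assms, where 'a='a] by (cases "x = 0") (auto simp: dist_commute)
  have "0 < bump r (0::'a) / 2 * measure lborel (ball (0::'a) d)"
    using bump_0[OF assms, where 'a='a] d(1) by (simp add: content_ball_pos)
  also have "\<dots> = (LINT x|lborel. indicat_real (ball (0::'a) d) x * (bump r (0::'a) / 2))" by simp
  also have "\<dots> \<le> (LINT x|lborel. bump r (x::'a))"
    using emeasure_lborel_ball_finite[of "0::'a" d] b bump_nonneg bump_integrable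
    by (intro integral_mono integrable_mult_left integrable_real_indicator) (auto split: split_indicator)
  finally show ?thesis .
qed

lemma mol_radius_pos: "0 < 1 / (real DIM('a::euclidean_space) * real (Suc n))" by simp

lemma mol_nonneg [simp]: "0 \<le> mol n x"
  unfolding mol_def by (intro divide_nonneg_nonneg bump_nonneg Bochner_Integration.integral_nonneg)

lemma Ck_mol: "Ck k (mol n :: 'a::euclidean_space \<Rightarrow> real)"
  unfolding mol_def[abs_def] divide_inverse by (intro Ck_mult Ck_bump Ck_const)

lemma mol_continuous: "continuous_on UNIV (mol n)" using Ck_mol[of 0 n] by simp

lemma mol_measurable [measurable]: "mol n \<in> borel_measurable borel"
  using mol_continuous by (rule borel_measurable_continuous_onI)

lemma mol_integrable: "integrable lborel (mol n)"
  unfolding mol_def[abs_def] by (intro integrable_divide bump_integrable)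

lemma mol_integral: "(LINT x|lborel. mol n (x::'a::euclidean_space)) = 1"
  unfolding mol_def using bump_integral_pos[of "1 / (real DIM('a) * Suc n)", where 'a='a] mol_radius_pos[of n, where 'a='a] by simp

lemma mol_eq_0: "1 / real (Suc n) < norm x \<Longrightarrow> mol n (x::'a::euclidean_space) = 0"
  unfolding mol_def by (subst bump_eq_0) auto

lemma mol_eq_0': "1 < norm x \<Longrightarrow> mol n x = 0"
  by (rule mol_eq_0) (rule order.strict_trans1[of _ 1], auto)

lemma test_function_mol: "test_function (\<lambda>y. mol n (y - x))"
  by (rule test_function_shift[OF Ck_mol mol_eq_0']) 

lemma mol_nn_integral: "(\<integral>\<^sup>+x. ennreal (mol n x) \<partial>(lborel :: 'a::euclidean_space measure)) = 1"
  using nn_integral_eq_integral[OF mol_integrable[of n, where 'a='a]] by (simp add: mol_integral)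

section \<open>Continuity of translations in L1\<close>

definition osc1 :: "('a::euclidean_space \<Rightarrow> real) \<Rightarrow> 'a \<Rightarrow> real" where
  "osc1 f h = (LINT x|lborel. \<bar>f (x + h) - f x\<bar>)"

text \<open>The error of replacing \<open>f\<close> by \<open>g\<close> is paid at \<open>x\<close>
  and at \<open>x + h\<close>; both integrals agree by translation invariance, whence the factor
  2.\<close>

lemma osc1_perturb:
  fixes f g :: "'a::euclidean_space \<Rightarrow> real"
  assumes f: "integrable lborel f" and g: "integrable lborel g"
  shows "osc1 f h \<le> osc1 g h + 2 * (LINT x|lborel. \<bar>f x - g x\<bar>)"
proof -
  have [measurable]: "f \<in> borel_measurable borel" "g \<in> borel_measurable borel"
    using borel_measurable_integrable[OF f] borel_measurable_integrable[OF g] by simp_all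
  have sh: "integrable lborel (\<lambda>x. f (x + h))" "integrable lborel (\<lambda>x. g (x + h))"
    using f g by (simp_all add: integrable_lborel_shift)
  have "osc1 f h \<le> (LINT x|lborel. \<bar>g (x + h) - g x\<bar> + (\<bar>f (x + h) - g (x + h)\<bar> + \<bar>f x - g x\<bar>))"
    unfolding osc1_def using f g sh by (intro integral_mono) auto
  also have "\<dots> = osc1 g h + ((LINT x|lborel. \<bar>f (x + h) - g (x + h)\<bar>) + (LINT x|lborel. \<bar>f x - g x\<bar>))"
    unfolding osc1_def using f g sh by simp
  also have "(LINT x|lborel. \<bar>f (x + h) - g (x + h)\<bar>) = (LINT x|lborel. \<bar>f x - g x\<bar>)"
    by (rule integral_lborel_shift[of "\<lambda>x. \<bar>f x - g x\<bar>"]) measurable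
  finally show ?thesis by simp
qed

text \<open>Regularity of Lebesgue measure supplies a closed subset, and intersecting it with large
  balls makes it compact; each step may lose \<open>e / 2\<close>.\<close>

lemma compact_inner_approximation:
  fixes A :: "'a::euclidean_space set"
  assumes [measurable]: "A \<in> sets borel" and fin: "emeasure lborel A < \<infinity>" and e: "0 < e"
  obtains T where "compact T" "T \<subseteq> A" "measure lborel A - e < measure lborel T"
proof -
  obtain C where C: "closed C" "C \<subseteq> A" "emeasure lebesgue (A - C) < ennreal (e / 2)"
    by (rule sets_lebesgue_inner_closed[of A "e / 2"]) (use e in auto)
  have [measurable]: "C \<in> sets borel" using C by simp
  have finC: "emeasure lborel C < \<infinity>" using emeasure_mono[of C A lborel] C fin by (auto intro: order.strict_trans1)
  have mC: "measure lborel (A - C) < e / 2"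
  proof -
    have "emeasure lborel (A - C) < ennreal (e / 2)" using C(3) by simp
    moreover have "emeasure lborel (A - C) = ennreal (measure lborel (A - C))"
      using emeasure_mono[of "A - C" A lborel] fin by (intro emeasure_eq_ennreal_measure) (auto simp: top_unique)
    ultimately show ?thesis using e by (simp add: ennreal_less_iff)
  qed
  have "measure lborel (A - C) = measure lborel A - measure lborel C"
    using fin C by (intro measure_Diff) auto
  with mC have 1: "measure lborel A - e / 2 < measure lborel C" by simp
  have "(\<lambda>n. measure lborel (C \<inter> cball 0 (real n))) \<longlonglongrightarrow> measure lborel (\<Union>n. C \<inter> cball 0 (real n))"
  proof (rule Lim_measure_incseq)
    show "incseq (\<lambda>n. C \<inter> cball 0 (real n))" by (auto simp: incseq_def)
    show "emeasure lborel (\<Union>n. C \<inter> cball 0 (real n)) \<noteq> \<infinity>"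
      using emeasure_mono[of "\<Union>n. C \<inter> cball 0 (real n)" C lborel] finC by (auto simp: top_unique)
  qed auto
  also have "(\<Union>n. C \<inter> cball 0 (real n)) = C" using real_arch_simple by auto
  finally have "\<forall>\<^sub>F n in sequentially. measure lborel C - e / 2 < measure lborel (C \<inter> cball 0 (real n))"
    using e by (intro order_tendstoD) auto
  then obtain n where n: "measure lborel C - e / 2 < measure lborel (C \<inter> cball 0 (real n))"
    by (auto simp: eventually_sequentially)
  show ?thesis
    by (rule that[of "C \<inter> cball 0 (real n)"]) (use C n 1 in \<open>auto intro: closed_Int_compact\<close>)
qed

text \<open>An open \<open>U\<close> around \<open>T\<close> with little extra measure contains a
  uniform neighbourhood of the compact set, hence both \<open>T\<close> and its small translates.
  Their symmetric difference has at most twice the measure of \<open>U - T\<close>.\<close>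

lemma osc1_indicator:
  fixes T :: "'a::euclidean_space set"
  assumes T: "compact T" and e: "0 < e"
  obtains d where "0 < d" "\<And>h. norm h < d \<Longrightarrow> osc1 (indicator T) h \<le> e"
proof -
  have [measurable]: "T \<in> sets borel" using T by (simp add: compact_imp_closed)
  have finT: "emeasure lborel T < \<infinity>" using T emeasure_bounded_finite compact_imp_bounded by auto
  obtain U where U: "open U" "T \<subseteq> U" "emeasure lebesgue (U - T) < ennreal (e / 2)"
    by (rule sets_lebesgue_outer_open[of T "e / 2"]) (use e in auto)
  have [measurable]: "U \<in> sets borel" using U by simp
  have UT: "emeasure lborel (U - T) < ennreal (e / 2)" using U(3) by simp
  then have finUT: "emeasure lborel (U - T) < \<infinity>" by (auto intro: order.strict_trans)
  have "U = T \<union> (U - T)" using U by auto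
  then have finU: "emeasure lborel U < \<infinity>"
    using emeasure_subadditive[of T lborel "U - T"] finT finUT by (auto simp: ennreal_add_less_top intro: order.strict_trans1)
  have "measure lborel (U - T) \<le> e / 2"
  proof -
    have "emeasure lborel (U - T) = ennreal (measure lborel (U - T))"
      using finUT by (intro emeasure_eq_ennreal_measure) auto
    then show ?thesis using UT e by (simp add: ennreal_less_iff)
  qed
  moreover have "measure lborel (U - T) = measure lborel U - measure lborel T"
    using finU U by (intro measure_Diff) auto
  ultimately have m: "measure lborel U - measure lborel T \<le> e / 2" by simp
  obtain d where d: "0 < d" "(\<Union>x\<in>T. ball x d) \<subseteq> U"
    using compact_subset_open_imp_ball_epsilon_subset[OF T U(1,2)] by metis
  show ?thesis
  proof (rule that[OF d(1)])
    fix h :: 'a assume h: "norm h < d"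
    have iT: "integrable lborel (indicat_real T)" and iU: "integrable lborel (indicat_real U)"
      using finT finU by (auto intro: integrable_real_indicator)
    have iTh: "integrable lborel (\<lambda>x. indicat_real T (x + h))"
      using iT by (simp add: integrable_lborel_shift)
    have sub: "x \<in> U" if "x + h \<in> T" for x
    proof -
      have "x \<in> ball (x + h) d" using h by (simp add: dist_norm)
      then show ?thesis using d(2) that by blast
    qed
    have pw: "\<bar>indicat_real T (x + h) - indicat_real T x\<bar> \<le>
        (indicat_real U x - indicat_real T (x + h)) + (indicat_real U x - indicat_real T x)" for x
      using sub[of x] U(2) by (auto split: split_indicator)
    have "osc1 (indicator T) h \<le> (LINT x|lborel. (indicat_real U x - indicat_real T (x + h)) + (indicat_real U x - indicat_real T x))"
      unfolding osc1_def using iT iU iTh pw by (intro integral_mono) auto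
    also have "\<dots> = (measure lborel U - measure lborel T) + (measure lborel U - measure lborel T)"
      using iT iU iTh integral_lborel_shift[of "indicat_real T" h] by simp
    also have "\<dots> \<le> e" using m by simp
    finally show "osc1 (indicator T) h \<le> e" .
  qed
qed

text \<open>Density of simple functions in the form of the induction rule for integrable functions.
  Indicators of measurable sets are first replaced by indicators of compact subsets.\<close>

lemma L1_translation_continuous:
  fixes f :: "'a::euclidean_space \<Rightarrow> real"
  assumes "integrable lborel f"
  shows "\<forall>e>0. \<exists>d>0. \<forall>h. norm h < d \<longrightarrow> osc1 f h \<le> e"
  using assms
proof (induction rule: integrable_induct)
  case (base A c)
  show ?case
  proof (intro allI impI)
    fix e :: real assume e: "0 < e"
    have A: "A \<in> sets borel" "emeasure lborel A < \<infinity>" using base by auto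
    have [measurable]: "A \<in> sets borel" by fact
    \<comment> \<open>The compact set contributes \<open>e'\<close> and the replacement
      \<open>2 * e'\<close>, so \<open>3 * e'\<close> times \<open>\<bar>c\<bar>\<close> must stay
      below \<open>e\<close>; the summand 1 admits \<open>c = 0\<close>.\<close>
    define e' where "e' = e / (4 * (\<bar>c\<bar> + 1))"
    have e': "0 < e'" using e by (simp add: e'_def)
    obtain T where T: "compact T" "T \<subseteq> A" "measure lborel A - e' < measure lborel T"
      using compact_inner_approximation[OF A e'] by metis
    have [measurable]: "T \<in> sets borel" using T by (simp add: compact_imp_closed)
    have finT: "emeasure lborel T < \<infinity>" using T(1) emeasure_bounded_finite compact_imp_bounded by auto
    obtain d where d: "0 < d" "\<And>h. norm h < d \<Longrightarrow> osc1 (indicator T) h \<le> e'"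
      using osc1_indicator[OF T(1) e'] by metis
    have iA: "integrable lborel (indicat_real A)" and iT: "integrable lborel (indicat_real T)"
      using A finT by (auto intro: integrable_real_indicator)
    show "\<exists>d>0. \<forall>h. norm h < d \<longrightarrow> osc1 (\<lambda>x. indicat_real A x *\<^sub>R c) h \<le> e"
    proof (intro exI[of _ d] conjI d(1) allI impI)
      fix h :: 'a assume h: "norm h < d"
      have "(LINT x|lborel. \<bar>indicat_real A x - indicat_real T x\<bar>) = (LINT x|lborel. indicat_real A x - indicat_real T x)"
        using T(2) by (intro Bochner_Integration.integral_cong) (auto split: split_indicator)
      also have "\<dots> \<le> e'" using iA iT T(3) by simp
      finally have "osc1 (indicator A) h \<le> 3 * e'"
        using osc1_perturb[OF iA iT, of h] d(2)[OF h] by simp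
      moreover have "osc1 (\<lambda>x. indicat_real A x *\<^sub>R c) h = \<bar>c\<bar> * osc1 (indicator A) h"
      proof -
        have "\<bar>u * c - v * c\<bar> = \<bar>c\<bar> * \<bar>u - v\<bar>" for u v :: real
          by (metis abs_mult left_diff_distrib mult.commute)
        then show ?thesis by (simp add: osc1_def)
      qed
      ultimately have "osc1 (\<lambda>x. indicat_real A x *\<^sub>R c) h \<le> \<bar>c\<bar> * (3 * e')"
        by (simp add: mult_left_mono)
      also have "\<dots> \<le> (\<bar>c\<bar> + 1) * (4 * e')" using e' by (intro mult_mono) auto
      also have "\<dots> = e" by (simp add: e'_def field_simps)
      finally show "osc1 (\<lambda>x. indicat_real A x *\<^sub>R c) h \<le> e" .
    qed
  qed
next
  case (add f g)
  show ?case
  proof (intro allI impI)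
    fix e :: real assume "0 < e"
    then have e2: "0 < e / 2" by simp
    obtain d1 where d1: "0 < d1" "\<And>h. norm h < d1 \<Longrightarrow> osc1 f h \<le> e / 2" using add.IH(1) e2 by blast
    obtain d2 where d2: "0 < d2" "\<And>h. norm h < d2 \<Longrightarrow> osc1 g h \<le> e / 2" using add.IH(2) e2 by blast
    have [measurable]: "f \<in> borel_measurable borel" "g \<in> borel_measurable borel"
      using borel_measurable_integrable[OF add.hyps(1)] borel_measurable_integrable[OF add.hyps(2)] by simp_all
    have i: "integrable lborel (\<lambda>x. f (x + h))" "integrable lborel (\<lambda>x. g (x + h))" for h
      using add.hyps by (simp_all add: integrable_lborel_shift)
    have "osc1 (\<lambda>x. f x + g x) h \<le> osc1 f h + osc1 g h" for h
    proof -
      have "osc1 (\<lambda>x. f x + g x) h \<le> (LINT x|lborel. \<bar>f (x + h) - f x\<bar> + \<bar>g (x + h) - g x\<bar>)"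
        unfolding osc1_def using add.hyps i[of h] by (intro integral_mono) auto
      also have "\<dots> = osc1 f h + osc1 g h" unfolding osc1_def using add.hyps i[of h] by simp
      finally show ?thesis .
    qed
    then have "osc1 (\<lambda>x. f x + g x) h \<le> e" if "norm h < min d1 d2" for h
      using d1(2)[of h] d2(2)[of h] that by (auto intro: order_trans[of _ "osc1 f h + osc1 g h"])
    then show "\<exists>d>0. \<forall>h. norm h < d \<longrightarrow> osc1 (\<lambda>x. f x + g x) h \<le> e"
      using d1(1) d2(1) by (intro exI[of _ "min d1 d2"]) auto
  qed
next
  case (lim f s)
  show ?case
  proof (intro allI impI)
    fix e :: real assume e: "0 < e"
    \<comment> \<open>The approximants are bounded by \<open>2 * norm (f x)\<close>, so
      \<open>3 * norm (f x)\<close> is a majorant of the difference.\<close>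
    have "(\<lambda>i. LINT x|lborel. \<bar>f x - s i x\<bar>) \<longlonglongrightarrow> (LINT x|(lborel :: 'a measure). 0)"
    proof (rule integral_dominated_convergence[where w="\<lambda>x. 3 * norm (f x)"])
      show "AE x in lborel. (\<lambda>i. \<bar>f x - s i x\<bar>) \<longlonglongrightarrow> 0"
      proof (rule AE_I2)
        fix x :: 'a
        have "(\<lambda>i. \<bar>f x - s i x\<bar>) \<longlonglongrightarrow> \<bar>f x - f x\<bar>" by (intro tendsto_intros lim.hyps(2)) simp
        then show "(\<lambda>i. \<bar>f x - s i x\<bar>) \<longlonglongrightarrow> 0" by simp
      qed
      have "norm \<bar>f x - s i x\<bar> \<le> 3 * norm (f x)" for i x
        using lim.hyps(3)[of x i] norm_triangle_ineq4[of "f x" "s i x"] by simp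
      then show "AE x in lborel. norm \<bar>f x - s i x\<bar> \<le> 3 * norm (f x)" for i by simp
    qed (use lim.hyps(1,4) in auto)
    then have "\<forall>\<^sub>F i in sequentially. (LINT x|lborel. \<bar>f x - s i x\<bar>) < e / 4"
      using e by (intro order_tendstoD(2)) auto
    then obtain i where i: "(LINT x|lborel. \<bar>f x - s i x\<bar>) < e / 4" by (auto simp: eventually_sequentially)
    obtain d where d: "0 < d" "\<And>h. norm h < d \<Longrightarrow> osc1 (s i) h \<le> e / 2"
      using lim.IH[of i] half_gt_zero[OF e] by blast
    have "osc1 f h \<le> e" if "norm h < d" for h
      using osc1_perturb[OF lim.hyps(4) lim.hyps(1)[of i], of h] d(2)[OF that] i by simp
    then show "\<exists>d>0. \<forall>h. norm h < d \<longrightarrow> osc1 f h \<le> e" using d(1) by blast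
  qed
qed

lemma osc1_mol:
  fixes f :: "'a::euclidean_space \<Rightarrow> real"
  assumes "integrable lborel f" "0 < e"
  shows "\<forall>\<^sub>F n in sequentially. \<forall>h. norm h \<le> 1 / real (Suc n) \<longrightarrow> osc1 f h \<le> e"
proof -
  obtain d where d: "0 < d" "\<And>h. norm h < d \<Longrightarrow> osc1 f h \<le> e"
    using L1_translation_continuous[OF assms(1)] assms(2) by blast
  have "(\<lambda>n. 1 / real (Suc n)) \<longlonglongrightarrow> 0" by (rule LIMSEQ_inverse_real_of_nat[unfolded inverse_eq_divide])
  then have "\<forall>\<^sub>F n in sequentially. 1 / real (Suc n) < d" using d(1) by (rule order_tendstoD)
  then show ?thesis by eventually_elim (use d(2) in auto)
qed

section \<open>Mollification and its convergence\<close>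

text \<open>For fixed \<open>x\<close> the kernel \<open>mol n (y - x)\<close> is a test function of
  \<open>y\<close>, so it can be inserted directly into the definition of a weak gradient.\<close>

definition mollify :: "nat \<Rightarrow> ('a::euclidean_space \<Rightarrow> real) \<Rightarrow> 'a \<Rightarrow> real" where
  "mollify n u x = (LINT y|lborel. mol n (y - x) * u y)"

lemma mol_bounded: "\<exists>C>0. \<forall>x::'a::euclidean_space. mol n x \<le> C"
proof -
  have z: "mol n x = 0" if "2 \<le> norm x" for x :: 'a using that by (intro mol_eq_0') auto
  obtain C where "0 < C" "\<And>x::'a. norm (mol n x) \<le> C"
    using bounded_if_compact_support[OF mol_continuous z] by blast
  then show ?thesis by (intro exI[of _ C]) auto
qed

lemma mollify_integrable:
  fixes u :: "'a::euclidean_space \<Rightarrow> real"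
  assumes "locally_integrable u"
  shows "integrable lborel (\<lambda>y. mol n (y - x) * u y)"
proof -
  have [measurable]: "u \<in> borel_measurable borel" using assms by (simp add: locally_integrable_def)
  obtain C where C: "0 < C" "\<And>x::'a. mol n x \<le> C" using mol_bounded[of n, where 'a='a] by blast
  have "set_integrable lborel (cball x 1) u" using assms by (simp add: locally_integrable_def)
  then have "integrable lborel (\<lambda>y. C * (indicator (cball x 1) y *\<^sub>R u y))"
    unfolding set_integrable_def by (rule integrable_mult_right)
  then show ?thesis
  proof (rule Bochner_Integration.integrable_bound)
    show "AE y in lborel. norm (mol n (y - x) * u y) \<le> norm (C * (indicator (cball x 1) y *\<^sub>R u y))"
    proof (rule AE_I2)
      fix y
      show "norm (mol n (y - x) * u y) \<le> norm (C * (indicator (cball x 1) y *\<^sub>R u y))"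
      proof (cases "y \<in> cball x 1")
        case True
        then show ?thesis using C mult_right_mono[OF C(2)[of "y - x"], of "\<bar>u y\<bar>"] by (simp add: abs_mult)
      next
        case False
        then have "mol n (y - x) = 0" by (intro mol_eq_0') (simp add: dist_norm norm_minus_commute)
        then show ?thesis by simp
      qed
    qed
  qed measurable
qed

lemma locally_integrable_if_integrable:
  "integrable lborel u \<Longrightarrow> locally_integrable u"
  unfolding locally_integrable_def set_integrable_def
  by (auto intro!: integrable_mult_indicator borel_closed compact_imp_closed dest: borel_measurable_integrable)

text \<open>As the kernel has mass 1, the mollification error is the mean of the increments of
  \<open>u\<close>; translation continuity therefore controls it.\<close>

lemma mollify_shift_eq:
  fixes u :: "'a::euclidean_space \<Rightarrow> real"
  assumes "integrable lborel u"
  shows "integrable lborel (\<lambda>w. mol n w * (u (x + w) - u x))"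
    and "mollify n u x - u x = (LINT w|lborel. mol n w * (u (x + w) - u x))"
proof -
  have [measurable]: "u \<in> borel_measurable borel" using borel_measurable_integrable[OF assms] by simp
  have "integrable lborel (\<lambda>y. mol n (y - x) * u y)"
    by (rule mollify_integrable[OF locally_integrable_if_integrable[OF assms]])
  then have i: "integrable lborel (\<lambda>w. mol n w * u (x + w))"
    by (subst (asm) integrable_lborel_shift[symmetric, where a=x]) (auto simp: add.commute)
  then show "integrable lborel (\<lambda>w. mol n w * (u (x + w) - u x))"
    using mol_integrable[of n, where 'a='a] by (simp add: right_diff_distrib)
  have "mollify n u x = (LINT w|lborel. mol n w * u (x + w))"
    unfolding mollify_def by (subst integral_lborel_shift[symmetric, where a=x]) (auto simp: add.commute)
  then show "mollify n u x - u x = (LINT w|lborel. mol n w * (u (x + w) - u x))"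
    using i mol_integrable[of n, where 'a='a] mol_integral[of n, where 'a='a] by (simp add: right_diff_distrib)
qed

text \<open>Jensen's inequality for the kernel enters only through the assumption \<open>jensen\<close>, so that the
  first and second powers are treated at once.\<close>

lemma mollify_power_le:
  fixes u :: "'a::euclidean_space \<Rightarrow> real" and q :: "real \<Rightarrow> ennreal"
  assumes u: "integrable lborel u" and [measurable]: "q \<in> borel_measurable borel"
    and jensen: "\<And>a. integrable lborel (\<lambda>w::'a. mol n w * a w) \<Longrightarrow> a \<in> borel_measurable borel \<Longrightarrow>
        q (LINT w|lborel. mol n w * a w) \<le> (\<integral>\<^sup>+w. ennreal (mol n w) * q (a w) \<partial>lborel)"
    and osc: "\<And>w. norm w \<le> 1 / real (Suc n) \<Longrightarrow> (\<integral>\<^sup>+x. q (u (x + w) - u x) \<partial>lborel) \<le> e"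
  shows "(\<integral>\<^sup>+x. q (mollify n u x - u x) \<partial>lborel) \<le> e"
proof -
  have [measurable]: "u \<in> borel_measurable borel" using borel_measurable_integrable[OF u] by simp
  have "(\<integral>\<^sup>+x. q (mollify n u x - u x) \<partial>lborel) \<le>
      (\<integral>\<^sup>+x. (\<integral>\<^sup>+w. ennreal (mol n w) * q (u (x + w) - u x) \<partial>lborel) \<partial>lborel)"
    unfolding mollify_shift_eq(2)[OF u]
    by (intro nn_integral_mono jensen mollify_shift_eq(1)[OF u]) measurable
  also have "\<dots> = (\<integral>\<^sup>+w. (\<integral>\<^sup>+x. ennreal (mol n w) * q (u (x + w) - u x) \<partial>lborel) \<partial>lborel)"
    by (rule lborel_pair.Fubini') measurable
  also have "\<dots> = (\<integral>\<^sup>+w. ennreal (mol n w) * (\<integral>\<^sup>+x. q (u (x + w) - u x) \<partial>lborel) \<partial>lborel)"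
    by (simp add: nn_integral_cmult)
  also have "\<dots> \<le> (\<integral>\<^sup>+w. ennreal (mol n w) * e \<partial>(lborel :: 'a measure))"
  proof (rule nn_integral_mono)
    fix w :: 'a
    show "ennreal (mol n w) * (\<integral>\<^sup>+x. q (u (x + w) - u x) \<partial>lborel) \<le> ennreal (mol n w) * e"
      using mol_eq_0[of n w] osc[of w] by (cases "norm w \<le> 1 / real (Suc n)") (auto intro: mult_left_mono)
  qed
  also have "\<dots> = e" by (simp add: nn_integral_multc mol_nn_integral)
  finally show ?thesis .
qed

lemma mol_jensen_abs:
  assumes "integrable lborel (\<lambda>w::'a::euclidean_space. mol n w * a w)" "a \<in> borel_measurable borel"
  shows "ennreal \<bar>LINT w|lborel. mol n w * a w\<bar> \<le> (\<integral>\<^sup>+w. ennreal (mol n w) * ennreal \<bar>a w\<bar> \<partial>lborel)"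
proof -
  have "ennreal \<bar>LINT w|lborel. mol n w * a w\<bar> \<le> (\<integral>\<^sup>+w. ennreal (norm (mol n w * a w)) \<partial>lborel)"
    using integral_norm_bound_ennreal[OF assms(1)] by simp
  then show ?thesis by (simp add: abs_mult ennreal_mult)
qed

text \<open>Writing the kernel as a product of two square roots, Cauchy-Schwarz yields the mass of
  the kernel, which is 1, times the weighted integral of the square.\<close>

lemma mol_jensen_square:
  assumes i: "integrable lborel (\<lambda>w::'a::euclidean_space. mol n w * a w)" and [measurable]: "a \<in> borel_measurable borel"
  shows "ennreal ((LINT w|lborel. mol n w * a w)\<^sup>2) \<le> (\<integral>\<^sup>+w. ennreal (mol n w) * ennreal ((a w)\<^sup>2) \<partial>lborel)"
proof -
  have "ennreal ((LINT w|lborel. mol n w * a w)\<^sup>2) = (ennreal \<bar>LINT w|lborel. mol n w * a w\<bar>)\<^sup>2"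
    by (simp add: ennreal_power)
  also have "\<dots> \<le> (\<integral>\<^sup>+w. ennreal (mol n w) * ennreal \<bar>a w\<bar> \<partial>lborel)\<^sup>2"
    by (intro power_mono mol_jensen_abs[OF i]) auto
  also have "(\<integral>\<^sup>+w. ennreal (mol n w) * ennreal \<bar>a w\<bar> \<partial>lborel) =
      (\<integral>\<^sup>+w. ennreal (sqrt (mol n w)) * ennreal (sqrt (mol n w) * \<bar>a w\<bar>) \<partial>lborel)"
    by (simp add: ennreal_mult[symmetric] mult.assoc[symmetric])
  also have "\<dots>\<^sup>2 \<le> (\<integral>\<^sup>+w. (ennreal (sqrt (mol n w)))\<^sup>2 \<partial>(lborel :: 'a measure)) * (\<integral>\<^sup>+w. (ennreal (sqrt (mol n w) * \<bar>a w\<bar>))\<^sup>2 \<partial>lborel)"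
    by (rule Cauchy_Schwarz_nn_integral) measurable
  also have "\<dots> = (\<integral>\<^sup>+w. ennreal (mol n w) * ennreal ((a w)\<^sup>2) \<partial>lborel)"
    by (simp add: ennreal_power power_mult_distrib mol_nn_integral ennreal_mult)
  finally show ?thesis .
qed

text \<open>For nonnegative numbers \<open>\<bar>a - b\<bar>\<close> is at most
  \<open>a + b\<close>. In this way L2 increments of a nonnegative function are controlled by L1
  increments of its square.\<close>

lemma square_diff_le_diff_squares:
  fixes a b :: real assumes "0 \<le> a" "0 \<le> b" shows "(a - b)\<^sup>2 \<le> \<bar>a\<^sup>2 - b\<^sup>2\<bar>"
proof -
  have "(a - b)\<^sup>2 = \<bar>a - b\<bar> * \<bar>a - b\<bar>" by (simp add: power2_eq_square abs_mult[symmetric])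
  also have "\<dots> \<le> \<bar>a - b\<bar> * (a + b)" using assms by (intro mult_left_mono) auto
  also have "\<dots> = \<bar>(a - b) * (a + b)\<bar>" using assms by (simp add: abs_mult)
  also have "(a - b) * (a + b) = a\<^sup>2 - b\<^sup>2" by (simp add: power2_eq_square algebra_simps)
  finally show ?thesis .
qed

section \<open>Mollification of weak gradients\<close>

lemma tendsto_0_ennrealI:
  fixes f :: "nat \<Rightarrow> ennreal"
  assumes "\<And>e::real. 0 < e \<Longrightarrow> \<forall>\<^sub>F n in sequentially. f n \<le> ennreal e"
  shows "f \<longlonglongrightarrow> 0"
proof (rule order_tendstoI)
  fix a :: ennreal assume a: "0 < a"
  have "\<exists>e>0. ennreal e < a"
  proof (cases a)
    case (real r)
    then show ?thesis using a by (intro exI[of _ "r / 2"]) (auto simp: ennreal_less_iff)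
  qed (auto intro: exI[of _ 1])
  then obtain e where e: "0 < e" "ennreal e < a" by blast
  show "\<forall>\<^sub>F n in sequentially. f n < a"
    using assms[OF e(1)] by eventually_elim (use e(2) in \<open>auto intro: order.strict_trans1\<close>)
qed auto

lemma mollify_L1_tendsto:
  assumes u: "integrable lborel u"
  shows "(\<lambda>n. \<integral>\<^sup>+x. ennreal \<bar>mollify n u x - u x\<bar> \<partial>lborel) \<longlonglongrightarrow> 0"
proof (rule tendsto_0_ennrealI)
  fix e :: real assume e: "0 < e"
  have i: "integrable lborel (\<lambda>x. u (x + w) - u x)" for w
    using u borel_measurable_integrable[OF u] by (simp add: integrable_lborel_shift)
  show "\<forall>\<^sub>F n in sequentially. (\<integral>\<^sup>+x. ennreal \<bar>mollify n u x - u x\<bar> \<partial>lborel) \<le> ennreal e"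
    using osc1_mol[OF u e]
  proof eventually_elim
    case (elim n)
    show ?case
    proof (rule mollify_power_le[OF u, where q="\<lambda>t. ennreal \<bar>t\<bar>"])
      fix w :: 'a assume "norm w \<le> 1 / real (Suc n)"
      then have "osc1 u w \<le> e" using elim by blast
      moreover have "(\<integral>\<^sup>+x. ennreal \<bar>u (x + w) - u x\<bar> \<partial>lborel) = ennreal (osc1 u w)"
        unfolding osc1_def using i[of w] by (intro nn_integral_eq_integral) auto
      ultimately show "(\<integral>\<^sup>+x. ennreal \<bar>u (x + w) - u x\<bar> \<partial>lborel) \<le> ennreal e"
        using e by simp
    qed (use mol_jensen_abs in auto)
  qed
qed

text \<open>Translation continuity in L2 is deduced from that in L1, applied to the squares
  \<open>p\<close> and \<open>m\<close> of the positive and negative parts. Each oscillation counts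
  twice, so \<open>e / 4\<close> for each adds up to \<open>e\<close>.\<close>

lemma mollify_L2_tendsto:
  assumes u: "integrable lborel u" and u2: "integrable lborel (\<lambda>x. (u x)\<^sup>2)"
  shows "(\<lambda>n. \<integral>\<^sup>+x. ennreal ((mollify n u x - u x)\<^sup>2) \<partial>lborel) \<longlonglongrightarrow> 0"
proof (rule tendsto_0_ennrealI)
  fix e :: real assume e: "0 < e"
  have [measurable]: "u \<in> borel_measurable borel" using borel_measurable_integrable[OF u] by simp
  define p where "p x = (max (u x) 0)\<^sup>2" for x
  define m where "m x = (max (- u x) 0)\<^sup>2" for x
  have [measurable]: "p \<in> borel_measurable borel" "m \<in> borel_measurable borel" unfolding p_def m_def by measurable
  have p: "integrable lborel p"
    by (rule Bochner_Integration.integrable_bound[OF u2]) (auto simp: p_def max_def)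
  have m: "integrable lborel m"
    by (rule Bochner_Integration.integrable_bound[OF u2]) (auto simp: m_def max_def)
  have e4: "0 < e / 4" using e by simp
  have pw: "(a - b)\<^sup>2 \<le> 2 * \<bar>(max a 0)\<^sup>2 - (max b 0)\<^sup>2\<bar> + 2 * \<bar>(max (- a) 0)\<^sup>2 - (max (- b) 0)\<^sup>2\<bar>" for a b :: real
  proof -
    have "a - b = (max a 0 - max b 0) - (max (- a) 0 - max (- b) 0)" by (simp add: max_def)
    then have "(a - b)\<^sup>2 = ((max a 0 - max b 0) - (max (- a) 0 - max (- b) 0))\<^sup>2" by (rule arg_cong)
    also have "\<dots> \<le> 2 * (max a 0 - max b 0)\<^sup>2 + 2 * (max (- a) 0 - max (- b) 0)\<^sup>2"
    proof -
      have "(s - t)\<^sup>2 \<le> 2 * s\<^sup>2 + 2 * t\<^sup>2" for s t :: real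
        using zero_le_power2[of "s + t"] by (simp add: power2_eq_square algebra_simps)
      then show ?thesis .
    qed
    also have "\<dots> \<le> 2 * \<bar>(max a 0)\<^sup>2 - (max b 0)\<^sup>2\<bar> + 2 * \<bar>(max (- a) 0)\<^sup>2 - (max (- b) 0)\<^sup>2\<bar>"
      by (intro add_mono mult_left_mono square_diff_le_diff_squares) auto
    finally show ?thesis .
  qed
  have i: "integrable lborel (\<lambda>x. p (x + w) - p x)" "integrable lborel (\<lambda>x. m (x + w) - m x)" for w
    using p m by (simp_all add: integrable_lborel_shift)
  show "\<forall>\<^sub>F n in sequentially. (\<integral>\<^sup>+x. ennreal ((mollify n u x - u x)\<^sup>2) \<partial>lborel) \<le> ennreal e"
    using osc1_mol[OF p e4] osc1_mol[OF m e4]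
  proof eventually_elim
    case (elim n)
    show ?case
    proof (rule mollify_power_le[OF u, where q="\<lambda>t. ennreal (t\<^sup>2)"])
      fix w :: 'a assume w: "norm w \<le> 1 / real (Suc n)"
      have "(\<integral>\<^sup>+x. ennreal ((u (x + w) - u x)\<^sup>2) \<partial>lborel) \<le>
          (\<integral>\<^sup>+x. ennreal (2 * \<bar>p (x + w) - p x\<bar> + 2 * \<bar>m (x + w) - m x\<bar>) \<partial>lborel)"
        unfolding p_def m_def by (intro nn_integral_mono ennreal_leI pw)
      also have "\<dots> = ennreal (LINT x|lborel. 2 * \<bar>p (x + w) - p x\<bar> + 2 * \<bar>m (x + w) - m x\<bar>)"
        using i[of w] by (intro nn_integral_eq_integral) auto
      also have "(LINT x|lborel. 2 * \<bar>p (x + w) - p x\<bar> + 2 * \<bar>m (x + w) - m x\<bar>) = 2 * osc1 p w + 2 * osc1 m w"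
        unfolding osc1_def using i[of w] by simp
      also have "\<dots> \<le> e"
      proof -
        have "osc1 p w \<le> e / 4" "osc1 m w \<le> e / 4" using elim w by blast+
        then show ?thesis by linarith
      qed
      finally show "(\<integral>\<^sup>+x. ennreal ((u (x + w) - u x)\<^sup>2) \<partial>lborel) \<le> ennreal e" by (simp add: ennreal_leI)
    qed (use mol_jensen_square in auto)
  qed
qed

text \<open>The kernel reaches no further than distance 1, so on the ball of radius \<open>R\<close>
  only the values of \<open>u\<close> on the ball of radius \<open>R + 1\<close> matter. This
  reduces locally integrable functions to integrable ones.\<close>

lemma mollify_localize:
  assumes "norm x \<le> R"
  shows "mollify n (\<lambda>y. indicator (cball 0 (R + 1)) y * u y) x = mollify n u (x::'a::euclidean_space)"
  unfolding mollify_def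
proof (rule Bochner_Integration.integral_cong[OF refl])
  fix y :: 'a
  show "mol n (y - x) * (indicator (cball 0 (R + 1)) y * u y) = mol n (y - x) * u y"
  proof (cases "norm (y - x) \<le> 1")
    case True
    then have "norm y \<le> R + 1" using assms norm_triangle_sub[of y x] by linarith
    then show ?thesis by simp
  next
    case False
    then show ?thesis by (simp add: mol_eq_0')
  qed
qed

lemma locally_integrable_cball:
  "locally_integrable u \<Longrightarrow> integrable lborel (\<lambda>x. indicator (cball 0 R) x *\<^sub>R u x)"
  by (simp add: locally_integrable_def set_integrable_def)

lemma locally_integrable_measurable: "locally_integrable u \<Longrightarrow> u \<in> borel_measurable borel"
  by (simp add: locally_integrable_def)

lemma nn_integral_sandwich_0:
  fixes f g :: "nat \<Rightarrow> ennreal"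
  assumes "g \<longlonglongrightarrow> 0" "\<And>n. f n \<le> g n" shows "f \<longlonglongrightarrow> 0"
  by (rule tendsto_sandwich[OF _ _ tendsto_const assms(1)]) (use assms(2) in auto)

lemma mollify_L1_local:
  fixes u :: "'a::euclidean_space \<Rightarrow> real"
  assumes u: "locally_integrable u"
  shows "(\<lambda>n. \<integral>\<^sup>+x. indicator (cball 0 R) x * ennreal \<bar>mollify n u x - u x\<bar> \<partial>lborel) \<longlonglongrightarrow> 0"
proof (rule nn_integral_sandwich_0)
  define w where "w = (\<lambda>y. indicat_real (cball 0 (R + 1)) y * u y)"
  show "(\<lambda>n. \<integral>\<^sup>+x. ennreal \<bar>mollify n w x - w x\<bar> \<partial>lborel) \<longlonglongrightarrow> 0"
    by (rule mollify_L1_tendsto) (use locally_integrable_cball[OF u, of "R + 1"] in \<open>simp add: w_def\<close>)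
  show "(\<integral>\<^sup>+x. indicator (cball 0 R) x * ennreal \<bar>mollify n u x - u x\<bar> \<partial>lborel) \<le>
     (\<integral>\<^sup>+x. ennreal \<bar>mollify n w x - w x\<bar> \<partial>lborel)" for n
    by (intro nn_integral_mono) (auto simp: w_def mollify_localize split: split_indicator)
qed

text \<open>Only the kernel depends on \<open>x\<close>; as it is taken at \<open>y - x\<close>, its
  gradient enters with a minus sign. For \<open>x\<close> in a unit ball the integrands live on a
  common ball of radius \<open>R + 1\<close>, which gives the majorant.\<close>

lemma mollify_has_derivative:
  fixes u :: "'a::euclidean_space \<Rightarrow> real"
  assumes u: "locally_integrable u"
  shows "(mollify n u has_derivative (\<lambda>h. (LINT y|lborel. - u y *\<^sub>R grad (mol n) (y - x)) \<bullet> h)) (at x)"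
proof -
  have [measurable]: "u \<in> borel_measurable borel" using u by (rule locally_integrable_measurable)
  have tf: "test_function (mol n :: 'a \<Rightarrow> real)" using test_function_mol[of n 0] by simp
  obtain R where R: "0 < R" "\<And>x::'a. R \<le> norm x \<Longrightarrow> grad (mol n) x = 0"
    using test_function_bounded_support[OF tf] by metis
  obtain C where C: "0 < C" "\<And>x::'a. norm (grad (mol n) x) \<le> C"
    using bounded_if_compact_support[OF test_function_grad_continuous[OF tf] R(2)] by metis
  have [measurable]: "(grad (mol n) :: 'a \<Rightarrow> 'a) \<in> borel_measurable borel"
    using test_function_grad_continuous[OF tf] by (rule borel_measurable_continuous_onI)
  have "((\<lambda>x. LINT y|lborel. mol n (y - x) * u y) has_derivative
      (\<lambda>h. (LINT y|lborel. - u y *\<^sub>R grad (mol n) (y - x)) \<bullet> h)) (at x)"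
  proof (rule has_derivative_integral_param[where r=1 and B="\<lambda>y. C * \<bar>indicator (cball x (R + 1)) y *\<^sub>R u y\<bar>"])
    show "integrable lborel (\<lambda>y. mol n (y - x) * u y)" for x by (rule mollify_integrable[OF u])
    show "integrable lborel (\<lambda>y. C * \<bar>indicator (cball x (R + 1)) y *\<^sub>R u y\<bar>)"
      using u by (intro integrable_mult_right integrable_abs) (simp add: locally_integrable_def set_integrable_def)
  next
    fix x' y :: 'a
    have "(mol n has_derivative (\<lambda>h. grad (mol n) (y - x') \<bullet> h)) (at (y - x'))"
      by (rule test_function_has_derivative[OF tf])
    then have "((\<lambda>x. mol n (y - x)) has_derivative (\<lambda>h. grad (mol n) (y - x') \<bullet> (- h))) (at x')"
      by (rule has_derivative_compose[where f="\<lambda>x. y - x" and f'="\<lambda>h. - h", rotated]) (auto intro!: derivative_eq_intros)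
    from has_derivative_mult_left[OF this, of "u y"]
    show "((\<lambda>x. mol n (y - x) * u y) has_derivative (\<lambda>h. (- u y *\<^sub>R grad (mol n) (y - x')) \<bullet> h)) (at x')"
      by (rule has_derivative_eq_rhs) (auto simp: mult.commute)
    assume x': "x' \<in> ball x 1"
    show "norm (- u y *\<^sub>R grad (mol n) (y - x')) \<le> C * \<bar>indicator (cball x (R + 1)) y *\<^sub>R u y\<bar>"
    proof (cases "y \<in> cball x (R + 1)")
      case True
      then show ?thesis using mult_right_mono[OF C(2)[of "y - x'"], of "\<bar>u y\<bar>"] by (simp add: mult.commute)
    next
      case False
      then have "R + 1 < norm (y - x)" by (simp add: dist_norm norm_minus_commute)
      moreover have "norm (x' - x) < 1" using x' by (simp add: dist_norm norm_minus_commute)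
      ultimately have "R \<le> norm (y - x')" using norm_triangle_ineq[of "y - x'" "x' - x"] by simp
      then show ?thesis using R(2) C(1) by simp
    qed
  qed auto
  then show ?thesis by (simp add: mollify_def[abs_def])
qed

lemma mollify_continuous:
  assumes "locally_integrable u" shows "continuous_on UNIV (mollify n u)"
  using mollify_has_derivative[OF assms] by (meson continuous_at_imp_continuous_on has_derivative_continuous)

lemma mollify_measurable:
  assumes "locally_integrable u" shows "mollify n u \<in> borel_measurable borel"
  using mollify_continuous[OF assms] by (rule borel_measurable_continuous_onI)

lemma continuous_cball_integrable:
  fixes h :: "'a::euclidean_space \<Rightarrow> real"
  assumes "continuous_on UNIV h"
  shows "integrable lborel (\<lambda>x. indicator (cball 0 R) x * h x)"
  using borel_integrable_compact[of "cball 0 R" h] assms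
  by (simp add: continuous_on_subset set_integrable_def)

lemma mollify_L2_local:
  fixes u :: "'a::euclidean_space \<Rightarrow> real"
  assumes u: "locally_integrable u" and u2: "locally_integrable (\<lambda>x. (u x)\<^sup>2)"
  shows "integrable lborel (\<lambda>x. indicator (cball 0 R) x * (mollify n u x - u x)\<^sup>2)"
    and "(\<lambda>n. LINT x|lborel. indicator (cball 0 R) x * (mollify n u x - u x)\<^sup>2) \<longlonglongrightarrow> 0"
proof -
  have [measurable]: "u \<in> borel_measurable borel" using u by (rule locally_integrable_measurable)
  have [measurable]: "mollify n u \<in> borel_measurable borel" for n using u by (rule mollify_measurable)
  have [measurable]: "cball (0::'a) R \<in> sets borel" by simp
  have i: "integrable lborel (\<lambda>x. indicator (cball 0 R) x * (mollify n u x - u x)\<^sup>2)" for n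
  proof (rule Bochner_Integration.integrable_bound)
    show "integrable lborel (\<lambda>x. 2 * (indicator (cball 0 R) x * (mollify n u x)\<^sup>2) + 2 * (indicator (cball 0 R) x *\<^sub>R (u x)\<^sup>2))"
      by (intro Bochner_Integration.integrable_add integrable_mult_right locally_integrable_cball[OF u2]
          continuous_cball_integrable continuous_intros mollify_continuous[OF u])
    have "(a - b)\<^sup>2 \<le> 2 * a\<^sup>2 + 2 * b\<^sup>2" for a b :: real
      using zero_le_power2[of "a + b"] by (simp add: power2_eq_square algebra_simps)
    then show "AE x in lborel. norm (indicator (cball 0 R) x * (mollify n u x - u x)\<^sup>2) \<le>
       norm (2 * (indicator (cball 0 R) x * (mollify n u x)\<^sup>2) + 2 * (indicator (cball 0 R) x *\<^sub>R (u x)\<^sup>2))"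
      by (intro AE_I2) (auto split: split_indicator)
  qed measurable
  show "integrable lborel (\<lambda>x. indicator (cball 0 R) x * (mollify n u x - u x)\<^sup>2)" by (rule i)
  define w where "w = (\<lambda>y. indicat_real (cball 0 (R + 1)) y * u y)"
  have w: "integrable lborel w" using locally_integrable_cball[OF u, of "R + 1"] by (simp add: w_def)
  have "(\<lambda>y. indicat_real (cball 0 (R + 1)) y *\<^sub>R (u y)\<^sup>2) = (\<lambda>x. (w x)\<^sup>2)"
    by (auto simp: w_def fun_eq_iff split: split_indicator)
  then have w2: "integrable lborel (\<lambda>x. (w x)\<^sup>2)" using locally_integrable_cball[OF u2, of "R + 1"] by simp
  have "(\<lambda>n. \<integral>\<^sup>+x. ennreal (indicator (cball 0 R) x * (mollify n u x - u x)\<^sup>2) \<partial>lborel) \<longlonglongrightarrow> 0"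
  proof (rule nn_integral_sandwich_0[OF mollify_L2_tendsto[OF w w2]])
    show "(\<integral>\<^sup>+x. ennreal (indicator (cball 0 R) x * (mollify n u x - u x)\<^sup>2) \<partial>lborel) \<le>
       (\<integral>\<^sup>+x. ennreal ((mollify n w x - w x)\<^sup>2) \<partial>lborel)" for n
      by (intro nn_integral_mono) (auto simp: w_def mollify_localize split: split_indicator)
  qed
  also have "(\<lambda>n. \<integral>\<^sup>+x. ennreal (indicator (cball 0 R) x * (mollify n u x - u x)\<^sup>2) \<partial>lborel) =
     (\<lambda>n. ennreal (LINT x|lborel. indicator (cball 0 R) x * (mollify n u x - u x)\<^sup>2))"
    using i by (intro ext nn_integral_eq_integral) auto
  finally have "(\<lambda>n. ennreal (LINT x|lborel. indicator (cball 0 R) x * (mollify n u x - u x)\<^sup>2)) \<longlonglongrightarrow> ennreal 0"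
    by simp
  then show "(\<lambda>n. LINT x|lborel. indicator (cball 0 R) x * (mollify n u x - u x)\<^sup>2) \<longlonglongrightarrow> 0"
    by (rule tendsto_ennrealD) (auto intro!: Bochner_Integration.integral_nonneg)
qed

section \<open>Weak gradients under mollification\<close>

definition mollify_vec :: "nat \<Rightarrow> ('a::euclidean_space \<Rightarrow> 'a) \<Rightarrow> 'a \<Rightarrow> 'a" where
  "mollify_vec n v x = (\<Sum>i\<in>Basis. mollify n (\<lambda>y. v y \<bullet> i) x *\<^sub>R i)"

lemma mollify_vec_inner: "i \<in> Basis \<Longrightarrow> mollify_vec n v x \<bullet> i = mollify n (\<lambda>y. v y \<bullet> i) x"
  by (simp add: mollify_vec_def inner_sum_left inner_Basis if_distrib sum.delta cong: if_cong)

lemma locally_integrable_inner: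
  fixes v :: "'a::euclidean_space \<Rightarrow> 'a"
  assumes "locally_integrable v" shows "locally_integrable (\<lambda>x. v x \<bullet> i)"
  unfolding locally_integrable_def
proof (intro conjI allI impI)
  have [measurable]: "v \<in> borel_measurable borel" using assms by (rule locally_integrable_measurable)
  show "(\<lambda>x. v x \<bullet> i) \<in> borel_measurable borel" by measurable
  fix K :: "'a set" assume "compact K"
  then have "set_integrable lborel K v" using assms by (simp add: locally_integrable_def)
  then have "integrable lborel (\<lambda>x. (indicator K x *\<^sub>R v x) \<bullet> i)"
    unfolding set_integrable_def by (rule integrable_inner_left)
  then show "set_integrable lborel K (\<lambda>x. v x \<bullet> i)" by (simp add: set_integrable_def)
qed

lemma mollify_vec_continuous:
  assumes "locally_integrable v" shows "continuous_on UNIV (mollify_vec n v)"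
  unfolding mollify_vec_def[abs_def]
  by (intro continuous_intros mollify_continuous locally_integrable_inner assms)

text \<open>The defining identity of a weak gradient, tested with the kernel centered at
  \<open>x\<close>, moves the derivative from the kernel to \<open>v\<close>; its minus sign cancels
  the one from differentiating in the center.\<close>

lemma mollify_weak_gradient:
  fixes g :: "'a::euclidean_space \<Rightarrow> real"
  assumes w: "has_weak_gradient g v"
  shows "(mollify n g has_derivative (\<lambda>h. mollify_vec n v x \<bullet> h)) (at x)"
proof -
  have g: "locally_integrable g" using w by (simp add: has_weak_gradient_def)
  have [measurable]: "g \<in> borel_measurable borel" using g by (rule locally_integrable_measurable)
  have tf: "test_function (mol n :: 'a \<Rightarrow> real)" using test_function_mol[of n 0] by simp
  have [measurable]: "(grad (mol n) :: 'a \<Rightarrow> 'a) \<in> borel_measurable borel"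
    using test_function_grad_continuous[OF tf] by (rule borel_measurable_continuous_onI)
  define Y where "Y = (LINT y|lborel. - g y *\<^sub>R grad (mol n) (y - x))"
  obtain R where R: "0 < R" "\<And>x::'a. R \<le> norm x \<Longrightarrow> grad (mol n) x = 0"
    using test_function_bounded_support[OF tf] by metis
  obtain C where C: "0 < C" "\<And>x::'a. norm (grad (mol n) x) \<le> C"
    using bounded_if_compact_support[OF test_function_grad_continuous[OF tf] R(2)] by metis
  have int: "integrable lborel (\<lambda>y. - g y *\<^sub>R grad (mol n) (y - x))"
  proof (rule Bochner_Integration.integrable_bound)
    show "integrable lborel (\<lambda>y. C * \<bar>indicator (cball x R) y *\<^sub>R g y\<bar>)"
      using g by (intro integrable_mult_right integrable_abs) (simp add: locally_integrable_def set_integrable_def)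
    show "AE y in lborel. norm (- g y *\<^sub>R grad (mol n) (y - x)) \<le> norm (C * \<bar>indicator (cball x R) y *\<^sub>R g y\<bar>)"
    proof (rule AE_I2)
      fix y
      show "norm (- g y *\<^sub>R grad (mol n) (y - x)) \<le> norm (C * \<bar>indicator (cball x R) y *\<^sub>R g y\<bar>)"
      proof (cases "y \<in> cball x R")
        case True
        then show ?thesis using C(1) mult_right_mono[OF C(2)[of "y - x"], of "\<bar>g y\<bar>"] by (simp add: mult.commute abs_mult)
      next
        case False
        then show ?thesis using R(2)[of "y - x"] by (simp add: dist_norm norm_minus_commute)
      qed
    qed
  qed measurable
  have "Y \<bullet> i = mollify_vec n v x \<bullet> i" if i: "i \<in> Basis" for i
  proof -
    have pd: "partial_deriv i (\<lambda>y. mol n (y - x)) y = grad (mol n) (y - x) \<bullet> i" for y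
    proof (rule partial_deriv_eq)
      have "(mol n has_derivative (\<lambda>h. grad (mol n) (y - x) \<bullet> h)) (at (y - x))"
        by (rule test_function_has_derivative[OF tf])
      then show "((\<lambda>y. mol n (y - x)) has_derivative (\<lambda>h. grad (mol n) (y - x) \<bullet> h)) (at y)"
        by (rule has_derivative_compose[where f="\<lambda>y. y - x" and f'="\<lambda>h. h", rotated]) (auto intro!: derivative_eq_intros)
    qed
    have "Y \<bullet> i = (LINT y|lborel. (- g y *\<^sub>R grad (mol n) (y - x)) \<bullet> i)"
      unfolding Y_def using int by (rule integral_inner_left[symmetric])
    also have "\<dots> = - (LINT y|lborel. g y * partial_deriv i (\<lambda>y. mol n (y - x)) y)"
      by (simp add: pd)
    also have "(LINT y|lborel. g y * partial_deriv i (\<lambda>y. mol n (y - x)) y) = - (LINT y|lborel. (v y \<bullet> i) * mol n (y - x))"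
      using w test_function_mol[of n x] i unfolding has_weak_gradient_def by blast
    finally show ?thesis by (simp add: mollify_vec_inner[OF i] mollify_def mult.commute)
  qed
  then have "Y = mollify_vec n v x" by (rule euclidean_eqI)
  then show ?thesis using mollify_has_derivative[OF g, of n x] by (simp add: Y_def)
qed

text \<open>Testing with the kernels shows that every mollification of a component of the difference
  vanishes, while the mollifications converge to that component in L1 on balls. This makes the
  arbitrary choice in \<open>weak_gradient\<close> computable almost everywhere.\<close>

lemma weak_gradient_unique:
  fixes f :: "'a::euclidean_space \<Rightarrow> real"
  assumes v1: "has_weak_gradient f v1" and v2: "has_weak_gradient f v2"
  shows "AE x in lborel. v1 x = v2 x"
proof -
  have l: "locally_integrable v1" "locally_integrable v2" using v1 v2 by (auto simp: has_weak_gradient_def)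
  have "AE x in lborel. v1 x \<bullet> i = v2 x \<bullet> i" if i: "i \<in> Basis" for i
  proof -
    define d where "d x = v1 x \<bullet> i - v2 x \<bullet> i" for x
    have li: "locally_integrable (\<lambda>x. v1 x \<bullet> i)" "locally_integrable (\<lambda>x. v2 x \<bullet> i)"
      using l by (auto intro: locally_integrable_inner)
    have d: "locally_integrable d"
      unfolding locally_integrable_def d_def[abs_def]
      using li by (auto simp: locally_integrable_def intro!: borel_measurable_diff)
    have [measurable]: "d \<in> borel_measurable borel" using d by (rule locally_integrable_measurable)
    have m0: "mollify n d x = 0" for n x
    proof -
      have "(LINT y|lborel. f y * partial_deriv i (\<lambda>y. mol n (y - x)) y) = - (LINT y|lborel. (v y \<bullet> i) * mol n (y - x))"
        if "has_weak_gradient f v" for v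
        using that test_function_mol[of n x] i unfolding has_weak_gradient_def by blast
      from this[OF v1] this[OF v2]
      have "(LINT y|lborel. (v1 y \<bullet> i) * mol n (y - x)) = (LINT y|lborel. (v2 y \<bullet> i) * mol n (y - x))" by simp
      then show ?thesis
        using mollify_integrable[OF li(1), of n x] mollify_integrable[OF li(2), of n x]
        by (simp add: mollify_def d_def right_diff_distrib mult.commute)
    qed
    have "AE x in lborel. indicator (cball 0 (real N)) x * ennreal \<bar>d x\<bar> = 0" for N
    proof -
      have "(\<lambda>n::nat. \<integral>\<^sup>+x. indicator (cball 0 (real N)) x * ennreal \<bar>d x\<bar> \<partial>lborel) \<longlonglongrightarrow> 0"
        using mollify_L1_local[OF d, of "real N"] by (simp add: m0)
      then have "(\<integral>\<^sup>+x. indicator (cball 0 (real N)) x * ennreal \<bar>d x\<bar> \<partial>lborel) = 0"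
        by (simp add: LIMSEQ_const_iff)
      moreover have [measurable]: "cball (0::'a) (real N) \<in> sets borel" by simp
      ultimately show ?thesis by (subst (asm) nn_integral_0_iff_AE) auto
    qed
    then have "AE x in lborel. \<forall>N. indicator (cball 0 (real N)) x * ennreal \<bar>d x\<bar> = 0"
      unfolding AE_all_countable by blast
    then show ?thesis
    proof eventually_elim
      case (elim x)
      obtain N where "norm x \<le> real N" using real_arch_simple by blast
      with elim[rule_format, of N] show ?case by (simp add: d_def)
    qed
  qed
  then have "AE x in lborel. \<forall>i\<in>Basis. v1 x \<bullet> i = v2 x \<bullet> i"
    by (subst AE_finite_all) auto
  then show ?thesis by eventually_elim (rule euclidean_eqI, auto)
qed

section \<open>Convergence in L2 and products of convergent sequences\<close>

lemma
  fixes a b :: "'a \<Rightarrow> real"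
  assumes [measurable]: "a \<in> borel_measurable M" "b \<in> borel_measurable M"
    and a2: "integrable M (\<lambda>x. (a x)\<^sup>2)" and b2: "integrable M (\<lambda>x. (b x)\<^sup>2)"
  shows integrable_mult_L2: "integrable M (\<lambda>x. a x * b x)"
    and integral_Cauchy_Schwarz: "(LINT x|M. \<bar>a x * b x\<bar>) \<le> sqrt (LINT x|M. (a x)\<^sup>2) * sqrt (LINT x|M. (b x)\<^sup>2)"
proof -
  show i: "integrable M (\<lambda>x. a x * b x)"
  proof (rule Bochner_Integration.integrable_bound)
    show "integrable M (\<lambda>x. (a x)\<^sup>2 + (b x)\<^sup>2)" using a2 b2 by simp
    have "\<bar>s * t\<bar> \<le> s\<^sup>2 + t\<^sup>2" for s t :: real
    proof -
      have "2 * \<bar>s * t\<bar> \<le> s\<^sup>2 + t\<^sup>2"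
        using zero_le_power2[of "\<bar>s\<bar> - \<bar>t\<bar>"] by (simp add: power2_diff abs_mult)
      then show ?thesis using abs_ge_zero[of "s * t"] by linarith
    qed
    then show "AE x in M. norm (a x * b x) \<le> norm ((a x)\<^sup>2 + (b x)\<^sup>2)" by simp
  qed measurable
  have sq: "(\<integral>\<^sup>+x. (ennreal \<bar>u x\<bar>)\<^sup>2 \<partial>M) = ennreal (LINT x|M. (u x)\<^sup>2)" if "integrable M (\<lambda>x. (u x)\<^sup>2)" for u
    using that by (subst nn_integral_eq_integral[symmetric]) (auto simp: ennreal_power)
  have "ennreal ((LINT x|M. \<bar>a x * b x\<bar>)\<^sup>2) = (\<integral>\<^sup>+x. ennreal \<bar>a x\<bar> * ennreal \<bar>b x\<bar> \<partial>M)\<^sup>2"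
  proof -
    have "(\<integral>\<^sup>+x. ennreal \<bar>a x\<bar> * ennreal \<bar>b x\<bar> \<partial>M) = (\<integral>\<^sup>+x. ennreal \<bar>a x * b x\<bar> \<partial>M)"
      by (simp add: abs_mult ennreal_mult)
    also have "\<dots> = ennreal (LINT x|M. \<bar>a x * b x\<bar>)"
      by (rule nn_integral_eq_integral[OF integrable_abs[OF i]]) simp
    finally show ?thesis by (simp add: ennreal_power)
  qed
  also have "\<dots> \<le> (\<integral>\<^sup>+x. (ennreal \<bar>a x\<bar>)\<^sup>2 \<partial>M) * (\<integral>\<^sup>+x. (ennreal \<bar>b x\<bar>)\<^sup>2 \<partial>M)"
    by (rule Cauchy_Schwarz_nn_integral) measurable
  also have "\<dots> = ennreal ((LINT x|M. (a x)\<^sup>2) * (LINT x|M. (b x)\<^sup>2))"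
    using a2 b2 by (simp add: sq ennreal_mult)
  finally have "(LINT x|M. \<bar>a x * b x\<bar>)\<^sup>2 \<le> (LINT x|M. (a x)\<^sup>2) * (LINT x|M. (b x)\<^sup>2)"
    by (subst (asm) ennreal_le_iff) auto
  then show "(LINT x|M. \<bar>a x * b x\<bar>) \<le> sqrt (LINT x|M. (a x)\<^sup>2) * sqrt (LINT x|M. (b x)\<^sup>2)"
    by (simp add: real_sqrt_mult[symmetric] real_le_rsqrt)
qed

text \<open>Square integrability is demanded of the limit and of the differences; that of the
  members of the sequence follows by addition.\<close>

definition L2_conv :: "'a measure \<Rightarrow> (nat \<Rightarrow> 'a \<Rightarrow> real) \<Rightarrow> ('a \<Rightarrow> real) \<Rightarrow> bool" where
  "L2_conv M A a \<longleftrightarrow> (\<forall>n. A n \<in> borel_measurable M) \<and> a \<in> borel_measurable M \<and> integrable M (\<lambda>x. (a x)\<^sup>2) \<and>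
     (\<forall>n. integrable M (\<lambda>x. (A n x - a x)\<^sup>2)) \<and> (\<lambda>n. LINT x|M. (A n x - a x)\<^sup>2) \<longlonglongrightarrow> 0"

lemma square_add_le: "(s + t)\<^sup>2 \<le> 2 * s\<^sup>2 + 2 * t\<^sup>2" for s t :: real
  using zero_le_power2[of "s - t"] by (simp add: power2_eq_square algebra_simps)

lemma L2_conv_add:
  assumes A: "L2_conv M A a" and B: "L2_conv M B b"
  shows "L2_conv M (\<lambda>n x. A n x + B n x) (\<lambda>x. a x + b x)"
  unfolding L2_conv_def
proof (intro conjI allI)
  have [measurable]: "A n \<in> borel_measurable M" "B n \<in> borel_measurable M" for n using A B by (auto simp: L2_conv_def)
  have [measurable]: "a \<in> borel_measurable M" "b \<in> borel_measurable M" using A B by (auto simp: L2_conv_def)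
  show "(\<lambda>x. A n x + B n x) \<in> borel_measurable M" "(\<lambda>x. a x + b x) \<in> borel_measurable M" for n by measurable
  have i: "integrable M (\<lambda>x. (a x)\<^sup>2)" "integrable M (\<lambda>x. (b x)\<^sup>2)"
    "integrable M (\<lambda>x. (A n x - a x)\<^sup>2)" "integrable M (\<lambda>x. (B n x - b x)\<^sup>2)" for n
    using A B by (auto simp: L2_conv_def)
  show "integrable M (\<lambda>x. (a x + b x)\<^sup>2)"
    by (rule Bochner_Integration.integrable_bound[of _ "\<lambda>x. 2 * (a x)\<^sup>2 + 2 * (b x)\<^sup>2"])
       (use i square_add_le in auto)
  have eq: "A n x + B n x - (a x + b x) = (A n x - a x) + (B n x - b x)" for n x by simp
  have i2: "integrable M (\<lambda>x. 2 * (A n x - a x)\<^sup>2 + 2 * (B n x - b x)\<^sup>2)" for n using i by simp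
  show i3: "integrable M (\<lambda>x. (A n x + B n x - (a x + b x))\<^sup>2)" for n
    unfolding eq by (rule Bochner_Integration.integrable_bound[OF i2[of n]]) (use square_add_le in auto)
  show "(\<lambda>n. LINT x|M. (A n x + B n x - (a x + b x))\<^sup>2) \<longlonglongrightarrow> 0"
  proof (rule tendsto_sandwich[OF _ _ tendsto_const])
    have "(\<lambda>n. 2 * (LINT x|M. (A n x - a x)\<^sup>2) + 2 * (LINT x|M. (B n x - b x)\<^sup>2)) \<longlonglongrightarrow> 2 * 0 + 2 * 0"
      by (intro tendsto_intros) (use A B in \<open>auto simp: L2_conv_def\<close>)
    then show "(\<lambda>n. LINT x|M. 2 * (A n x - a x)\<^sup>2 + 2 * (B n x - b x)\<^sup>2) \<longlonglongrightarrow> 0"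
      using i by simp
    show "\<forall>\<^sub>F n in sequentially. (LINT x|M. (A n x + B n x - (a x + b x))\<^sup>2) \<le> (LINT x|M. 2 * (A n x - a x)\<^sup>2 + 2 * (B n x - b x)\<^sup>2)"
      using i2 i3 by (intro always_eventually allI integral_mono) (auto simp: eq square_add_le)
  qed simp
qed

lemma L2_conv_bounded_mult:
  assumes A: "L2_conv M A a" and [measurable]: "c \<in> borel_measurable M" and C: "\<And>x. \<bar>c x\<bar> \<le> C"
  shows "L2_conv M (\<lambda>n x. c x * A n x) (\<lambda>x. c x * a x)"
  unfolding L2_conv_def
proof (intro conjI allI)
  have [measurable]: "A n \<in> borel_measurable M" for n using A by (auto simp: L2_conv_def)
  have [measurable]: "a \<in> borel_measurable M" using A by (auto simp: L2_conv_def)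
  show "(\<lambda>x. c x * A n x) \<in> borel_measurable M" "(\<lambda>x. c x * a x) \<in> borel_measurable M" for n by measurable
  have i: "integrable M (\<lambda>x. (a x)\<^sup>2)" "integrable M (\<lambda>x. (A n x - a x)\<^sup>2)" for n
    using A by (auto simp: L2_conv_def)
  have le: "(c x * t)\<^sup>2 \<le> C\<^sup>2 * t\<^sup>2" for x t
    using power_mono[OF C[of x], of 2] by (simp add: power_mult_distrib mult_right_mono)
  show "integrable M (\<lambda>x. (c x * a x)\<^sup>2)"
    by (rule Bochner_Integration.integrable_bound[of _ "\<lambda>x. C\<^sup>2 * (a x)\<^sup>2"]) (use i le in auto)
  have eq: "c x * A n x - c x * a x = c x * (A n x - a x)" for n x by (simp add: algebra_simps)
  show i3: "integrable M (\<lambda>x. (c x * A n x - c x * a x)\<^sup>2)" for n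
    unfolding eq by (rule Bochner_Integration.integrable_bound[of _ "\<lambda>x. C\<^sup>2 * (A n x - a x)\<^sup>2"]) (use i le in auto)
  show "(\<lambda>n. LINT x|M. (c x * A n x - c x * a x)\<^sup>2) \<longlonglongrightarrow> 0"
  proof (rule tendsto_sandwich[OF _ _ tendsto_const])
    have "(\<lambda>n. C\<^sup>2 * (LINT x|M. (A n x - a x)\<^sup>2)) \<longlonglongrightarrow> C\<^sup>2 * 0"
      by (intro tendsto_intros) (use A in \<open>auto simp: L2_conv_def\<close>)
    then show "(\<lambda>n. LINT x|M. C\<^sup>2 * (A n x - a x)\<^sup>2) \<longlonglongrightarrow> 0" by simp
    show "\<forall>\<^sub>F n in sequentially. (LINT x|M. (c x * A n x - c x * a x)\<^sup>2) \<le> (LINT x|M. C\<^sup>2 * (A n x - a x)\<^sup>2)"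
      using i i3 le by (intro always_eventually allI integral_mono) (auto simp: eq)
  qed simp
qed

text \<open>The identity \<open>A B - a b = (A - a) (B - b) + a (B - b) + b (A - a)\<close> leaves
  in every term a factor that tends to 0 in L2, and Cauchy-Schwarz does the rest.\<close>

lemma
  assumes A: "L2_conv M A a" and B: "L2_conv M B b"
  shows L2_conv_product_integrable: "integrable M (\<lambda>x. A n x * B n x)" "integrable M (\<lambda>x. a x * b x)"
    and L2_conv_product: "(\<lambda>n. LINT x|M. \<bar>A n x * B n x - a x * b x\<bar>) \<longlonglongrightarrow> 0"
proof -
  have [measurable]: "A n \<in> borel_measurable M" for n using A by (auto simp: L2_conv_def)
  have [measurable]: "B n \<in> borel_measurable M" for n using B by (auto simp: L2_conv_def)
  have [measurable]: "a \<in> borel_measurable M" "b \<in> borel_measurable M" using A B by (auto simp: L2_conv_def)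
  have i: "integrable M (\<lambda>x. (a x)\<^sup>2)" "integrable M (\<lambda>x. (b x)\<^sup>2)"
    "integrable M (\<lambda>x. (A n x - a x)\<^sup>2)" "integrable M (\<lambda>x. (B n x - b x)\<^sup>2)" for n
    using A B by (auto simp: L2_conv_def)
  show iab: "integrable M (\<lambda>x. a x * b x)" using i by (intro integrable_mult_L2) auto
  have j: "integrable M (\<lambda>x. (A n x - a x) * (B n x - b x))" "integrable M (\<lambda>x. a x * (B n x - b x))"
    "integrable M (\<lambda>x. b x * (A n x - a x))" for n
    using i by (intro integrable_mult_L2; simp)+
  have eq: "A n x * B n x = (A n x - a x) * (B n x - b x) + a x * (B n x - b x) + b x * (A n x - a x) + a x * b x" for n x
    by (simp add: algebra_simps)
  show iAB: "integrable M (\<lambda>x. A n x * B n x)" for n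
    unfolding eq using j iab by (intro Bochner_Integration.integrable_add) auto
  define \<alpha> where "\<alpha> n = sqrt (LINT x|M. (A n x - a x)\<^sup>2)" for n
  define \<beta> where "\<beta> n = sqrt (LINT x|M. (B n x - b x)\<^sup>2)" for n
  have \<alpha>: "\<alpha> \<longlonglongrightarrow> 0" and \<beta>: "\<beta> \<longlonglongrightarrow> 0"
    using A B tendsto_real_sqrt[of _ 0] unfolding \<alpha>_def[abs_def] \<beta>_def[abs_def] L2_conv_def by fastforce+
  show "(\<lambda>n. LINT x|M. \<bar>A n x * B n x - a x * b x\<bar>) \<longlonglongrightarrow> 0"
  proof (rule tendsto_sandwich[OF _ _ tendsto_const])
    have "(\<lambda>n. \<alpha> n * \<beta> n + sqrt (LINT x|M. (a x)\<^sup>2) * \<beta> n + sqrt (LINT x|M. (b x)\<^sup>2) * \<alpha> n) \<longlonglongrightarrow>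
       0 * 0 + sqrt (LINT x|M. (a x)\<^sup>2) * 0 + sqrt (LINT x|M. (b x)\<^sup>2) * 0"
      by (intro tendsto_intros \<alpha> \<beta>)
    then show "(\<lambda>n. \<alpha> n * \<beta> n + sqrt (LINT x|M. (a x)\<^sup>2) * \<beta> n + sqrt (LINT x|M. (b x)\<^sup>2) * \<alpha> n) \<longlonglongrightarrow> 0" by simp
    show "\<forall>\<^sub>F n in sequentially. (LINT x|M. \<bar>A n x * B n x - a x * b x\<bar>) \<le>
        \<alpha> n * \<beta> n + sqrt (LINT x|M. (a x)\<^sup>2) * \<beta> n + sqrt (LINT x|M. (b x)\<^sup>2) * \<alpha> n"
    proof (intro always_eventually allI)
      fix n
      have "(LINT x|M. \<bar>A n x * B n x - a x * b x\<bar>) \<le>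
         (LINT x|M. \<bar>(A n x - a x) * (B n x - b x)\<bar> + \<bar>a x * (B n x - b x)\<bar> + \<bar>b x * (A n x - a x)\<bar>)"
      proof (rule integral_mono)
        show "\<bar>A n x * B n x - a x * b x\<bar> \<le> \<bar>(A n x - a x) * (B n x - b x)\<bar> + \<bar>a x * (B n x - b x)\<bar> + \<bar>b x * (A n x - a x)\<bar>" for x
          unfolding eq by linarith
        show "integrable M (\<lambda>x. \<bar>A n x * B n x - a x * b x\<bar>)" using iAB[of n] iab by simp
        show "integrable M (\<lambda>x. \<bar>(A n x - a x) * (B n x - b x)\<bar> + \<bar>a x * (B n x - b x)\<bar> + \<bar>b x * (A n x - a x)\<bar>)"
          using j[of n] by (intro Bochner_Integration.integrable_add integrable_abs)
      qed
      also have "\<dots> = (LINT x|M. \<bar>(A n x - a x) * (B n x - b x)\<bar>) + (LINT x|M. \<bar>a x * (B n x - b x)\<bar>) + (LINT x|M. \<bar>b x * (A n x - a x)\<bar>)"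
        using j[of n, THEN integrable_abs] by (simp only: Bochner_Integration.integral_add Bochner_Integration.integrable_add)
      also have "\<dots> \<le> \<alpha> n * \<beta> n + sqrt (LINT x|M. (a x)\<^sup>2) * \<beta> n + sqrt (LINT x|M. (b x)\<^sup>2) * \<alpha> n"
        unfolding \<alpha>_def \<beta>_def using i by (intro add_mono integral_Cauchy_Schwarz) auto
      finally show "(LINT x|M. \<bar>A n x * B n x - a x * b x\<bar>) \<le> \<alpha> n * \<beta> n + sqrt (LINT x|M. (a x)\<^sup>2) * \<beta> n + sqrt (LINT x|M. (b x)\<^sup>2) * \<alpha> n" .
    qed
  qed simp
qed

lemma L1_conv_bounded_mult:
  fixes h :: "nat \<Rightarrow> 'a \<Rightarrow> real"
  assumes i: "\<And>n. integrable M (h n)" "integrable M h0" and lim: "(\<lambda>n. LINT x|M. \<bar>h n x - h0 x\<bar>) \<longlonglongrightarrow> 0"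
    and [measurable]: "c \<in> borel_measurable M" and C: "\<And>x. \<bar>c x\<bar> \<le> C"
  shows "(\<lambda>n. LINT x|M. h n x * c x) \<longlonglongrightarrow> (LINT x|M. h0 x * c x)"
proof (rule tendsto_integral_L1)
  have bi: "integrable M (\<lambda>x. k x * c x)" if k: "integrable M k" for k
  proof (rule Bochner_Integration.integrable_bound)
    show "integrable M (\<lambda>x. \<bar>k x\<bar> * C)" using k by simp
    show "AE x in M. norm (k x * c x) \<le> norm (\<bar>k x\<bar> * C)"
      using C by (intro AE_I2) (auto simp: abs_mult intro!: mult_left_mono order_trans[OF C abs_ge_self])
  qed (use borel_measurable_integrable[OF k] in measurable)
  show "integrable M (\<lambda>x. h n x * c x)" "integrable M (\<lambda>x. h0 x * c x)" for n using i by (auto intro: bi)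
  show "integrable M (\<lambda>x. C * \<bar>h n x - h0 x\<bar>)" for n using i by simp
  show "(\<lambda>n. LINT x|M. C * \<bar>h n x - h0 x\<bar>) \<longlonglongrightarrow> 0"
    using tendsto_mult_left[OF lim, of C] by simp
  show "norm (h n x * c x - h0 x * c x) \<le> C * \<bar>h n x - h0 x\<bar>" for n x
    using mult_left_mono[OF C[of x] abs_ge_zero[of "h n x - h0 x"]]
    unfolding left_diff_distrib[symmetric] real_norm_def abs_mult by (simp add: mult.commute)
qed

lemma mollify_L2_conv:
  fixes u :: "'a::euclidean_space \<Rightarrow> real"
  assumes u: "locally_integrable u" and u2: "locally_integrable (\<lambda>x. (u x)\<^sup>2)"
  shows "L2_conv lborel (\<lambda>n x. indicator (cball 0 R) x * mollify n u x) (\<lambda>x. indicator (cball 0 R) x * u x)"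
proof -
  have [measurable]: "u \<in> borel_measurable borel" using u by (rule locally_integrable_measurable)
  have [measurable]: "mollify n u \<in> borel_measurable borel" for n using u by (rule mollify_measurable)
  have [measurable]: "cball (0::'a) R \<in> sets borel" by simp
  have eq1: "(indicat_real (cball 0 R) x * u x)\<^sup>2 = indicator (cball 0 R) x *\<^sub>R (u x)\<^sup>2"
    and eq2: "(indicat_real (cball 0 R) x * mollify n u x - indicator (cball 0 R) x * u x)\<^sup>2 =
      indicator (cball 0 R) x * (mollify n u x - u x)\<^sup>2" for x n
    by (auto split: split_indicator)
  show ?thesis
    unfolding L2_conv_def eq1 eq2
    using mollify_L2_local[OF assms] locally_integrable_cball[OF u2] by auto
qed

lemma locally_integrable_bound:
  fixes u :: "'a::euclidean_space \<Rightarrow> real" and v :: "'a \<Rightarrow> 'b::{banach, second_countable_topology}"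
  assumes u: "locally_integrable u" and [measurable]: "v \<in> borel_measurable borel" and le: "\<And>x. norm (v x) \<le> u x"
  shows "locally_integrable v"
  unfolding locally_integrable_def set_integrable_def
proof (intro conjI allI impI)
  fix K :: "'a set" assume K: "compact K"
  then have [measurable]: "K \<in> sets borel" by (simp add: compact_imp_closed)
  show "integrable lborel (\<lambda>x. indicator K x *\<^sub>R v x)"
  proof (rule Bochner_Integration.integrable_bound)
    show "integrable lborel (\<lambda>x. indicator K x *\<^sub>R u x)"
      using u K by (simp add: locally_integrable_def set_integrable_def)
    have "norm (indicat_real K x *\<^sub>R v x) \<le> norm (indicat_real K x *\<^sub>R u x)" for x
      using le[of x] by (auto split: split_indicator)
    then show "AE x in lborel. norm (indicat_real K x *\<^sub>R v x) \<le> norm (indicat_real K x *\<^sub>R u x)" by simp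
  qed measurable
qed measurable

lemma locally_integrable_add:
  fixes u v :: "'a::euclidean_space \<Rightarrow> real"
  assumes "locally_integrable u" "locally_integrable v" shows "locally_integrable (\<lambda>x. u x + v x)"
  using assms by (auto simp: locally_integrable_def intro!: borel_measurable_add)

text \<open>For mollified functions the product rule is classical. Both sides of the tested identity
  contain only products of two L2-convergent sequences with a bounded factor, so they converge; thus
  square integrability on compact sets suffices.\<close>

lemma weak_gradient_square:
  fixes g :: "'a::euclidean_space \<Rightarrow> real"
  assumes w: "has_weak_gradient g v" and g2: "locally_integrable (\<lambda>x. (g x)\<^sup>2)"
    and v2: "locally_integrable (\<lambda>x. (norm (v x))\<^sup>2)"
  shows "has_weak_gradient (\<lambda>x. (g x)\<^sup>2) (\<lambda>x. (2 * g x) *\<^sub>R v x)"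
proof -
  have g: "locally_integrable g" and v: "locally_integrable v" using w by (auto simp: has_weak_gradient_def)
  note gm [measurable] = locally_integrable_measurable[OF g] 
  note vm [measurable] = locally_integrable_measurable[OF v]
  have vi: "locally_integrable (\<lambda>x. v x \<bullet> i)" for i using v by (rule locally_integrable_inner)
  have vi2: "locally_integrable (\<lambda>x. (v x \<bullet> i)\<^sup>2)" if "i \<in> Basis" for i
    by (rule locally_integrable_bound[OF v2]) (use Basis_le_norm[OF that] in \<open>auto intro!: power2_le_iff_abs_le[THEN iffD2]\<close>)
  show ?thesis
    unfolding has_weak_gradient_def
  proof (intro conjI allI impI ballI g2)
    show "locally_integrable (\<lambda>x. (2 * g x) *\<^sub>R v x)"
    proof (rule locally_integrable_bound[OF locally_integrable_add[OF g2 v2]])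
      show "norm ((2 * g x) *\<^sub>R v x) \<le> (g x)\<^sup>2 + (norm (v x))\<^sup>2" for x
        using zero_le_power2[of "\<bar>g x\<bar> - norm (v x)"] by (simp add: power2_diff)
    qed measurable
    fix \<phi> :: "'a \<Rightarrow> real" and i :: 'a
    assume \<phi>: "test_function \<phi>" and i: "i \<in> Basis"
    obtain R where R: "0 < R" "\<And>x. R \<le> norm x \<Longrightarrow> \<phi> x = 0" "\<And>x. R \<le> norm x \<Longrightarrow> grad \<phi> x = 0"
      using test_function_bounded_support[OF \<phi>] by metis
    have c\<phi>: "continuous_on UNIV \<phi>" and cg: "continuous_on UNIV (grad \<phi>)"
      using \<phi> by (auto intro: test_function_continuous test_function_grad_continuous)
    have [measurable]: "\<phi> \<in> borel_measurable borel" "grad \<phi> \<in> borel_measurable borel"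
      using c\<phi> cg by (auto intro: borel_measurable_continuous_onI)
    obtain C where C: "\<And>x. norm (\<phi> x) \<le> C" using bounded_if_compact_support[OF c\<phi> R(2)] by metis
    obtain D where D: "\<And>x. norm (grad \<phi> x) \<le> D" using bounded_if_compact_support[OF cg R(3)] by metis
    define I where "I = indicat_real (cball (0::'a) R)"
    \<comment> \<open>The test function and its gradient vanish off the ball, so indicators may be
      inserted at will; they turn local L2 convergence into global one.\<close>
    have I: "(I x * s) * (I x * t) * (grad \<phi> x \<bullet> i) = s * t * (grad \<phi> x \<bullet> i)"
      "(I x * s) * (I x * t) * (2 * \<phi> x) = 2 * s * t * \<phi> x" for x s t
      using R(2,3)[of x] by (auto simp: I_def split: split_indicator)
    \<comment> \<open>The compactly supported function \<Psi> has a directional derivative with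
      integral 0; the product rule splits it into the two sides.\<close>
    have main: "(LINT x|lborel. (mollify n g x)\<^sup>2 * (grad \<phi> x \<bullet> i)) = - (LINT x|lborel. 2 * mollify n g x * mollify n (\<lambda>y. v y \<bullet> i) x * \<phi> x)" for n
    proof -
      define \<Psi> where "\<Psi> = (\<lambda>x. (mollify n g x)\<^sup>2 * \<phi> x)"
      define W where "W = (\<lambda>x. (2 * mollify n g x * \<phi> x) *\<^sub>R mollify_vec n v x + (mollify n g x)\<^sup>2 *\<^sub>R grad \<phi> x)"
      have "(\<Psi> has_derivative (\<lambda>h. W x \<bullet> h)) (at x)" for x
        unfolding \<Psi>_def
        by (rule has_derivative_eq_rhs[OF has_derivative_mult[OF has_derivative_power[OF mollify_weak_gradient[OF w]] test_function_has_derivative[OF \<phi>]]])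
           (auto simp: W_def inner_add_left fun_eq_iff)
      then have der: "((\<lambda>t. \<Psi> (x + t *\<^sub>R i)) has_real_derivative (W (x + t *\<^sub>R i) \<bullet> i)) (at t)" for x t
        by (rule has_derivative_along)
      have cW: "continuous_on UNIV (\<lambda>x. W x \<bullet> i)" unfolding W_def
        by (intro continuous_intros mollify_continuous[OF g] mollify_vec_continuous[OF v] c\<phi> cg)
      have c\<Psi>: "continuous_on UNIV \<Psi>" unfolding \<Psi>_def by (intro continuous_intros mollify_continuous[OF g] c\<phi>)
      have "(LINT x|lborel. W x \<bullet> i) = 0"
      proof (rule integral_derivative_eq_0[OF der cW])
        show "integrable lborel (\<lambda>x. W x \<bullet> i)"
          by (rule integrable_if_compact_support[OF cW, of R]) (use R in \<open>auto simp: W_def\<close>)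
        show "integrable lborel \<Psi>"
          by (rule integrable_if_compact_support[OF c\<Psi>, of R]) (use R in \<open>auto simp: \<Psi>_def\<close>)
        show "\<Psi> \<in> borel_measurable borel" using c\<Psi> by (rule borel_measurable_continuous_onI)
      qed
      also have "(LINT x|lborel. W x \<bullet> i) = (LINT x|lborel. 2 * mollify n g x * mollify n (\<lambda>y. v y \<bullet> i) x * \<phi> x + (mollify n g x)\<^sup>2 * (grad \<phi> x \<bullet> i))"
        by (simp add: W_def inner_add_left mollify_vec_inner[OF i] mult_ac)
      also have "\<dots> = (LINT x|lborel. 2 * mollify n g x * mollify n (\<lambda>y. v y \<bullet> i) x * \<phi> x) + (LINT x|lborel. (mollify n g x)\<^sup>2 * (grad \<phi> x \<bullet> i))"
      proof (rule Bochner_Integration.integral_add)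
        show "integrable lborel (\<lambda>x. 2 * mollify n g x * mollify n (\<lambda>y. v y \<bullet> i) x * \<phi> x)"
          by (rule integrable_if_compact_support[of _ R])
             (use R in \<open>auto intro!: continuous_intros mollify_continuous g vi c\<phi>\<close>)
        show "integrable lborel (\<lambda>x. (mollify n g x)\<^sup>2 * (grad \<phi> x \<bullet> i))"
          by (rule integrable_if_compact_support[of _ R])
             (use R in \<open>auto intro!: continuous_intros mollify_continuous g cg\<close>)
      qed
      finally show ?thesis by simp
    qed
    note Lg = mollify_L2_conv[OF g g2, of R]
    note Lv = mollify_L2_conv[OF vi vi2[OF i], of R]
    have "(\<lambda>n. LINT x|lborel. (I x * mollify n g x) * (I x * mollify n g x) * (grad \<phi> x \<bullet> i)) \<longlonglongrightarrow>
       (LINT x|lborel. (I x * g x) * (I x * g x) * (grad \<phi> x \<bullet> i))"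
    proof (rule L1_conv_bounded_mult[OF L2_conv_product_integrable[OF Lg Lg, folded I_def] L2_conv_product[OF Lg Lg, folded I_def]])
      show "\<bar>grad \<phi> x \<bullet> i\<bar> \<le> D" for x using Basis_le_norm[OF i, of "grad \<phi> x"] D[of x] by linarith
    qed measurable
    then have 1: "(\<lambda>n. LINT x|lborel. (mollify n g x)\<^sup>2 * (grad \<phi> x \<bullet> i)) \<longlonglongrightarrow> (LINT x|lborel. (g x)\<^sup>2 * (grad \<phi> x \<bullet> i))"
      unfolding I power2_eq_square .
    have "(\<lambda>n. LINT x|lborel. (I x * mollify n g x) * (I x * mollify n (\<lambda>y. v y \<bullet> i) x) * (2 * \<phi> x)) \<longlonglongrightarrow>
       (LINT x|lborel. (I x * g x) * (I x * (v x \<bullet> i)) * (2 * \<phi> x))"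
    proof (rule L1_conv_bounded_mult[OF L2_conv_product_integrable[OF Lg Lv, folded I_def] L2_conv_product[OF Lg Lv, folded I_def]])
      show "\<bar>2 * \<phi> x\<bar> \<le> 2 * C" for x using C[of x] by simp
    qed measurable
    then have 2: "(\<lambda>n. LINT x|lborel. 2 * mollify n g x * mollify n (\<lambda>y. v y \<bullet> i) x * \<phi> x) \<longlonglongrightarrow> (LINT x|lborel. 2 * g x * (v x \<bullet> i) * \<phi> x)"
      unfolding I .
    have "(LINT x|lborel. (g x)\<^sup>2 * (grad \<phi> x \<bullet> i)) = - (LINT x|lborel. 2 * g x * (v x \<bullet> i) * \<phi> x)"
      using LIMSEQ_unique[OF 1] tendsto_minus[OF 2] by (simp add: main)
    then show "(LINT x|lborel. (g x)\<^sup>2 * partial_deriv i \<phi> x) = - (LINT x|lborel. ((2 * g x) *\<^sub>R v x \<bullet> i) * \<phi> x)"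
      by (simp add: grad_inner[OF i] mult.assoc)
  qed
qed

section \<open>Approximation of Sobolev densities\<close>

text \<open>Squaring the positive part removes its kink, so the function is continuously
  differentiable, and one continuous derivative is all that \<open>nice_density\<close> asks for. It
  also has an explicit gradient of size \<open>1 / R\<close>.\<close>

definition cutoff :: "real \<Rightarrow> 'a::euclidean_space \<Rightarrow> real" where
  "cutoff R x = (max 0 (1 - (norm x)\<^sup>2 / R\<^sup>2))\<^sup>2"

definition grad_cutoff :: "real \<Rightarrow> 'a::euclidean_space \<Rightarrow> 'a" where
  "grad_cutoff R x = (- (4 / R\<^sup>2) * max 0 (1 - (norm x)\<^sup>2 / R\<^sup>2)) *\<^sub>R x"

lemma max_0_square_DERIV: "((\<lambda>t::real. (max 0 t)\<^sup>2) has_real_derivative 2 * max 0 t) (at t)"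
proof -
  consider "t > 0" | "t < 0" | "t = 0" by linarith
  then show ?thesis
  proof cases
    case 1
    have "((\<lambda>t::real. t\<^sup>2) has_real_derivative 2 * max 0 t) (at t)"
      using 1 by (auto intro!: derivative_eq_intros)
    then show ?thesis
      by (rule has_field_derivative_transform_within_open[of _ _ _ "{0<..}"]) (use 1 in auto)
  next
    case 2
    have "((\<lambda>t::real. 0) has_real_derivative 2 * max 0 t) (at t)" using 2 by simp
    then show ?thesis
      by (rule has_field_derivative_transform_within_open[of _ _ _ "{..<0}"]) (use 2 in auto)
  next
    case 3
    have "((\<lambda>h::real. max 0 h) \<longlongrightarrow> 0) (at 0)"
      using tendsto_max[OF tendsto_const tendsto_ident_at, of "0::real" "0::real" UNIV] by simp
    then have "((\<lambda>h::real. (max 0 h)\<^sup>2 / h) \<longlongrightarrow> 0) (at 0)"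
      by (rule Lim_transform_eventually) (auto simp: eventually_at_filter max_def power2_eq_square)
    then show ?thesis unfolding 3 DERIV_def by simp
  qed
qed

lemma cutoff_has_derivative: "(cutoff R has_derivative (\<lambda>h. grad_cutoff R x \<bullet> h)) (at x)"
proof -
  have "((\<lambda>x::'a. 1 - (x \<bullet> x) * k) has_derivative (\<lambda>h. - (2 * (x \<bullet> h)) * k)) (at x)" for k
    by (rule has_derivative_eq_rhs, (rule derivative_eq_intros refl)+)
       (auto simp: inner_commute fun_eq_iff)
  from has_derivative_compose[OF this max_0_square_DERIV[unfolded has_field_derivative_def]]
  show ?thesis
    unfolding cutoff_def[abs_def] power2_norm_eq_inner divide_inverse
    by (rule has_derivative_eq_rhs) (auto simp: grad_cutoff_def power2_norm_eq_inner fun_eq_iff divide_inverse)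
qed

lemma cutoff_continuous: "continuous_on A (cutoff R)" and grad_cutoff_continuous: "continuous_on A (grad_cutoff R)"
  unfolding cutoff_def[abs_def] grad_cutoff_def[abs_def] divide_inverse by (intro continuous_intros)+

lemma cutoff_measurable [measurable]: "cutoff R \<in> borel_measurable borel" "grad_cutoff R \<in> borel_measurable borel"
  by (rule borel_measurable_continuous_onI, rule cutoff_continuous grad_cutoff_continuous)+

lemma cutoff_nonneg: "0 \<le> cutoff R x" by (simp add: cutoff_def)

lemma cutoff_le_1: "cutoff R x \<le> 1"
  unfolding cutoff_def by (intro power_le_one) auto

lemma cutoff_abs_le: "\<bar>cutoff R x\<bar> \<le> 1" using cutoff_nonneg[of R x] cutoff_le_1[of R x] by simp

lemma cutoff_eq_0:
  assumes "0 < R" "R \<le> norm x" shows "cutoff R x = 0" "grad_cutoff R x = 0"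
proof -
  have "R\<^sup>2 \<le> (norm x)\<^sup>2" using assms by (intro power_mono) auto
  then have "1 - (norm x)\<^sup>2 / R\<^sup>2 \<le> 0" using assms by (simp add: field_simps)
  then show "cutoff R x = 0" "grad_cutoff R x = 0" by (simp_all add: cutoff_def grad_cutoff_def max_absorb1)
qed

lemma norm_grad_cutoff_le:
  assumes "0 < R" shows "norm (grad_cutoff R x) \<le> 4 / R"
proof (cases "R \<le> norm x")
  case True
  then show ?thesis using assms by (simp add: cutoff_eq_0)
next
  case False
  have m: "0 \<le> max 0 (1 - (norm x)\<^sup>2 / R\<^sup>2)" "max 0 (1 - (norm x)\<^sup>2 / R\<^sup>2) \<le> 1" by auto
  have "norm (grad_cutoff R x) = (4 / R\<^sup>2) * max 0 (1 - (norm x)\<^sup>2 / R\<^sup>2) * norm x"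
    using m by (simp add: grad_cutoff_def abs_mult)
  also have "\<dots> \<le> (4 / R\<^sup>2) * 1 * R" using m False by (intro mult_mono) auto
  also have "\<dots> = 4 / R" using assms by (simp add: power2_eq_square)
  finally show ?thesis .
qed

text \<open>From \<open>1 + t \<le> 2 * exp (t / 2)\<close> the Gaussian factor absorbs the
  quadratic weight. Unweighted convergence in L1 for Lebesgue measure therefore implies the weighted
  Gaussian convergence required by \<open>stable_limit\<close>.\<close>

lemma gauss_weight:
  fixes x :: "'a::euclidean_space"
  shows "gaussian_density x * (1 + (norm x)\<^sup>2) \<le> 2 * (2 * pi) powr (- (real DIM('a) / 2))"
proof -
  have "1 + (norm x)\<^sup>2 \<le> 2 * exp ((norm x)\<^sup>2 / 2)"
    using exp_ge_add_one_self[of "(norm x)\<^sup>2 / 2"] by linarith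
  then have "exp (- (norm x)\<^sup>2 / 2) * (1 + (norm x)\<^sup>2) \<le> exp (- (norm x)\<^sup>2 / 2) * (2 * exp ((norm x)\<^sup>2 / 2))"
    by (intro mult_left_mono) auto
  also have "\<dots> = 2" by (simp add: exp_minus field_simps)
  finally have "(2 * pi) powr (- (real DIM('a) / 2)) * (exp (- (norm x)\<^sup>2 / 2) * (1 + (norm x)\<^sup>2)) \<le>
      (2 * pi) powr (- (real DIM('a) / 2)) * 2" by (intro mult_left_mono) auto
  then show ?thesis by (simp add: gaussian_density_def mult.assoc mult.commute)
qed

lemma gaussian_density_le:
  fixes x :: "'a::euclidean_space"
  shows "gaussian_density x \<le> 2 * (2 * pi) powr (- (real DIM('a) / 2))"
  using mult_left_mono[of 1 "1 + (norm x)\<^sup>2" "gaussian_density x"] gauss_weight[of x] by simp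

lemma integrable_gauss_weight:
  fixes u :: "'a::euclidean_space \<Rightarrow> real"
  assumes u: "integrable lborel u"
  shows "integrable lborel (\<lambda>x. gaussian_density x * ((1 + (norm x)\<^sup>2) * u x))"
    "integrable lborel (\<lambda>x. gaussian_density x * ((norm x)\<^sup>2 * u x))"
    "integrable lborel (\<lambda>x. gaussian_density x * u x)"
proof -
  define C where "C = 2 * (2 * pi) powr (- (real DIM('a) / 2))"
  have [measurable]: "u \<in> borel_measurable borel" using borel_measurable_integrable[OF u] by simp
  have i: "integrable lborel (\<lambda>x. gaussian_density x * (k x * u x))"
    if [measurable]: "k \<in> borel_measurable borel" and k: "\<And>x. 0 \<le> k x" "\<And>x. k x \<le> 1 + (norm x)\<^sup>2" for k :: "'a \<Rightarrow> real"
  proof (rule Bochner_Integration.integrable_bound)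
    show "integrable lborel (\<lambda>x. C * \<bar>u x\<bar>)" using u by simp
    have "norm (gaussian_density x * (k x * u x)) \<le> norm (C * \<bar>u x\<bar>)" for x
    proof -
      have "gaussian_density x * k x \<le> C"
        using mult_left_mono[OF k(2), of "gaussian_density x" x] gauss_weight[of x] by (simp add: C_def)
      from mult_right_mono[OF this, of "\<bar>u x\<bar>"] show ?thesis using k(1)[of x]
        by (simp add: abs_mult mult.assoc C_def)
    qed
    then show "AE x in lborel. norm (gaussian_density x * (k x * u x)) \<le> norm (C * \<bar>u x\<bar>)" by simp
  qed measurable
  show "integrable lborel (\<lambda>x. gaussian_density x * ((1 + (norm x)\<^sup>2) * u x))" by (rule i) auto
  show "integrable lborel (\<lambda>x. gaussian_density x * ((norm x)\<^sup>2 * u x))" by (rule i) auto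
  show "integrable lborel (\<lambda>x. gaussian_density x * u x)" using i[of "\<lambda>_. 1"] by simp
qed

text \<open>The Fisher information of \<open>G\<^sup>2 + \<eta>\<close> when \<open>W\<close> is the
  gradient of \<open>G\<close>: the gradient of the density is \<open>2 G W\<close>. Writing the
  quotient as a factor between 0 and 1 keeps the formula meaningful where \<open>G\<close>
  vanishes.\<close>

definition soft_fisher :: "real \<Rightarrow> ('a::euclidean_space \<Rightarrow> real) \<Rightarrow> ('a \<Rightarrow> 'a) \<Rightarrow> real" where
  "soft_fisher \<eta> G W = 4 * (LINT x|std_gaussian. (G x)\<^sup>2 / ((G x)\<^sup>2 + \<eta>) * (norm (W x))\<^sup>2)"

text \<open>Compact support bounds \<open>G\<close> and its gradient, and \<eta> keeps the density
  away from 0, so all conditions of \<open>nice_density\<close> hold.\<close>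

lemma stable_C1_compact:
  fixes G :: "'a::euclidean_space \<Rightarrow> real"
  assumes der: "\<And>x. (G has_derivative (\<lambda>h. W x \<bullet> h)) (at x)" and cW: "continuous_on UNIV W"
    and z: "\<And>x. R \<le> norm x \<Longrightarrow> G x = 0" and \<eta>: "0 < \<eta>"
  shows "stable (\<lambda>x. (G x)\<^sup>2 + \<eta>) (soft_fisher \<eta> G W)"
proof -
  have cG: "continuous_on UNIV G" using der by (meson continuous_at_imp_continuous_on has_derivative_continuous)
  define V where "V = (\<lambda>x. (2 * G x) *\<^sub>R W x)"
  have cV: "continuous_on UNIV V" unfolding V_def by (intro continuous_intros cG cW)
  have zV: "V x = 0" if "R \<le> norm x" for x using z[OF that] by (simp add: V_def)
  obtain L where L: "\<And>x. norm (V x) \<le> L" using bounded_if_compact_support[OF cV zV] by metis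
  obtain K where K: "\<And>x. norm (G x) \<le> K" using bounded_if_compact_support[OF cG z] by metis
  interpret nice_density "\<lambda>x. (G x)\<^sup>2 + \<eta>" V \<eta> "K\<^sup>2 + \<eta>" L
  proof
    show "((\<lambda>x. (G x)\<^sup>2 + \<eta>) has_derivative (\<lambda>h. V x \<bullet> h)) (at x)" for x
      by (rule has_derivative_eq_rhs[OF has_derivative_add[OF has_derivative_power[OF der] has_derivative_const]])
         (auto simp: V_def fun_eq_iff)
    show "(G x)\<^sup>2 + \<eta> \<le> K\<^sup>2 + \<eta>" for x using power_mono[OF K[of x], of 2] by simp
  qed (use cV \<eta> L in auto)
  have "fisher = soft_fisher \<eta> G W"
    unfolding fisher_def soft_fisher_def integral_mult_right_zero[symmetric]
    by (rule Bochner_Integration.integral_cong) (auto simp: V_def power_mult_distrib)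
  with stable show ?thesis by simp
qed

text \<open>The mollified \<open>g\<close> is multiplied by a fixed cutoff, so every convergence
  takes place in L2 of a ball with respect to Lebesgue measure. The gradients of these products are
  \<open>Wn\<close>, and they converge because mollification commutes with weak gradients.\<close>

lemma stable_cutoff:
  fixes g :: "'a::euclidean_space \<Rightarrow> real"
  assumes w: "has_weak_gradient g v" and g2: "locally_integrable (\<lambda>x. (g x)\<^sup>2)"
    and v2: "locally_integrable (\<lambda>x. (norm (v x))\<^sup>2)" and R: "0 < R" and \<eta>: "0 < \<eta>"
  shows "stable (\<lambda>x. (cutoff R x * g x)\<^sup>2 + \<eta>) (soft_fisher \<eta> (\<lambda>x. cutoff R x * g x) (\<lambda>x. cutoff R x *\<^sub>R v x + g x *\<^sub>R grad_cutoff R x))"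
proof -
  have g: "locally_integrable g" and v: "locally_integrable v" using w by (auto simp: has_weak_gradient_def)
  have [measurable]: "g \<in> borel_measurable borel" using g by (rule locally_integrable_measurable)
  have [measurable]: "v \<in> borel_measurable borel" using v by (rule locally_integrable_measurable)
  have vi: "locally_integrable (\<lambda>x. v x \<bullet> i)" for i using v by (rule locally_integrable_inner)
  have vi2: "locally_integrable (\<lambda>x. (v x \<bullet> i)\<^sup>2)" if "i \<in> Basis" for i
    by (rule locally_integrable_bound[OF v2]) (use Basis_le_norm[OF that] in \<open>auto intro!: power2_le_iff_abs_le[THEN iffD2]\<close>)
  define C where "C = 2 * (2 * pi) powr (- (real DIM('a) / 2))"
  have C: "0 \<le> C" by (simp add: C_def)
  define G where "G = (\<lambda>x. cutoff R x * g x)"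
  define W where "W = (\<lambda>x. cutoff R x *\<^sub>R v x + g x *\<^sub>R grad_cutoff R x)"
  define Gn where "Gn n x = cutoff R x * mollify n g x" for n x
  define Wn where "Wn n x = cutoff R x *\<^sub>R mollify_vec n v x + mollify n g x *\<^sub>R grad_cutoff R x" for n x
  have cWn: "continuous_on UNIV (Wn n)" for n unfolding Wn_def
    by (intro continuous_intros cutoff_continuous grad_cutoff_continuous mollify_continuous[OF g] mollify_vec_continuous[OF v])
  have dGn: "(Gn n has_derivative (\<lambda>h. Wn n x \<bullet> h)) (at x)" for n x
    unfolding Gn_def
    by (rule has_derivative_eq_rhs[OF has_derivative_mult[OF cutoff_has_derivative mollify_weak_gradient[OF w]]])
       (auto simp: Wn_def inner_add_left fun_eq_iff)
  have cGn: "continuous_on UNIV (Gn n)" for n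
    using dGn by (meson continuous_at_imp_continuous_on has_derivative_continuous)
  have [measurable]: "Gn n \<in> borel_measurable borel" for n using cGn by (rule borel_measurable_continuous_onI)
  have [measurable]: "Wn n \<in> borel_measurable borel" for n using cWn by (rule borel_measurable_continuous_onI)
  have [measurable]: "G \<in> borel_measurable borel" "W \<in> borel_measurable borel" unfolding G_def W_def by measurable
  have st: "stable (\<lambda>x. (Gn n x)\<^sup>2 + \<eta>) (soft_fisher \<eta> (Gn n) (Wn n))" for n
    by (rule stable_C1_compact[OF dGn cWn, of R]) (use R \<eta> cutoff_eq_0[OF R] in \<open>auto simp: Gn_def\<close>)
  have ind: "cutoff R x * (indicator (cball 0 R) x * t) = cutoff R x * t"
    "(grad_cutoff R x \<bullet> i) * (indicator (cball 0 R) x * t) = (grad_cutoff R x \<bullet> i) * t" for x i t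
    using cutoff_eq_0[OF R, of x] by (auto split: split_indicator)
  have LG: "L2_conv lborel Gn G"
  proof -
    have "L2_conv lborel (\<lambda>n x. cutoff R x * (indicator (cball 0 R) x * mollify n g x)) (\<lambda>x. cutoff R x * (indicator (cball 0 R) x * g x))"
      by (rule L2_conv_bounded_mult[OF mollify_L2_conv[OF g g2] _ cutoff_abs_le]) simp
    then show ?thesis by (simp add: ind Gn_def[abs_def] G_def)
  qed
  have LW: "L2_conv lborel (\<lambda>n x. Wn n x \<bullet> i) (\<lambda>x. W x \<bullet> i)" if i: "i \<in> Basis" for i
  proof -
    have d: "\<bar>grad_cutoff R x \<bullet> i\<bar> \<le> 4 / R" for x
      using Basis_le_norm[OF i, of "grad_cutoff R x"] norm_grad_cutoff_le[OF R, of x] by linarith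
    have "L2_conv lborel (\<lambda>n x. cutoff R x * mollify n (\<lambda>y. v y \<bullet> i) x) (\<lambda>x. cutoff R x * (v x \<bullet> i))"
    proof -
      have "L2_conv lborel (\<lambda>n x. cutoff R x * (indicator (cball 0 R) x * mollify n (\<lambda>y. v y \<bullet> i) x)) (\<lambda>x. cutoff R x * (indicator (cball 0 R) x * (v x \<bullet> i)))"
        by (rule L2_conv_bounded_mult[OF mollify_L2_conv[OF vi vi2[OF i]] _ cutoff_abs_le]) simp
      then show ?thesis by (simp add: ind)
    qed
    moreover have "L2_conv lborel (\<lambda>n x. (grad_cutoff R x \<bullet> i) * mollify n g x) (\<lambda>x. (grad_cutoff R x \<bullet> i) * g x)"
    proof -
      have "L2_conv lborel (\<lambda>n x. (grad_cutoff R x \<bullet> i) * (indicator (cball 0 R) x * mollify n g x)) (\<lambda>x. (grad_cutoff R x \<bullet> i) * (indicator (cball 0 R) x * g x))"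
        by (rule L2_conv_bounded_mult[OF mollify_L2_conv[OF g g2] _ d]) simp
      then show ?thesis by (simp add: ind)
    qed
    ultimately have "L2_conv lborel (\<lambda>n x. cutoff R x * mollify n (\<lambda>y. v y \<bullet> i) x + (grad_cutoff R x \<bullet> i) * mollify n g x)
        (\<lambda>x. cutoff R x * (v x \<bullet> i) + (grad_cutoff R x \<bullet> i) * g x)"
      by (rule L2_conv_add)
    then show ?thesis
      by (simp add: Wn_def W_def inner_add_left mollify_vec_inner[OF i] mult.commute)
  qed
  have GG: "integrable lborel (\<lambda>x. Gn n x * Gn n x)" "integrable lborel (\<lambda>x. G x * G x)"
    "(\<lambda>n. LINT x|lborel. \<bar>Gn n x * Gn n x - G x * G x\<bar>) \<longlonglongrightarrow> 0" for n
    using L2_conv_product_integrable[OF LG LG] L2_conv_product[OF LG LG] by auto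
  have WW: "integrable lborel (\<lambda>x. (Wn n x \<bullet> i) * (Wn n x \<bullet> i))" "integrable lborel (\<lambda>x. (W x \<bullet> i) * (W x \<bullet> i))"
    "(\<lambda>n. LINT x|lborel. \<bar>(Wn n x \<bullet> i) * (Wn n x \<bullet> i) - (W x \<bullet> i) * (W x \<bullet> i)\<bar>) \<longlonglongrightarrow> 0" if "i \<in> Basis" for i n
    using L2_conv_product_integrable[OF LW[OF that] LW[OF that]] L2_conv_product[OF LW[OF that] LW[OF that]] by auto
  have nsq: "(norm x)\<^sup>2 = (\<Sum>i\<in>Basis. (x \<bullet> i) * (x \<bullet> i))" for x :: 'a
    unfolding power2_norm_eq_inner by (rule euclidean_inner)
  have W2: "integrable lborel (\<lambda>x. (norm (W x))\<^sup>2)" "integrable lborel (\<lambda>x. (norm (Wn n x))\<^sup>2)" for n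
    unfolding nsq using WW by (auto intro!: Bochner_Integration.integrable_sum)
  have W2lim: "(\<lambda>n. LINT x|lborel. \<bar>(norm (Wn n x))\<^sup>2 - (norm (W x))\<^sup>2\<bar>) \<longlonglongrightarrow> 0"
  proof (rule tendsto_sandwich[OF _ _ tendsto_const])
    have "(\<lambda>n. \<Sum>i\<in>Basis. LINT x|lborel. \<bar>(Wn n x \<bullet> i) * (Wn n x \<bullet> i) - (W x \<bullet> i) * (W x \<bullet> i)\<bar>) \<longlonglongrightarrow> (\<Sum>i\<in>(Basis::'a set). 0)"
      by (intro tendsto_sum WW)
    then show "(\<lambda>n. \<Sum>i\<in>Basis. LINT x|lborel. \<bar>(Wn n x \<bullet> i) * (Wn n x \<bullet> i) - (W x \<bullet> i) * (W x \<bullet> i)\<bar>) \<longlonglongrightarrow> 0" by simp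
    show "\<forall>\<^sub>F n in sequentially. (LINT x|lborel. \<bar>(norm (Wn n x))\<^sup>2 - (norm (W x))\<^sup>2\<bar>) \<le>
        (\<Sum>i\<in>Basis. LINT x|lborel. \<bar>(Wn n x \<bullet> i) * (Wn n x \<bullet> i) - (W x \<bullet> i) * (W x \<bullet> i)\<bar>)"
    proof (intro always_eventually allI)
      fix n
      have si: "integrable lborel (\<lambda>x. \<bar>(Wn n x \<bullet> i) * (Wn n x \<bullet> i) - (W x \<bullet> i) * (W x \<bullet> i)\<bar>)" if "i \<in> Basis" for i
        using WW[OF that] by simp
      have "(LINT x|lborel. \<bar>(norm (Wn n x))\<^sup>2 - (norm (W x))\<^sup>2\<bar>) \<le>
          (LINT x|lborel. (\<Sum>i\<in>Basis. \<bar>(Wn n x \<bullet> i) * (Wn n x \<bullet> i) - (W x \<bullet> i) * (W x \<bullet> i)\<bar>))"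
      proof (rule integral_mono)
        show "integrable lborel (\<lambda>x. \<Sum>i\<in>Basis. \<bar>(Wn n x \<bullet> i) * (Wn n x \<bullet> i) - (W x \<bullet> i) * (W x \<bullet> i)\<bar>)"
          using si by (intro Bochner_Integration.integrable_sum) auto
        show "\<bar>(norm (Wn n x))\<^sup>2 - (norm (W x))\<^sup>2\<bar> \<le> (\<Sum>i\<in>Basis. \<bar>(Wn n x \<bullet> i) * (Wn n x \<bullet> i) - (W x \<bullet> i) * (W x \<bullet> i)\<bar>)" for x
          unfolding nsq sum_subtractf[symmetric] by (rule sum_abs)
      qed (use W2 in auto)
      also have "\<dots> = (\<Sum>i\<in>Basis. LINT x|lborel. \<bar>(Wn n x \<bullet> i) * (Wn n x \<bullet> i) - (W x \<bullet> i) * (W x \<bullet> i)\<bar>)"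
        using si by (intro Bochner_Integration.integral_sum) auto
      finally show "(LINT x|lborel. \<bar>(norm (Wn n x))\<^sup>2 - (norm (W x))\<^sup>2\<bar>) \<le>
        (\<Sum>i\<in>Basis. LINT x|lborel. \<bar>(Wn n x \<bullet> i) * (Wn n x \<bullet> i) - (W x \<bullet> i) * (W x \<bullet> i)\<bar>)" .
    qed
  qed simp
  \<comment> \<open>Pointwise convergence is needed for the bounded nonlinear factor
    \<open>q\<close>, hence the subsequence.\<close>
  obtain r where r: "strict_mono r" and ae: "AE x in lborel. (\<lambda>n. Gn (r n) x * Gn (r n) x - G x * G x) \<longlonglongrightarrow> 0"
    using tendsto_L1_AE_subseq[of lborel "\<lambda>n x. Gn n x * Gn n x - G x * G x"] GG by auto
  define q where "q t = t / (t + \<eta>)" for t :: real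
  have q: "0 \<le> q (t * t)" "q (t * t) \<le> 1" for t using \<eta> by (auto simp: q_def divide_le_eq_1 add_nonneg_pos)
  have [measurable]: "q \<in> borel_measurable borel" unfolding q_def[abs_def] by measurable
  have J: "(\<lambda>n. soft_fisher \<eta> (Gn (r n)) (Wn (r n))) \<longlonglongrightarrow> soft_fisher \<eta> G W"
  proof -
    have eq: "soft_fisher \<eta> G' W' = 4 * (LINT x|lborel. gaussian_density x * (q (G' x * G' x) * (norm (W' x))\<^sup>2))"
      if [measurable]: "G' \<in> borel_measurable borel" "W' \<in> borel_measurable borel" for G' W'
      unfolding soft_fisher_def by (subst integral_std_gaussian) (auto simp: q_def power2_eq_square)
    have bnd: "norm (gaussian_density x * (q (t * t) * y\<^sup>2)) \<le> norm (C * y\<^sup>2)" for x :: 'a and t y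
    proof -
      have "gaussian_density x * (q (t * t) * y\<^sup>2) \<le> C * (1 * y\<^sup>2)"
        using q[of t] gaussian_density_le[of x] C by (intro mult_mono) (auto simp: C_def)
      then show ?thesis using q[of t] C by (simp add: abs_mult)
    qed
    have int: "integrable lborel (\<lambda>x. gaussian_density x * (q (G' x * G' x) * (norm (W' x))\<^sup>2))"
      if [measurable]: "G' \<in> borel_measurable borel" "W' \<in> borel_measurable borel" and "integrable lborel (\<lambda>x. (norm (W' x))\<^sup>2)" for G' and W' :: "'a \<Rightarrow> 'a"
      by (rule Bochner_Integration.integrable_bound[of _ "\<lambda>x. C * (norm (W' x))\<^sup>2"]) (use that bnd in auto)
    \<comment> \<open>Splitting \<open>q_n A_n - q A\<close> as
      \<open>q_n (A_n - A) + (q_n - q) A\<close> with \<open>A = (norm (W x))\<^sup>2\<close>: the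
      first part tends to 0 in L1 since \<open>q_n \<le> 1\<close>, the second by dominated
      convergence.\<close>
    define b where "b n x = C * (\<bar>(norm (Wn n x))\<^sup>2 - (norm (W x))\<^sup>2\<bar> + \<bar>q (Gn n x * Gn n x) - q (G x * G x)\<bar> * (norm (W x))\<^sup>2)" for n x
    have qd: "\<bar>q (s * s) - q (t * t)\<bar> \<le> 1" for s t using q[of s] q[of t] by linarith
    have qi: "integrable lborel (\<lambda>x. \<bar>q (Gn n x * Gn n x) - q (G x * G x)\<bar> * (norm (W x))\<^sup>2)" for n
      by (rule Bochner_Integration.integrable_bound[OF W2(1)]) (use qd in \<open>auto simp: abs_mult intro!: mult_left_le_one_le\<close>)
    have "(\<lambda>n. LINT x|lborel. gaussian_density x * (q (Gn (r n) x * Gn (r n) x) * (norm (Wn (r n) x))\<^sup>2)) \<longlonglongrightarrow>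
       (LINT x|lborel. gaussian_density x * (q (G x * G x) * (norm (W x))\<^sup>2))"
    proof (rule tendsto_integral_L1)
      show "integrable lborel (\<lambda>x. gaussian_density x * (q (Gn (r n) x * Gn (r n) x) * (norm (Wn (r n) x))\<^sup>2))" for n
        using W2 by (intro int) auto
      show "integrable lborel (\<lambda>x. gaussian_density x * (q (G x * G x) * (norm (W x))\<^sup>2))" using W2 by (intro int) auto
      show "integrable lborel (b (r n))" for n unfolding b_def[abs_def] using W2 qi by simp
      have 1: "(\<lambda>n. LINT x|lborel. \<bar>(norm (Wn (r n) x))\<^sup>2 - (norm (W x))\<^sup>2\<bar>) \<longlonglongrightarrow> 0"
        using LIMSEQ_subseq_LIMSEQ[OF W2lim r] by (simp add: o_def)
      have 2: "(\<lambda>n. LINT x|lborel. \<bar>q (Gn (r n) x * Gn (r n) x) - q (G x * G x)\<bar> * (norm (W x))\<^sup>2) \<longlonglongrightarrow> (LINT x|(lborel :: 'a measure). 0)"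
      proof (rule integral_dominated_convergence[OF _ _ W2(1)])
        show "AE x in lborel. (\<lambda>n. \<bar>q (Gn (r n) x * Gn (r n) x) - q (G x * G x)\<bar> * (norm (W x))\<^sup>2) \<longlonglongrightarrow> 0"
          using ae
        proof eventually_elim
          case (elim x)
          then have l: "(\<lambda>n. Gn (r n) x * Gn (r n) x) \<longlonglongrightarrow> G x * G x" by (rule LIM_zero_cancel)
          have "G x * G x + \<eta> \<noteq> 0" using \<eta> by (smt (verit) zero_le_square)
          then have "(\<lambda>n. q (Gn (r n) x * Gn (r n) x)) \<longlonglongrightarrow> q (G x * G x)"
            unfolding q_def by (intro tendsto_intros l)
          then have "(\<lambda>n. \<bar>q (Gn (r n) x * Gn (r n) x) - q (G x * G x)\<bar> * (norm (W x))\<^sup>2) \<longlonglongrightarrow> \<bar>q (G x * G x) - q (G x * G x)\<bar> * (norm (W x))\<^sup>2"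
            by (intro tendsto_intros)
          then show ?case by simp
        qed
      qed (use qd in \<open>auto simp: abs_mult intro!: mult_left_le_one_le\<close>)
      have "(\<lambda>n. C * ((LINT x|lborel. \<bar>(norm (Wn (r n) x))\<^sup>2 - (norm (W x))\<^sup>2\<bar>) + (LINT x|lborel. \<bar>q (Gn (r n) x * Gn (r n) x) - q (G x * G x)\<bar> * (norm (W x))\<^sup>2))) \<longlonglongrightarrow> C * (0 + (LINT x|(lborel :: 'a measure). 0))"
        by (intro tendsto_intros 1 2)
      then show "(\<lambda>n. LINT x|lborel. b (r n) x) \<longlonglongrightarrow> 0"
        unfolding b_def using W2 qi by simp
      show "norm (gaussian_density x * (q (Gn (r n) x * Gn (r n) x) * (norm (Wn (r n) x))\<^sup>2) - gaussian_density x * (q (G x * G x) * (norm (W x))\<^sup>2)) \<le> b (r n) x" for n x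
      proof -
        have "q s * A - q t * B = q s * (A - B) + (q s - q t) * B" for s t A B by (simp add: algebra_simps)
        then have "norm (gaussian_density x * (q s * A) - gaussian_density x * (q t * B)) = gaussian_density x * \<bar>q s * (A - B) + (q s - q t) * B\<bar>" for s t A B
          by (simp add: right_diff_distrib[symmetric] abs_mult)
        also have "gaussian_density x * \<bar>q (s * s) * (A - B) + (q (s * s) - q (t * t)) * B\<bar> \<le> C * (\<bar>A - B\<bar> + \<bar>q (s * s) - q (t * t)\<bar> * B)" if "0 \<le> B" for s t A B
        proof (rule mult_mono)
          have "\<bar>q (s * s) * (A - B)\<bar> \<le> \<bar>A - B\<bar>"
            unfolding abs_mult using q[of s] by (intro mult_left_le_one_le) auto
          then show "\<bar>q (s * s) * (A - B) + (q (s * s) - q (t * t)) * B\<bar> \<le> \<bar>A - B\<bar> + \<bar>q (s * s) - q (t * t)\<bar> * B"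
            using abs_triangle_ineq[of "q (s * s) * (A - B)" "(q (s * s) - q (t * t)) * B"] that by (simp add: abs_mult)
        qed (use gaussian_density_le[of x] C in \<open>auto simp: C_def\<close>)
        finally show ?thesis unfolding b_def by simp
      qed
    qed
    then show ?thesis by (simp add: eq tendsto_mult_left)
  qed
  have "stable (\<lambda>x. (G x)\<^sup>2 + \<eta>) (soft_fisher \<eta> G W)"
  proof (rule stable_limit[OF st[of "r _"] J])
    have c: "integrable std_gaussian (\<lambda>x::'a. (norm x)\<^sup>2 * \<eta>)" using integrable_std_gaussian_norm_sq[where 'a='a] by simp
    show i: "integrable std_gaussian (\<lambda>x. (G x)\<^sup>2 + \<eta>)"
      using integrable_gauss_weight(3)[OF GG(2)] by (simp add: integrable_std_gaussian_iff power2_eq_square)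
    have "integrable std_gaussian (\<lambda>x. (norm x)\<^sup>2 * (G x)\<^sup>2)"
      using integrable_gauss_weight(2)[OF GG(2)] by (subst integrable_std_gaussian_iff) (auto simp: power2_eq_square[of "G _"])
    then show "integrable std_gaussian (\<lambda>x. (norm x)\<^sup>2 * ((G x)\<^sup>2 + \<eta>))"
      using c by (simp add: distrib_left)
    have "(LINT x|(std_gaussian :: 'a measure). \<eta>) \<le> (LINT x|std_gaussian. (G x)\<^sup>2 + \<eta>)"
      using i by (intro integral_mono) auto
    then show "0 < (LINT x|std_gaussian. (G x)\<^sup>2 + \<eta>)" using \<eta> by (simp add: std_gaussian.prob_space[simplified])
    show "(\<lambda>j. LINT x|std_gaussian. (1 + (norm x)\<^sup>2) * \<bar>(Gn (r j) x)\<^sup>2 + \<eta> - ((G x)\<^sup>2 + \<eta>)\<bar>) \<longlonglongrightarrow> 0"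
    proof (rule tendsto_sandwich[OF _ _ tendsto_const])
      show "(\<lambda>j. C * (LINT x|lborel. \<bar>Gn (r j) x * Gn (r j) x - G x * G x\<bar>)) \<longlonglongrightarrow> 0"
        using tendsto_mult_left[OF LIMSEQ_subseq_LIMSEQ[OF GG(3) r], of C] by (simp add: o_def)
      show "\<forall>\<^sub>F j in sequentially. (LINT x|std_gaussian. (1 + (norm x)\<^sup>2) * \<bar>(Gn (r j) x)\<^sup>2 + \<eta> - ((G x)\<^sup>2 + \<eta>)\<bar>) \<le>
         C * (LINT x|lborel. \<bar>Gn (r j) x * Gn (r j) x - G x * G x\<bar>)"
      proof (intro always_eventually allI)
        fix j
        define d where "d x = \<bar>Gn (r j) x * Gn (r j) x - G x * G x\<bar>" for x
        have d: "integrable lborel d" unfolding d_def[abs_def] using GG by simp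
        have [measurable]: "d \<in> borel_measurable borel" unfolding d_def[abs_def] by measurable
        have "(LINT x|std_gaussian. (1 + (norm x)\<^sup>2) * \<bar>(Gn (r j) x)\<^sup>2 + \<eta> - ((G x)\<^sup>2 + \<eta>)\<bar>) = (LINT x|std_gaussian. (1 + (norm x)\<^sup>2) * d x)"
          by (simp add: d_def power2_eq_square)
        also have "\<dots> = (LINT x|lborel. gaussian_density x * ((1 + (norm x)\<^sup>2) * d x))"
          by (subst integral_std_gaussian) auto
        also have "\<dots> \<le> (LINT x|lborel. C * d x)"
        proof (rule integral_mono[OF integrable_gauss_weight(1)[OF d]])
          show "gaussian_density x * ((1 + (norm x)\<^sup>2) * d x) \<le> C * d x" for x
            using mult_right_mono[OF gauss_weight[of x], of "d x"] by (simp add: C_def d_def mult.assoc)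
        qed (use d in simp)
        also have "\<dots> = C * (LINT x|lborel. d x)" by simp
        finally show "(LINT x|std_gaussian. (1 + (norm x)\<^sup>2) * \<bar>(Gn (r j) x)\<^sup>2 + \<eta> - ((G x)\<^sup>2 + \<eta>)\<bar>) \<le>
         C * (LINT x|lborel. \<bar>Gn (r j) x * Gn (r j) x - G x * G x\<bar>)" by (simp add: d_def)
      qed
    qed simp
  qed (use \<eta> in auto)
  then show ?thesis by (simp add: G_def W_def)
qed

text \<open>On a bounded set the Gaussian density has a positive lower bound \<open>c\<close>, so
  Gaussian integrability dominates Lebesgue integrability there.\<close>

lemma locally_integrable_if_gaussian:
  fixes u :: "'a::euclidean_space \<Rightarrow> real"
  assumes [measurable]: "u \<in> borel_measurable borel" and u: "integrable std_gaussian u"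
  shows "locally_integrable u"
  unfolding locally_integrable_def set_integrable_def
proof (intro conjI allI impI)
  fix K :: "'a set" assume K: "compact K"
  then have [measurable]: "K \<in> sets borel" by (simp add: compact_imp_closed)
  obtain R where R: "0 < R" "\<And>x. x \<in> K \<Longrightarrow> norm x \<le> R"
    using compact_imp_bounded[OF K] by (auto simp: bounded_pos)
  define c where "c = (2 * pi) powr (- (real DIM('a) / 2)) * exp (- R\<^sup>2 / 2)"
  have c: "0 < c" by (simp add: c_def)
  have le: "c \<le> gaussian_density x" if "x \<in> K" for x
    using R(2)[OF that] by (auto simp: c_def gaussian_density_def intro!: mult_left_mono power_mono)
  show "integrable lborel (\<lambda>x. indicator K x *\<^sub>R u x)"
  proof (rule Bochner_Integration.integrable_bound)
    show "integrable lborel (\<lambda>x. (1 / c) * (gaussian_density x * u x))"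
      using u by (simp add: integrable_std_gaussian_iff)
    have "norm (indicat_real K x *\<^sub>R u x) \<le> norm ((1 / c) * (gaussian_density x * u x))" for x
    proof (cases "x \<in> K")
      case True
      have "c * \<bar>u x\<bar> \<le> gaussian_density x * \<bar>u x\<bar>" using le[OF True] by (rule mult_right_mono) simp
      then show ?thesis using True c by (simp add: abs_mult field_simps)
    qed simp
    then show "AE x in lborel. norm (indicat_real K x *\<^sub>R u x) \<le> norm ((1 / c) * (gaussian_density x * u x))" by simp
  qed measurable
qed measurable

text \<open>The cutoff radius tends to infinity while the floor \<eta> tends to 0, both governed by
  \<open>j\<close>, and all limits follow by dominated convergence. The factor
  \<open>G\<^sup>2 / (G\<^sup>2 + \<eta>)\<close> tends to 1 where \<open>g\<close> is nonzero and
  is 0 where \<open>g\<close> vanishes, which explains the case distinction in the limiting Fisher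
  information.\<close>

lemma stable_square:
  fixes g :: "'a::euclidean_space \<Rightarrow> real"
  assumes w: "has_weak_gradient g v" and i1: "integrable std_gaussian (\<lambda>x. (g x)\<^sup>2)"
    and i2: "integrable std_gaussian (\<lambda>x. (norm (v x))\<^sup>2)"
    and i3: "integrable std_gaussian (\<lambda>x. (norm x)\<^sup>2 * (g x)\<^sup>2)"
    and m: "0 < (LINT x|std_gaussian. (g x)\<^sup>2)"
  shows "stable (\<lambda>x. (g x)\<^sup>2) (4 * (LINT x|std_gaussian. (if g x = 0 then 0 else (norm (v x))\<^sup>2)))"
proof -
  have [measurable]: "g \<in> borel_measurable borel" "v \<in> borel_measurable borel"
    using w by (auto simp: has_weak_gradient_def locally_integrable_def)
  define R where "R j = real (Suc j)" for j
  define \<eta> where "\<eta> j = inverse (real (Suc j))" for j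
  have R: "0 < R j" "1 \<le> R j" and \<eta>: "0 < \<eta> j" "\<eta> j \<le> 1" for j by (auto simp: R_def \<eta>_def inverse_le_1_iff)
  have \<eta>_lim: "\<eta> \<longlonglongrightarrow> 0" unfolding \<eta>_def by (rule LIMSEQ_inverse_real_of_nat)
  have R\<eta>: "1 / R j = \<eta> j" for j by (simp add: R_def \<eta>_def inverse_eq_divide)
  define G where "G j x = cutoff (R j) x * g x" for j x
  define W where "W j x = cutoff (R j) x *\<^sub>R v x + g x *\<^sub>R grad_cutoff (R j) x" for j x
  have [measurable]: "G j \<in> borel_measurable borel" "W j \<in> borel_measurable borel" for j
    unfolding G_def[abs_def] W_def[abs_def] by measurable
  have st: "stable (\<lambda>x. (G j x)\<^sup>2 + \<eta> j) (soft_fisher (\<eta> j) (G j) (W j))" for j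
    unfolding G_def[abs_def] W_def[abs_def]
    by (rule stable_cutoff[OF w _ _ R(1) \<eta>(1)]) (use i1 i2 in \<open>auto intro!: locally_integrable_if_gaussian\<close>)
  have cut_lim: "(\<lambda>j. cutoff (R j) x) \<longlonglongrightarrow> 1" for x :: 'a
  proof -
    have "(\<lambda>j. (max 0 (1 - (norm x)\<^sup>2 * (\<eta> j)\<^sup>2))\<^sup>2) \<longlonglongrightarrow> (max 0 (1 - (norm x)\<^sup>2 * 0\<^sup>2))\<^sup>2"
      by (intro tendsto_intros \<eta>_lim)
    moreover have "(norm x)\<^sup>2 * (\<eta> j)\<^sup>2 = (norm x)\<^sup>2 / (R j)\<^sup>2" for j
      unfolding R\<eta>[symmetric] by (simp add: power_divide)
    ultimately show ?thesis by (simp add: cutoff_def)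
  qed
  have G_lim: "(\<lambda>j. G j x) \<longlonglongrightarrow> g x" for x
    using tendsto_mult_right[OF cut_lim[of x], of "g x"] by (simp add: G_def)
  have grad_lim: "(\<lambda>j. grad_cutoff (R j) x) \<longlonglongrightarrow> 0" for x :: 'a
  proof (rule Lim_null_comparison)
    show "\<forall>\<^sub>F j in sequentially. norm (grad_cutoff (R j) x) \<le> 4 * \<eta> j"
      using norm_grad_cutoff_le[OF R(1)] by (intro always_eventually allI) (simp add: R\<eta>[symmetric])
    show "(\<lambda>j. 4 * \<eta> j) \<longlonglongrightarrow> 0" using tendsto_mult_left[OF \<eta>_lim, of 4] by simp
  qed
  have W_lim: "(\<lambda>j. W j x) \<longlonglongrightarrow> v x" for x
  proof -
    have "(\<lambda>j. W j x) \<longlonglongrightarrow> 1 *\<^sub>R v x + g x *\<^sub>R 0"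
      unfolding W_def by (intro tendsto_intros cut_lim grad_lim)
    then show ?thesis by simp
  qed
  \<comment> \<open>As \<open>R j \<ge> 1\<close>, the gradient of the cutoff is bounded by 4 for
    all \<open>j\<close>; the constant 32 is \<open>2 * 4\<^sup>2\<close>.\<close>
  have W_le: "(norm (W j x))\<^sup>2 \<le> 2 * (norm (v x))\<^sup>2 + 32 * (g x)\<^sup>2" for j x
  proof -
    have "norm (W j x) \<le> norm (cutoff (R j) x *\<^sub>R v x) + norm (g x *\<^sub>R grad_cutoff (R j) x)"
      unfolding W_def by (rule norm_triangle_ineq)
    also have "\<dots> \<le> norm (v x) + 4 * \<bar>g x\<bar>"
    proof (rule add_mono)
      show "norm (cutoff (R j) x *\<^sub>R v x) \<le> norm (v x)"
        using mult_right_mono[OF cutoff_abs_le[of "R j" x] norm_ge_zero[of "v x"]] by simp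
      have "4 / R j \<le> 4" using R(2)[of j] by (simp add: field_simps)
      then have "norm (grad_cutoff (R j) x) \<le> 4" using norm_grad_cutoff_le[OF R(1), of j x] by linarith
      from mult_left_mono[OF this abs_ge_zero[of "g x"]]
      show "norm (g x *\<^sub>R grad_cutoff (R j) x) \<le> 4 * \<bar>g x\<bar>" by simp
    qed
    finally have "(norm (W j x))\<^sup>2 \<le> (norm (v x) + 4 * \<bar>g x\<bar>)\<^sup>2" by (intro power_mono) auto
    also have "\<dots> \<le> 2 * (norm (v x))\<^sup>2 + 2 * (4 * \<bar>g x\<bar>)\<^sup>2" by (rule square_add_le)
    finally show ?thesis by (simp add: power_mult_distrib)
  qed
  have q_le: "(t::real)\<^sup>2 / (t\<^sup>2 + \<eta> j) \<le> 1" "0 \<le> t\<^sup>2 / (t\<^sup>2 + \<eta> j)" for t j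
    using \<eta>(1)[of j] by (auto simp: divide_le_eq_1 add_nonneg_pos)
  have J: "(\<lambda>j. soft_fisher (\<eta> j) (G j) (W j)) \<longlonglongrightarrow> 4 * (LINT x|std_gaussian. (if g x = 0 then 0 else (norm (v x))\<^sup>2))"
    unfolding soft_fisher_def
  proof (rule tendsto_mult_left, rule integral_dominated_convergence)
    show "integrable std_gaussian (\<lambda>x. 2 * (norm (v x))\<^sup>2 + 32 * (g x)\<^sup>2)" using i1 i2 by simp
    show "AE x in std_gaussian. (\<lambda>j. (G j x)\<^sup>2 / ((G j x)\<^sup>2 + \<eta> j) * (norm (W j x))\<^sup>2) \<longlonglongrightarrow> (if g x = 0 then 0 else (norm (v x))\<^sup>2)"
    proof (rule AE_I2)
      fix x
      show "(\<lambda>j. (G j x)\<^sup>2 / ((G j x)\<^sup>2 + \<eta> j) * (norm (W j x))\<^sup>2) \<longlonglongrightarrow> (if g x = 0 then 0 else (norm (v x))\<^sup>2)"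
      proof (cases "g x = 0")
        case True
        then show ?thesis by (simp add: G_def)
      next
        case False
        then have "(\<lambda>j. (G j x)\<^sup>2 / ((G j x)\<^sup>2 + \<eta> j) * (norm (W j x))\<^sup>2) \<longlonglongrightarrow> (g x)\<^sup>2 / ((g x)\<^sup>2 + 0) * (norm (v x))\<^sup>2"
          by (intro tendsto_intros G_lim W_lim \<eta>_lim) auto
        with False show ?thesis by simp
      qed
    qed
    show "AE x in std_gaussian. norm ((G j x)\<^sup>2 / ((G j x)\<^sup>2 + \<eta> j) * (norm (W j x))\<^sup>2) \<le> 2 * (norm (v x))\<^sup>2 + 32 * (g x)\<^sup>2" for j
    proof (rule AE_I2)
      fix x
      have "(G j x)\<^sup>2 / ((G j x)\<^sup>2 + \<eta> j) * (norm (W j x))\<^sup>2 \<le> 1 * (2 * (norm (v x))\<^sup>2 + 32 * (g x)\<^sup>2)"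
        by (intro mult_mono q_le W_le) auto
      then show "norm ((G j x)\<^sup>2 / ((G j x)\<^sup>2 + \<eta> j) * (norm (W j x))\<^sup>2) \<le> 2 * (norm (v x))\<^sup>2 + 32 * (g x)\<^sup>2"
        unfolding real_norm_def by (subst abs_of_nonneg) (simp_all only: mult_nonneg_nonneg q_le(2) zero_le_power2 mult_1)
    qed
  qed measurable
  show ?thesis
  proof (rule stable_limit[OF st J _ _ i1 i3 m])
    have "(\<lambda>j. LINT x|std_gaussian. (1 + (norm x)\<^sup>2) * \<bar>(G j x)\<^sup>2 + \<eta> j - (g x)\<^sup>2\<bar>) \<longlonglongrightarrow> (LINT x|(std_gaussian :: 'a measure). 0)"
    proof (rule integral_dominated_convergence)
      have n2: "integrable std_gaussian (\<lambda>x::'a. (norm x)\<^sup>2)" by (rule integrable_std_gaussian_norm_sq)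
      show "integrable std_gaussian (\<lambda>x. (g x)\<^sup>2 + (norm x)\<^sup>2 * (g x)\<^sup>2 + 1 + (norm x)\<^sup>2)"
        using i1 i3 n2 by simp
      show "AE x in std_gaussian. (\<lambda>j. (1 + (norm x)\<^sup>2) * \<bar>(G j x)\<^sup>2 + \<eta> j - (g x)\<^sup>2\<bar>) \<longlonglongrightarrow> 0"
      proof (rule AE_I2)
        fix x
        have "(\<lambda>j. (1 + (norm x)\<^sup>2) * \<bar>(G j x)\<^sup>2 + \<eta> j - (g x)\<^sup>2\<bar>) \<longlonglongrightarrow> (1 + (norm x)\<^sup>2) * \<bar>(g x)\<^sup>2 + 0 - (g x)\<^sup>2\<bar>"
          by (intro tendsto_intros G_lim \<eta>_lim)
        then show "(\<lambda>j. (1 + (norm x)\<^sup>2) * \<bar>(G j x)\<^sup>2 + \<eta> j - (g x)\<^sup>2\<bar>) \<longlonglongrightarrow> 0" by simp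
      qed
      show "AE x in std_gaussian. norm ((1 + (norm x)\<^sup>2) * \<bar>(G j x)\<^sup>2 + \<eta> j - (g x)\<^sup>2\<bar>) \<le> (g x)\<^sup>2 + (norm x)\<^sup>2 * (g x)\<^sup>2 + 1 + (norm x)\<^sup>2" for j
      proof (rule AE_I2)
        fix x :: 'a
        have "(cutoff (R j) x)\<^sup>2 \<le> 1" using cutoff_le_1[of "R j" x] cutoff_nonneg[of "R j" x] by (simp add: power_le_one)
        then have "(G j x)\<^sup>2 \<le> (g x)\<^sup>2" unfolding G_def power_mult_distrib by (intro mult_left_le_one_le) auto
        then have "\<bar>(G j x)\<^sup>2 + \<eta> j - (g x)\<^sup>2\<bar> \<le> (g x)\<^sup>2 + 1" using \<eta>[of j] zero_le_power2[of "G j x"] zero_le_power2[of "g x"] by linarith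
        then have "(1 + (norm x)\<^sup>2) * \<bar>(G j x)\<^sup>2 + \<eta> j - (g x)\<^sup>2\<bar> \<le> (1 + (norm x)\<^sup>2) * ((g x)\<^sup>2 + 1)"
          by (intro mult_left_mono) auto
        then show "norm ((1 + (norm x)\<^sup>2) * \<bar>(G j x)\<^sup>2 + \<eta> j - (g x)\<^sup>2\<bar>) \<le> (g x)\<^sup>2 + (norm x)\<^sup>2 * (g x)\<^sup>2 + 1 + (norm x)\<^sup>2"
          by (simp add: algebra_simps)
      qed
    qed measurable
    then show "(\<lambda>j. LINT x|std_gaussian. (1 + (norm x)\<^sup>2) * \<bar>(G j x)\<^sup>2 + \<eta> j - (g x)\<^sup>2\<bar>) \<longlonglongrightarrow> 0" by simp
  qed auto
qed

section \<open>From the stability inequality to the deficit\<close>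

text \<open>The weak gradient is seen through integrals only. This bridges \<open>f\<close> and the
  square of \<open>sqrt f\<close>, which agree just almost everywhere because a density may be
  negative on a null set.\<close>

lemma has_weak_gradient_cong_AE:
  fixes f g :: "'a::euclidean_space \<Rightarrow> real"
  assumes g: "has_weak_gradient g v" and [measurable]: "f \<in> borel_measurable borel" and ae: "AE x in lborel. f x = g x"
  shows "has_weak_gradient f v"
proof -
  have [measurable]: "g \<in> borel_measurable borel" using g by (auto simp: has_weak_gradient_def locally_integrable_def)
  show ?thesis
    unfolding has_weak_gradient_def
  proof (intro conjI allI impI ballI)
    show "locally_integrable f"
      unfolding locally_integrable_def set_integrable_def
    proof (intro conjI allI impI)
      fix K :: "'a set" assume K: "compact K"
      then have [measurable]: "K \<in> sets borel" by (simp add: compact_imp_closed)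
      have "integrable lborel (\<lambda>x. indicator K x *\<^sub>R g x)"
        using g K by (simp add: has_weak_gradient_def locally_integrable_def set_integrable_def)
      then show "integrable lborel (\<lambda>x. indicator K x *\<^sub>R f x)"
        by (rule integrable_cong_AE_imp) (use ae in auto)
    qed measurable
    show "locally_integrable v" using g by (simp add: has_weak_gradient_def)
    fix \<phi> :: "'a \<Rightarrow> real" and i :: 'a
    assume \<phi>: "test_function \<phi>" and i: "i \<in> Basis"
    have [measurable]: "grad \<phi> \<in> borel_measurable borel"
      using test_function_grad_continuous[OF \<phi>] by (rule borel_measurable_continuous_onI)
    have "(LINT x|lborel. f x * partial_deriv i \<phi> x) = (LINT x|lborel. g x * partial_deriv i \<phi> x)"
      unfolding grad_inner[OF i, symmetric] by (rule integral_cong_AE) (use ae in auto)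
    also have "\<dots> = - (LINT x|lborel. (v x \<bullet> i) * \<phi> x)"
      using g \<phi> i unfolding has_weak_gradient_def by blast
    finally show "(LINT x|lborel. f x * partial_deriv i \<phi> x) = - (LINT x|lborel. (v x \<bullet> i) * \<phi> x)" .
  qed
qed

text \<open>Mass 1 makes \<open>m * ln m\<close> vanish and centering removes the first moment, so
  the stability inequality for the square of \<open>sqrt f\<close> becomes a lower bound for the
  deficit. The second moment enters with a nonpositive coefficient and may be replaced by its bound
  \<open>M\<close>.\<close>

lemma deficit_bound:
  fixes f :: "'a::euclidean_space \<Rightarrow> real"
  assumes f: "gaussian_prob_density f" and cen: "centered (density std_gaussian (\<lambda>x. ennreal (f x)))"
    and W: "(\<lambda>x. sqrt (f x)) \<in> gaussian_W12"
    and mi: "integrable std_gaussian (\<lambda>x. (norm x)\<^sup>2 * f x)"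
    and M: "(LINT x|std_gaussian. (norm x)\<^sup>2 * f x) \<le> M"
    and \<theta>: "0 < \<theta>" "\<theta> < pi / 2" and \<mu>: "0 \<le> \<mu>"
    and \<kappa>_def: "\<kappa> = pi / 2 * gauss_mean_norm TYPE('a)"
  shows "integrable std_gaussian f"
    and "(cos \<theta>)\<^sup>2 / 2 * (2 * \<mu> * ((LINT x|std_gaussian. \<bar>f x - 1\<bar>) -
        \<kappa> * (cos \<theta> / sin \<theta> * gauss_mean_norm TYPE('a) * (1 + M))) - (\<kappa> * \<mu>)\<^sup>2) \<le> log_sobolev_deficit f"
proof -
  define g where "g = (\<lambda>x. sqrt (f x))"
  have [measurable]: "f \<in> borel_measurable borel" using f by (simp add: gaussian_prob_density_def)
  have [measurable]: "g \<in> borel_measurable borel" unfolding g_def by measurable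
  have f0: "AE x in std_gaussian. 0 \<le> f x" using f by (simp add: gaussian_prob_density_def)
  \<comment> \<open>For negative arguments \<open>sqrt\<close> is negative, so
    \<open>(g x)\<^sup>2\<close> is in fact \<open>\<bar>f x\<bar>\<close>; the identity needs the
    sign of \<open>f\<close>.\<close>
  have fg: "AE x in std_gaussian. f x = (g x)\<^sup>2" using f0 by eventually_elim (simp add: g_def)
  obtain v where v: "has_weak_gradient g v" "integrable std_gaussian (\<lambda>x. (norm (v x))\<^sup>2)"
    and g2: "integrable std_gaussian (\<lambda>x. (g x)\<^sup>2)"
    using W unfolding gaussian_W12_def g_def by blast
  have [measurable]: "v \<in> borel_measurable borel" using v by (auto simp: has_weak_gradient_def locally_integrable_def)
  show fi: "integrable std_gaussian f"
    by (rule integrable_cong_AE_imp[OF g2]) (use fg in \<open>auto elim: eventually_mono\<close>)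
  have f1: "(LINT x|std_gaussian. f x) = 1"
  proof -
    have "emeasure (density std_gaussian (\<lambda>x. ennreal (f x))) (space (density std_gaussian (\<lambda>x. ennreal (f x)))) = 1"
      using f unfolding gaussian_prob_density_def by (intro prob_space.emeasure_space_1) auto
    then have "(\<integral>\<^sup>+x. ennreal (f x) \<partial>std_gaussian) = 1"
      by (simp add: emeasure_density)
    moreover have "(\<integral>\<^sup>+x. ennreal (f x) \<partial>std_gaussian) = ennreal (LINT x|std_gaussian. f x)"
      using fi f0 by (rule nn_integral_eq_integral)
    ultimately show ?thesis by (simp add: ennreal_eq_1)
  qed
  have fx: "(LINT x|std_gaussian. f x *\<^sub>R x) = 0"
  proof -
    have "(LINT x|density std_gaussian (\<lambda>x. ennreal (f x)). x) = (LINT x|std_gaussian. f x *\<^sub>R x)"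
      by (rule integral_density) (use f0 in auto)
    then show ?thesis using cen by (simp add: centered_def)
  qed
  have g1: "(LINT x|std_gaussian. (g x)\<^sup>2) = 1"
    unfolding f1[symmetric] by (rule integral_cong_AE) (use fg in \<open>auto elim: eventually_mono\<close>)
  have gx: "(LINT x|std_gaussian. (g x)\<^sup>2 *\<^sub>R x) = 0"
    unfolding fx[symmetric] by (rule integral_cong_AE) (use fg in \<open>auto elim: eventually_mono\<close>)
  have gm: "integrable std_gaussian (\<lambda>x. (norm x)\<^sup>2 * (g x)\<^sup>2)"
    by (rule integrable_cong_AE_imp[OF mi]) (use fg in \<open>auto elim: eventually_mono\<close>)
  have gM: "(LINT x|std_gaussian. (norm x)\<^sup>2 * (g x)\<^sup>2) = (LINT x|std_gaussian. (norm x)\<^sup>2 * f x)"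
    by (rule integral_cong_AE) (use fg in \<open>auto elim: eventually_mono\<close>)
  have gN: "(LINT x|std_gaussian. \<bar>(g x)\<^sup>2 - 1\<bar>) = (LINT x|std_gaussian. \<bar>f x - 1\<bar>)"
    by (rule integral_cong_AE) (use fg in \<open>auto elim: eventually_mono\<close>)
  define J where "J = 4 * (LINT x|std_gaussian. (if g x = 0 then 0 else (norm (v x))\<^sup>2))"
  have fisher: "fisher_information f = J"
  proof -
    have "has_weak_gradient (\<lambda>x. (g x)\<^sup>2) (\<lambda>x. (2 * g x) *\<^sub>R v x)"
      using g2 v by (intro weak_gradient_square locally_integrable_if_gaussian) auto
    then have wf: "has_weak_gradient f (\<lambda>x. (2 * g x) *\<^sub>R v x)"
      by (rule has_weak_gradient_cong_AE) (use fg in \<open>auto simp: AE_std_gaussian_iff\<close>)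
    then have wf': "has_weak_gradient f (weak_gradient f)"
      unfolding weak_gradient_def by (rule someI[of "has_weak_gradient f"])
    then have [measurable]: "weak_gradient f \<in> borel_measurable borel"
      by (auto simp: has_weak_gradient_def locally_integrable_def)
    have "AE x in std_gaussian. weak_gradient f x = (2 * g x) *\<^sub>R v x"
      unfolding AE_std_gaussian_iff by (rule weak_gradient_unique[OF wf' wf])
    \<comment> \<open>Where \<open>g\<close> vanishes so does \<open>f\<close>, and division by 0
      gives 0 on the left, in accordance with the case distinction.\<close>
    then have "AE x in std_gaussian. (norm (weak_gradient f x))\<^sup>2 / f x = 4 * (if g x = 0 then 0 else (norm (v x))\<^sup>2)"
      using fg by eventually_elim (auto simp: power_mult_distrib)
    then have "fisher_information f = (LINT x|std_gaussian. 4 * (if g x = 0 then 0 else (norm (v x))\<^sup>2))"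
      unfolding fisher_information_def by (intro integral_cong_AE) auto
    then show ?thesis by (simp add: J_def)
  qed
  define H where "H = (LINT x|std_gaussian. (g x)\<^sup>2 * ln ((g x)\<^sup>2))"
  have ent: "relative_entropy f = H"
    unfolding relative_entropy_def H_def by (rule integral_cong_AE) (use fg in \<open>auto elim: eventually_mono\<close>)
  define S where "S = stab_rhs \<theta> \<mu> (\<lambda>x. (g x)\<^sup>2) J"
  have "stable (\<lambda>x. (g x)\<^sup>2) J"
    unfolding J_def by (rule stable_square[OF v(1) g2 v(2) gm]) (simp add: g1)
  then have nn: "(\<integral>\<^sup>+x. ennreal ((g x)\<^sup>2 * ln ((g x)\<^sup>2) + 2) \<partial>std_gaussian) \<le> ennreal (2 + S)"
    using \<theta> \<mu> by (simp add: stable_def S_def)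
  have ge1: "1 \<le> (g x)\<^sup>2 * ln ((g x)\<^sup>2) + 2" for x using x_ln_x_ge[of "(g x)\<^sup>2"] by simp
  \<comment> \<open>Integrability of the entropy density is a result here: the shifted integrand is
    positive and the stability inequality bounds its extended integral by a finite number.\<close>
  have int2: "integrable std_gaussian (\<lambda>x. (g x)\<^sup>2 * ln ((g x)\<^sup>2) + 2)"
  proof (rule integrableI_nonneg)
    show "AE x in std_gaussian. 0 \<le> (g x)\<^sup>2 * ln ((g x)\<^sup>2) + 2"
      by (intro AE_I2 order_trans[OF zero_le_one ge1])
    show "(\<integral>\<^sup>+x. ennreal ((g x)\<^sup>2 * ln ((g x)\<^sup>2) + 2) \<partial>std_gaussian) < \<infinity>"
      using nn by (auto intro: order.strict_trans1)
  qed measurable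
  then have int: "integrable std_gaussian (\<lambda>x. (g x)\<^sup>2 * ln ((g x)\<^sup>2))"
    using Bochner_Integration.integrable_diff[OF int2, of "\<lambda>_. 2"] by simp
  have "(\<integral>\<^sup>+x. ennreal ((g x)\<^sup>2 * ln ((g x)\<^sup>2) + 2) \<partial>std_gaussian) = ennreal (LINT x|std_gaussian. (g x)\<^sup>2 * ln ((g x)\<^sup>2) + 2)"
    using int2 by (rule nn_integral_eq_integral) (intro AE_I2 order_trans[OF zero_le_one ge1])
  also have "(LINT x|std_gaussian. (g x)\<^sup>2 * ln ((g x)\<^sup>2) + 2) = H + 2"
    using int by (simp add: H_def std_gaussian.prob_space[simplified])
  finally have le: "ennreal (H + 2) \<le> ennreal (2 + S)" using nn by simp
  \<comment> \<open>The map \<open>ennreal\<close> sends negative numbers to 0. Since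
    \<open>H + 2\<close> is at least 1, no truncation takes place and the inequality descends to
    real numbers.\<close>
  have "(LINT x|(std_gaussian :: 'a measure). 1) \<le> (LINT x|std_gaussian. (g x)\<^sup>2 * ln ((g x)\<^sup>2) + 2)"
    using int2 ge1 by (intro integral_mono) auto
  then have "1 \<le> H + 2" using int by (simp add: H_def std_gaussian.prob_space[simplified])
  with le have HS: "H \<le> S" by (cases "0 \<le> 2 + S") (auto simp: ennreal_neg not_le ennreal_le_iff2)
  define N where "N = (LINT x|std_gaussian. \<bar>f x - 1\<bar>)"
  define M2 where "M2 = (LINT x|std_gaussian. (norm x)\<^sup>2 * f x)"
  define K where "K = gauss_mean_norm TYPE('a)"
  have S_eq: "S = J / 2 - (cos \<theta>)\<^sup>2 / 2 * (2 * \<mu> * (N - \<kappa> * (cos \<theta> / sin \<theta> * K * (1 + M2))) - (\<kappa> * \<mu>)\<^sup>2)"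
    unfolding S_def stab_rhs_def Let_def g1 gx gM gN
    by (simp add: N_def M2_def K_def \<kappa>_def)
  have sc: "0 \<le> cos \<theta> / sin \<theta>" using \<theta> by (intro divide_nonneg_nonneg cos_ge_zero sin_ge_zero) auto
  have K0: "0 \<le> K" "0 \<le> \<kappa>" by (simp_all add: K_def \<kappa>_def gauss_mean_norm_nonneg)
  have "\<kappa> * (cos \<theta> / sin \<theta> * K * (1 + M2)) \<le> \<kappa> * (cos \<theta> / sin \<theta> * K * (1 + M))"
    using M sc K0 by (intro mult_left_mono mult_nonneg_nonneg) (auto simp: M2_def)
  then have "2 * \<mu> * (N - \<kappa> * (cos \<theta> / sin \<theta> * K * (1 + M))) \<le> 2 * \<mu> * (N - \<kappa> * (cos \<theta> / sin \<theta> * K * (1 + M2)))"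
    using \<mu> by (intro mult_left_mono) auto
  then have "(cos \<theta>)\<^sup>2 / 2 * (2 * \<mu> * (N - \<kappa> * (cos \<theta> / sin \<theta> * K * (1 + M))) - (\<kappa> * \<mu>)\<^sup>2) \<le>
      (cos \<theta>)\<^sup>2 / 2 * (2 * \<mu> * (N - \<kappa> * (cos \<theta> / sin \<theta> * K * (1 + M2))) - (\<kappa> * \<mu>)\<^sup>2)"
    by (intro mult_left_mono) auto
  also have "\<dots> \<le> J / 2 - H" using HS unfolding S_eq by linarith
  finally show "(cos \<theta>)\<^sup>2 / 2 * (2 * \<mu> * ((LINT x|std_gaussian. \<bar>f x - 1\<bar>) -
        \<kappa> * (cos \<theta> / sin \<theta> * gauss_mean_norm TYPE('a) * (1 + M))) - (\<kappa> * \<mu>)\<^sup>2) \<le> log_sobolev_deficit f"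
    by (simp add: log_sobolev_deficit_def fisher ent N_def K_def)
qed

text \<open>A Bochner integral of a non-integrable function is 0 and would meet the moment bound for
  free, hence the separate integrability assumption. The conclusion uses the extended nonnegative
  integral, which has no default value.\<close>

theorem theorem1p16:
  fixes f :: "nat \<Rightarrow> real ^ 'n \<Rightarrow> real" and M :: real
  assumes "M \<ge> real CARD('n)"
    and "\<And>k. gaussian_prob_density (f k)"
    and "\<And>k. centered (density std_gaussian (\<lambda>x. ennreal (f k x)))"
    and "\<And>k. (\<lambda>x. sqrt (f k x)) \<in> gaussian_W12"
    and "\<And>k. integrable std_gaussian (\<lambda>x. (norm x)\<^sup>2 * f k x)"
    and "\<And>k. (LINT x|std_gaussian. (norm x)\<^sup>2 * f k x) \<le> M"
    and "(\<lambda>k. log_sobolev_deficit (f k)) \<longlonglongrightarrow> 0"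
  shows "(\<lambda>k. \<integral>\<^sup>+x. ennreal \<bar>f k x - 1\<bar> \<partial>std_gaussian) \<longlonglongrightarrow> 0"
proof (rule tendsto_0_ennrealI)
  fix e :: real assume e: "0 < e"
  define K where "K = gauss_mean_norm TYPE(real ^ 'n)"
  define \<kappa> where "\<kappa> = pi / 2 * K"
  define N where "N k = (LINT x|std_gaussian. \<bar>f k x - 1\<bar>)" for k
  define B where "B = \<kappa> * (K * (1 + M))"
  have B: "0 \<le> B" using assms(1) by (auto simp: B_def \<kappa>_def K_def gauss_mean_norm_nonneg intro!: mult_nonneg_nonneg)
  \<comment> \<open>The tolerance is divided into thirds: one for the moment error
    \<open>B * t\<close>, one for the Young error \<open>\<kappa>\<^sup>2 * \<mu>\<close>, of which
    only half occurs, and one for the deficit. The summands 1 here and in \<mu> exclude division by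
    0.\<close>
  define t where "t = e / (3 * (B + 1))"
  \<comment> \<open>The angle with cotangent \<open>t\<close>, so the coefficient
    \<open>cos \<theta> / sin \<theta>\<close> in the bound becomes \<open>t\<close>. It depends on
    \<open>e\<close> and the moment bound, not on \<open>k\<close>.\<close>
  define \<theta> where "\<theta> = arctan (1 / t)"
  define \<mu> where "\<mu> = e / (3 * (\<kappa>\<^sup>2 + 1))"
  have t: "0 < t" using e B by (simp add: t_def)
  have \<mu>: "0 < \<mu>" using e by (simp add: \<mu>_def add_nonneg_pos)
  have \<theta>: "0 < \<theta>" "\<theta> < pi / 2" using t arctan_ubound[of "1 / t"] by (simp_all add: \<theta>_def)
  have "tan \<theta> = 1 / t" by (simp add: \<theta>_def tan_arctan)
  then have "inverse (tan \<theta>) = t" by simp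
  then have ct: "cos \<theta> / sin \<theta> = t" by (simp add: tan_def)
  have c: "0 < cos \<theta>" using \<theta> by (intro cos_gt_zero) auto
  \<comment> \<open>With the prefactor \<open>(cos \<theta>)\<^sup>2 / 2\<close> and the coefficient
    \<open>2 * \<mu>\<close> of \<open>N k\<close>, a deficit below \<open>d\<close> costs
    \<open>N k\<close> at most \<open>e / 3\<close>.\<close>
  define d where "d = (cos \<theta>)\<^sup>2 * \<mu> * (e / 3)"
  have "0 < d" using c \<mu> e by (simp add: d_def)
  then have "\<forall>\<^sub>F k in sequentially. log_sobolev_deficit (f k) < d"
    by (rule order_tendstoD(2)[OF assms(7)])
  then show "\<forall>\<^sub>F k in sequentially. (\<integral>\<^sup>+x. ennreal \<bar>f k x - 1\<bar> \<partial>std_gaussian) \<le> ennreal e"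
  proof eventually_elim
    case (elim k)
    note db = deficit_bound[OF assms(2-6)[of k] \<theta> less_imp_le[OF \<mu>] refl]
    have "(cos \<theta>)\<^sup>2 / 2 * (2 * \<mu> * (N k - B * t) - (\<kappa> * \<mu>)\<^sup>2) \<le> log_sobolev_deficit (f k)"
      using db(2) unfolding ct by (simp add: N_def B_def \<kappa>_def K_def mult_ac)
    with elim have "(cos \<theta>)\<^sup>2 / 2 * (2 * \<mu> * (N k - B * t) - (\<kappa> * \<mu>)\<^sup>2) < (cos \<theta>)\<^sup>2 / 2 * (2 * \<mu> * (e / 3))"
      by (simp add: d_def)
    then have "2 * \<mu> * (N k - B * t) - (\<kappa> * \<mu>)\<^sup>2 < 2 * \<mu> * (e / 3)" using c by simp
    then have "2 * \<mu> * (N k - B * t - \<kappa>\<^sup>2 * \<mu> / 2) < 2 * \<mu> * (e / 3)"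
      by (simp add: power2_eq_square algebra_simps)
    then have "N k - B * t - \<kappa>\<^sup>2 * \<mu> / 2 < e / 3"
      by (rule mult_left_less_imp_less) (use \<mu> in simp)
    moreover have "B * t \<le> e / 3" using B e by (simp add: t_def field_simps)
    moreover have "\<kappa>\<^sup>2 * \<mu> \<le> e / 3"
    proof -
      have "0 < \<kappa>\<^sup>2 + 1" by (simp add: add_nonneg_pos)
      then show ?thesis using e by (simp add: \<mu>_def field_simps)
    qed
    ultimately have "N k \<le> e" using e by linarith
    moreover have "(\<integral>\<^sup>+x. ennreal \<bar>f k x - 1\<bar> \<partial>std_gaussian) = ennreal (N k)"
      unfolding N_def using db(1) by (intro nn_integral_eq_integral) auto
    ultimately show ?case by (simp add: ennreal_leI)
  qed
qed

end
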